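(* Let $\mathcal{M}$ be a countably infinite graph. Then $\mathcal{M}$ is $\geq$$k$-homogeneous for some integer $k\geq 1$ if and only if exactly one of the following holds: (i) $\mathcal{M}$ is homogeneous; (ii) $\mathcal{M}$ is not $1$-homogeneous and there are a finite homogeneous graph $\mathcal{H}$ and some $t\in\mathbb{Z}^+$ such that $\mathcal{M}\cong \mathcal{G}_t\dot\cup\mathcal{H}$ or $\mathcal{M}\cong (\mathcal{G}_t\dot\cup\mathcal{H})^c$; (iii) $\mathcal{M}$ is $1$-homogeneous but not $2$-homogeneous and for some $t$ we have $\mathcal{M}\cong\mathcal{H}_{t,1}$, $\mathcal{M}\cong\mathcal{H}_{t,2}$, $\mathcal{M}\cong\mathcal{H}_{t,1}^c$ or $\mathcal{M}\cong\mathcal{H}_{t,2}^c$ (for those $t$ for which these graphs are defined).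
   Context: All subgraphs are induced subgraphs. An embedding of graphs is an injective map preserving both adjacency and non-adjacency. A graph $\mathcal{G}$ is $k$-homogeneous if for every induced subgraph $\mathcal{A}\subseteq\mathcal{G}$ with $|A|=k$ and every embedding $f:\mathcal{A}\to\mathcal{G}$, $f$ extends to an automorphism of $\mathcal{G}$. $\mathcal{G}$ is $\geq$$k$-homogeneous if it is $t$-homogeneous for every $t\geq k$; it is homogeneous if it is $t$-homogeneous for every $t\geq 1$. $\mathcal{G}^c$ denotes the complement graph and $\dot\cup$ the disjoint union (no edges between the two parts). For $t\in\mathbb{Z}^+$, $\mathcal{G}_t$ has vertex set $\mathbb{Z}\times\{1,\dots,t\}$ with $(a,i)$ adjacent to $(b,j)$ iff $a\neq b$. For $t\geq 2$, $\mathcal{H}_{t,1}$ has vertex set $\mathbb{Z}\times\{1,\dots,2t\}$ and edges $\{(a,i),(b,j)\}$ with ($i,j\leq t$ or $i,j>t$) and $a\neq b$; $\mathcal{H}_{t,2}$ has the same vertex set and edges those of $\mathcal{H}_{t,1}$ together with $\{(a,i),(b,j)\}$ for $i\leq t<j$ and $a=b$. $\mathcal{H}_{1,2}$ has vertex set $\mathbb{Z}\times\{1,2\}$ with $(a,i)$ adjacent to $(b,j)$ (distinct) iff $i=j$ or $a=b$. *)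

theory Defs
  imports Main "HOL-Library.Countable_Set"
begin

record 'v ugraph =
  verts :: "'v set"
  adj :: "'v \<Rightarrow> 'v \<Rightarrow> bool"

definition simple_graph :: "'v ugraph \<Rightarrow> bool" where
  "simple_graph G \<longleftrightarrow>
     (\<forall>x y. adj G x y \<longrightarrow> x \<in> verts G \<and> y \<in> verts G) \<and>
     (\<forall>x y. adj G x y \<longrightarrow> adj G y x) \<and>
     (\<forall>x. \<not> adj G x x)"

definition induced_subgraph :: "'v ugraph \<Rightarrow> 'v set \<Rightarrow> 'v ugraph" where
  "induced_subgraph G A = \<lparr>verts = A, adj = (\<lambda>x y. x \<in> A \<and> y \<in> A \<and> adj G x y)\<rparr>"

definition graph_embedding :: "('v \<Rightarrow> 'w) \<Rightarrow> 'v ugraph \<Rightarrow> 'w ugraph \<Rightarrow> bool" where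
  "graph_embedding f G H \<longleftrightarrow>
     inj_on f (verts G) \<and> f ` verts G \<subseteq> verts H \<and>
     (\<forall>x\<in>verts G. \<forall>y\<in>verts G. adj G x y \<longleftrightarrow> adj H (f x) (f y))"

definition graph_isomorphism :: "('v \<Rightarrow> 'w) \<Rightarrow> 'v ugraph \<Rightarrow> 'w ugraph \<Rightarrow> bool" where
  "graph_isomorphism f G H \<longleftrightarrow>
     bij_betw f (verts G) (verts H) \<and>
     (\<forall>x\<in>verts G. \<forall>y\<in>verts G. adj G x y \<longleftrightarrow> adj H (f x) (f y))"

definition graph_isomorphic :: "'v ugraph \<Rightarrow> 'w ugraph \<Rightarrow> bool" (infix "\<cong>\<^sub>g" 50) where
  "G \<cong>\<^sub>g H \<longleftrightarrow> (\<exists>f. graph_isomorphism f G H)"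

definition graph_automorphism :: "('v \<Rightarrow> 'v) \<Rightarrow> 'v ugraph \<Rightarrow> bool" where
  "graph_automorphism g G \<longleftrightarrow> graph_isomorphism g G G"

definition k_homogeneous :: "nat \<Rightarrow> 'v ugraph \<Rightarrow> bool" where
  "k_homogeneous k G \<longleftrightarrow>
     (\<forall>A f. A \<subseteq> verts G \<and> finite A \<and> card A = k \<and>
            graph_embedding f (induced_subgraph G A) G \<longrightarrow>
        (\<exists>g. graph_automorphism g G \<and> (\<forall>x\<in>A. g x = f x)))"

definition ge_k_homogeneous :: "nat \<Rightarrow> 'v ugraph \<Rightarrow> bool" where
  "ge_k_homogeneous k G \<longleftrightarrow> (\<forall>t\<ge>k. k_homogeneous t G)"

definition homogeneous :: "'v ugraph \<Rightarrow> bool" where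
  "homogeneous G \<longleftrightarrow> (\<forall>t\<ge>1. k_homogeneous t G)"

definition complement :: "'v ugraph \<Rightarrow> 'v ugraph" where
  "complement G =
     \<lparr>verts = verts G,
      adj = (\<lambda>x y. x \<in> verts G \<and> y \<in> verts G \<and> x \<noteq> y \<and> \<not> adj G x y)\<rparr>"

definition disjoint_union :: "'v ugraph \<Rightarrow> 'w ugraph \<Rightarrow> ('v + 'w) ugraph"
    (infixl "\<union>\<^sub>g" 65) where
  "G \<union>\<^sub>g H =
     \<lparr>verts = verts G <+> verts H,
      adj = (\<lambda>p q. case (p, q) of
                (Inl x, Inl y) \<Rightarrow> adj G x y
              | (Inr x, Inr y) \<Rightarrow> adj H x y
              | _ \<Rightarrow> False)\<rparr>"

definition graph_G :: "nat \<Rightarrow> (int \<times> nat) ugraph" where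
  "graph_G t =
     \<lparr>verts = UNIV \<times> {1..t},
      adj = (\<lambda>(a, i) (b, j). i \<in> {1..t} \<and> j \<in> {1..t} \<and> a \<noteq> b)\<rparr>"

text \<open>Only used for \<open>t \<ge> 2\<close>.\<close>

definition graph_H1 :: "nat \<Rightarrow> (int \<times> nat) ugraph" where
  "graph_H1 t =
     \<lparr>verts = UNIV \<times> {1..2 * t},
      adj = (\<lambda>(a, i) (b, j). i \<in> {1..2 * t} \<and> j \<in> {1..2 * t} \<and>
               (i \<le> t \<and> j \<le> t \<or> i > t \<and> j > t) \<and> a \<noteq> b)\<rparr>"

text \<open>
  Used for all \<open>t \<ge> 1\<close>. Edges are unordered pairs, so the condition on the additional edges
  is symmetrized. Lemma \<open>adj_graph_H2_1\<close> below shows that the case \<open>t = 1\<close>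
  is the graph on \<open>\<int> \<times> {1, 2}\<close> in which distinct \<open>(a, i)\<close> and \<open>(b, j)\<close>
  are adjacent iff \<open>i = j\<close> or \<open>a = b\<close>.
\<close>

definition graph_H2 :: "nat \<Rightarrow> (int \<times> nat) ugraph" where
  "graph_H2 t =
     \<lparr>verts = UNIV \<times> {1..2 * t},
      adj = (\<lambda>(a, i) (b, j). i \<in> {1..2 * t} \<and> j \<in> {1..2 * t} \<and>
               (adj (graph_H1 t) (a, i) (b, j) \<or>
                (i \<le> t \<and> t < j \<or> j \<le> t \<and> t < i) \<and> a = b))\<rparr>"

lemma verts_graph_H2_1: "verts (graph_H2 1) = UNIV \<times> {1, 2}"
  by (auto simp: graph_H2_def)

lemma adj_graph_H2_1:
  assumes "i \<in> {1, 2}" "j \<in> {1, 2}"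
  shows "adj (graph_H2 1) (a, i) (b, j) \<longleftrightarrow> (a, i) \<noteq> (b, j) \<and> (i = j \<or> a = b)"
  using assms by (auto simp: graph_H2_def graph_H1_def)

lemma simple_graph_complement: "simple_graph G \<Longrightarrow> simple_graph (complement G)"
  by (auto simp: simple_graph_def complement_def)

lemma simple_graph_disjoint_union:
  "simple_graph G \<Longrightarrow> simple_graph H \<Longrightarrow> simple_graph (G \<union>\<^sub>g H)"
  by (auto simp: simple_graph_def disjoint_union_def split: sum.splits)

lemma simple_graph_G: "simple_graph (graph_G t)"
  by (auto simp: simple_graph_def graph_G_def)

lemma simple_graph_H1: "simple_graph (graph_H1 t)"
  by (auto simp: simple_graph_def graph_H1_def)

lemma simple_graph_H2: "simple_graph (graph_H2 t)"
  by (auto simp: simple_graph_def graph_H2_def graph_H1_def)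

definition exactly_one_of_three :: "bool \<Rightarrow> bool \<Rightarrow> bool \<Rightarrow> bool" where
  "exactly_one_of_three P Q R \<longleftrightarrow>
     (P \<and> \<not> Q \<and> \<not> R) \<or> (\<not> P \<and> Q \<and> \<not> R) \<or> (\<not> P \<and> \<not> Q \<and> R)"

end

(*
  Suppose M is homogeneous for all sizes >= k but not for size r, and take r minimal. Then two
  vertices a, b have the same type over a set F of r - 1 vertices but lie in different orbits of
  the pointwise stabiliser of F. Two large homogeneous sets of the same type over F, one constant
  over a and one constant over b, cannot look alike, and with Ramsey's theorem this forces every
  infinite type over F to be joined almost completely to one of a, b and almost not at all to the
  other. For r = 1 this says that all degrees are finite or cofinite, with only finitely many of
  one kind, which gives (ii). For r = 2 the neighbourhoods of any two vertices agree or
  are complementary up to finite sets, which splits M into two halves and gives (iii). For r >= 3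
  all types over F are infinite, yet infinitely many vertices have almost the same neighbourhood,
  so by 2-homogeneity all adjacent (or all non-adjacent) vertices do, a contradiction.
*)
theory Submission
  imports Defs "HOL-Library.Ramsey"
begin

section \<open>Automorphisms and types\<close>

text \<open>Homogeneous sets of at least \<open>k\<close> vertices are useful because inside one
  type over \<open>F\<close> all their pairs look alike: any bijection between two of them, together
  with the identity on \<open>F\<close>, extends to an automorphism, and so does the map that also
  sends \<open>a\<close> to \<open>b\<close> when both relate constantly to their sets. The obstacle
  is that Ramsey alone allows mixed behaviour: \<open>a\<close> could meet the cliques of a type in
  one way and its independent sets in the other. Excluding this takes a maximality argument in which
  one homogeneous set keeps growing. Since cliques and independent sets play symmetric roles,
  adjacency values are carried as Booleans throughout. Wherever classes of vertices have to be
  identified, non-adjacency turns out to be an equivalence relation with classes of one finite size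
  \<open>t\<close> (after passing to the complement if necessary). The infinite graphs are therefore
  treated as blow-ups of small patterns; vertices of one class are interchangeable, so an embedding
  extends once the map it induces on the pattern does. The bounds for the converse make a set meet
  enough classes to contain a clique whose image must stay on one side.\<close>

lemma graph_isomorphism_comp:
  assumes "graph_isomorphism f G H" "graph_isomorphism g H K"
  shows "graph_isomorphism (g \<circ> f) G K"
proof -
  have b: "bij_betw f (verts G) (verts H)" "bij_betw g (verts H) (verts K)"
    using assms unfolding graph_isomorphism_def by blast+
  have "f x \<in> verts H" if "x \<in> verts G" for x
    using b(1) that by (rule bij_betwE[rule_format])
  then show ?thesis
    using assms bij_betw_trans[OF b] unfolding graph_isomorphism_def by simp
qed

lemma graph_isomorphism_inv_into:
  assumes "graph_isomorphism f G H"
  shows "graph_isomorphism (inv_into (verts G) f) H G"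
proof -
  have b: "bij_betw f (verts G) (verts H)"
    using assms unfolding graph_isomorphism_def by blast
  show ?thesis
    unfolding graph_isomorphism_def
  proof (intro conjI ballI)
    show "bij_betw (inv_into (verts G) f) (verts H) (verts G)"
      using b by (rule bij_betw_inv_into)
    fix x y assume xy: "x \<in> verts H" "y \<in> verts H"
    have *: "inv_into (verts G) f z \<in> verts G \<and> f (inv_into (verts G) f z) = z"
      if "z \<in> verts H" for z
      using b that by (metis bij_betw_imp_surj_on f_inv_into_f inv_into_into)
    show "adj H x y = adj G (inv_into (verts G) f x) (inv_into (verts G) f y)"
      using assms *[OF xy(1)] *[OF xy(2)] unfolding graph_isomorphism_def by metis
  qed
qed

lemma graph_isomorphic_sym: "G \<cong>\<^sub>g H \<Longrightarrow> H \<cong>\<^sub>g G"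
  unfolding graph_isomorphic_def using graph_isomorphism_inv_into by blast

lemma graph_isomorphism_complement:
  "graph_isomorphism f G H \<Longrightarrow> graph_isomorphism f (complement G) (complement H)"
  unfolding graph_isomorphism_def complement_def
  by (auto simp: bij_betw_def inj_on_def)

lemma graph_isomorphic_complement: "G \<cong>\<^sub>g H \<Longrightarrow> complement G \<cong>\<^sub>g complement H"
  unfolding graph_isomorphic_def using graph_isomorphism_complement by blast

lemma complement_complement: "simple_graph G \<Longrightarrow> complement (complement G) = (G :: 'v ugraph)"
  unfolding complement_def simple_graph_def
  by (cases G) (auto intro!: ext)

lemma verts_complement [simp]: "verts (complement G) = verts G"
  by (simp add: complement_def)

lemma adj_complement:
  "adj (complement G) x y \<longleftrightarrow> x \<in> verts G \<and> y \<in> verts G \<and> x \<noteq> y \<and> \<not> adj G x y"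
  by (simp add: complement_def)

lemma graph_embedding_complement:
  assumes "graph_embedding f (induced_subgraph (complement G) A) (complement G)"
    "A \<subseteq> verts G" "simple_graph G"
  shows "graph_embedding f (induced_subgraph G A) G"
proof -
  have f: "inj_on f A" "f ` A \<subseteq> verts G"
    and a: "\<forall>x\<in>A. \<forall>y\<in>A. adj (complement G) x y \<longleftrightarrow> adj (complement G) (f x) (f y)"
    using assms(1) unfolding graph_embedding_def induced_subgraph_def by auto
  have "adj G x y \<longleftrightarrow> adj G (f x) (f y)" if xy: "x \<in> A" "y \<in> A" for x y
  proof (cases "x = y")
    case True
    then show ?thesis using assms(3) unfolding simple_graph_def by blast
  next
    case False
    then have "f x \<noteq> f y" using f(1) xy unfolding inj_on_def by blast
    moreover have "f x \<in> verts G" "f y \<in> verts G" "x \<in> verts G" "y \<in> verts G"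
      using f(2) xy assms(2) by auto
    ultimately show ?thesis
      using a[rule_format, OF xy] False unfolding adj_complement by blast
  qed
  then show ?thesis
    using f unfolding graph_embedding_def induced_subgraph_def by auto
qed

lemma k_homogeneous_complement_if:
  assumes "simple_graph G" "k_homogeneous k G"
  shows "k_homogeneous k (complement G)"
  unfolding k_homogeneous_def
proof (intro allI impI; elim conjE)
  fix A f assume A: "A \<subseteq> verts (complement G)" "finite A" "card A = k"
    "graph_embedding f (induced_subgraph (complement G) A) (complement G)"
  then have "graph_embedding f (induced_subgraph G A) G"
    using graph_embedding_complement[OF _ _ assms(1)] by simp
  then obtain g where g: "graph_automorphism g G" "\<forall>x\<in>A. g x = f x"
    using assms(2) A(2,3) A(1)[unfolded verts_complement] unfolding k_homogeneous_def by blast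
  have "graph_automorphism g (complement G)"
    using g(1) graph_isomorphism_complement unfolding graph_automorphism_def by blast
  then show "\<exists>g. graph_automorphism g (complement G) \<and> (\<forall>x\<in>A. g x = f x)"
    using g(2) by blast
qed

lemma k_homogeneous_complement:
  "simple_graph G \<Longrightarrow> k_homogeneous k (complement G) \<longleftrightarrow> k_homogeneous k G"
  by (metis complement_complement k_homogeneous_complement_if simple_graph_complement)

lemma k_homogeneous_iso:
  assumes "G \<cong>\<^sub>g H" "k_homogeneous k G"
  shows "k_homogeneous k H"
  unfolding k_homogeneous_def
proof (intro allI impI; elim conjE)
  fix A f assume A: "A \<subseteq> verts H" "finite A" "card A = k"
    and f: "graph_embedding f (induced_subgraph H A) H"
  obtain i where i: "graph_isomorphism i G H"
    using assms(1) unfolding graph_isomorphic_def by blast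
  define j where "j = inv_into (verts G) i"
  have j: "graph_isomorphism j H G"
    unfolding j_def using i by (rule graph_isomorphism_inv_into)
  have ij: "i (j y) = y" if "y \<in> verts H" for y
    using i that unfolding j_def graph_isomorphism_def
    by (metis bij_betw_imp_surj_on f_inv_into_f)
  have jV: "j y \<in> verts G" if "y \<in> verts H" for y
    using j that unfolding graph_isomorphism_def bij_betw_def by blast
  have ja: "adj G (j x) (j y) = adj H x y" if "x \<in> verts H" "y \<in> verts H" for x y
    using j that unfolding graph_isomorphism_def by blast
  have inj: "inj_on j (verts H)"
    using j unfolding graph_isomorphism_def bij_betw_def by blast
  have fV: "f x \<in> verts H" if "x \<in> A" for x
    using f that unfolding graph_embedding_def induced_subgraph_def by auto
  have fa: "adj H (f x) (f y) = adj H x y" if "x \<in> A" "y \<in> A" for x y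
    using f that unfolding graph_embedding_def induced_subgraph_def by auto
  have fi: "inj_on f A"
    using f unfolding graph_embedding_def induced_subgraph_def by auto
  have iA: "i x \<in> A" if "x \<in> j ` A" for x
    using that ij A(1) by auto
  have "graph_embedding (j \<circ> f \<circ> i) (induced_subgraph G (j ` A)) G"
    unfolding graph_embedding_def induced_subgraph_def
  proof (simp, intro conjI ballI)
    show "inj_on (j \<circ> f \<circ> i) (j ` A)"
    proof (rule inj_onI)
      fix x y assume xy: "x \<in> j ` A" "y \<in> j ` A" "(j \<circ> f \<circ> i) x = (j \<circ> f \<circ> i) y"
      have "f (i x) = f (i y)"
        using inj_onD[OF inj] xy fV iA by auto
      then have "i x = i y" using inj_onD[OF fi] iA xy by blast
      moreover have "j (i z) = z" if "z \<in> j ` A" for z using that ij A(1) by auto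
      ultimately show "x = y" using xy by metis
    qed
    show "(\<lambda>x. j (f (i x))) ` j ` A \<subseteq> verts G"
      using iA fV jV by auto
    fix x y assume xy: "x \<in> A" "y \<in> A"
    then show "adj G (j x) (j y) = adj G (j (f (i (j x)))) (j (f (i (j y))))"
      using ij ja fa fV A(1) by (simp add: subset_iff)
  qed
  moreover have "j ` A \<subseteq> verts G" "finite (j ` A)" "card (j ` A) = k"
    using A jV inj by (auto simp: card_image inj_on_subset)
  ultimately obtain g where g: "graph_automorphism g G" "\<forall>x\<in>j ` A. g x = (j \<circ> f \<circ> i) x"
    using assms(2) unfolding k_homogeneous_def by blast
  have "graph_automorphism (i \<circ> g \<circ> j) H"
    using g(1) i j unfolding graph_automorphism_def
    by (meson graph_isomorphism_comp)
  moreover have "(i \<circ> g \<circ> j) x = f x" if "x \<in> A" for x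
    using g(2) that ij fV A(1) by (auto simp: subset_iff)
  ultimately show "\<exists>g. graph_automorphism g H \<and> (\<forall>x\<in>A. g x = f x)"
    by blast
qed

section \<open>Types over a vertex set, orbits of pointwise stabilisers, homogeneous sets\<close>

locale sgraph =
  fixes M :: "'v ugraph"
  assumes simple: "simple_graph M"
begin

abbreviation "V \<equiv> verts M"
abbreviation "E \<equiv> adj M"
abbreviation "Aut g \<equiv> graph_automorphism g M"

definition nb :: "'v \<Rightarrow> 'v set" where
  "nb x = {y. E x y}"

text \<open>The quantifier-free types over \<open>F\<close> realised outside \<open>F\<close>. Only
  subsets \<open>S\<close> of \<open>F\<close> give non-empty classes, so a finite \<open>F\<close>
  has finitely many types.\<close>

definition cls :: "'v set \<Rightarrow> 'v set \<Rightarrow> 'v set" where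
  "cls F S = {v \<in> V - F. nb v \<inter> F = S}"

text \<open>Lying in one orbit of the pointwise stabiliser of \<open>F\<close>; for
  \<open>F = {}\<close> these are the orbits of the full automorphism group.\<close>

definition conj_over :: "'v set \<Rightarrow> 'v \<Rightarrow> 'v \<Rightarrow> bool" where
  "conj_over F x y \<longleftrightarrow> (\<exists>g. Aut g \<and> (\<forall>e\<in>F. g e = e) \<and> g x = y)"

text \<open>Cliques for \<open>True\<close>, independent sets for \<open>False\<close>; the Boolean
  lets one argument serve both kinds.\<close>

definition mono_set :: "bool \<Rightarrow> 'v set \<Rightarrow> bool" where
  "mono_set p D \<longleftrightarrow> (\<forall>x\<in>D. \<forall>y\<in>D. x \<noteq> y \<longrightarrow> E x y = p)"

lemma E_sym: "E x y \<longleftrightarrow> E y x"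
  and E_irrefl [simp]: "\<not> E x x"
  and E_verts: "E x y \<Longrightarrow> x \<in> V \<and> y \<in> V"
  using simple unfolding simple_graph_def by blast+

lemma nb_subset: "nb x \<subseteq> V"
  unfolding nb_def using E_verts by blast

lemma in_nb [simp]: "y \<in> nb x \<longleftrightarrow> E x y"
  by (simp add: nb_def)

lemma cls_empty [simp]: "cls {} {} = V"
  by (simp add: cls_def)

lemma cls_subset: "cls F S \<subseteq> V"
  by (auto simp: cls_def)

lemma mono_set_subset: "mono_set p D \<Longrightarrow> D' \<subseteq> D \<Longrightarrow> mono_set p D'"
  unfolding mono_set_def by blast

lemma mono_set_insert:
  "mono_set p (insert x D) \<longleftrightarrow> mono_set p D \<and> (\<forall>y\<in>D. y \<noteq> x \<longrightarrow> E x y = p)"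
  unfolding mono_set_def using E_sym by (auto; metis)

lemma Aut_E: "Aut g \<Longrightarrow> x \<in> V \<Longrightarrow> y \<in> V \<Longrightarrow> E (g x) (g y) = E x y"
  and Aut_bij: "Aut g \<Longrightarrow> bij_betw g V V"
  unfolding graph_automorphism_def graph_isomorphism_def by blast+

lemma Aut_in: "Aut g \<Longrightarrow> x \<in> V \<Longrightarrow> g x \<in> V"
  using Aut_bij bij_betwE by blast

lemma Aut_inj: "Aut g \<Longrightarrow> inj_on g V"
  and Aut_image: "Aut g \<Longrightarrow> g ` V = V"
  using Aut_bij unfolding bij_betw_def by blast+

lemma Aut_eq_iff: "Aut g \<Longrightarrow> x \<in> V \<Longrightarrow> y \<in> V \<Longrightarrow> g x = g y \<longleftrightarrow> x = y"
  using Aut_inj by (meson inj_on_def)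

lemma Aut_id: "Aut id"
  unfolding graph_automorphism_def graph_isomorphism_def by auto

lemma Aut_comp: "Aut g \<Longrightarrow> Aut h \<Longrightarrow> Aut (h \<circ> g)"
  unfolding graph_automorphism_def by (rule graph_isomorphism_comp)

lemma Aut_inverse:
  assumes "Aut g"
  obtains h where "Aut h" "\<And>x. x \<in> V \<Longrightarrow> h (g x) = x" "\<And>x. x \<in> V \<Longrightarrow> g (h x) = x"
proof
  show "Aut (inv_into V g)"
    using assms unfolding graph_automorphism_def by (rule graph_isomorphism_inv_into)
  show "inv_into V g (g x) = x" if "x \<in> V" for x
    using Aut_inj[OF assms] that by simp
  show "g (inv_into V g x) = x" if "x \<in> V" for x
    using Aut_image[OF assms] that by (simp add: f_inv_into_f)
qed

lemma conj_over_sym: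
  assumes "conj_over F x y" "F \<subseteq> V" "x \<in> V"
  shows "conj_over F y x"
proof -
  obtain g where g: "Aut g" "\<forall>e\<in>F. g e = e" "g x = y"
    using assms(1) unfolding conj_over_def by blast
  obtain h where h: "Aut h" "\<And>x. x \<in> V \<Longrightarrow> h (g x) = x"
    using Aut_inverse[OF g(1)] by metis
  have "\<forall>e\<in>F. h e = e" using g(2) h(2) assms(2) by (metis subsetD)
  moreover have "h y = x" using g(3) h(2) assms(3) by blast
  ultimately show ?thesis unfolding conj_over_def using h(1) by blast
qed

lemma conj_over_trans: "conj_over F x y \<Longrightarrow> conj_over F y z \<Longrightarrow> conj_over F x z"
  unfolding conj_over_def by (metis Aut_comp comp_apply)

lemma Aut_image_rel:
  assumes "Aut g" "X \<subseteq> V" "g ` X = X" "x \<in> V"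
  shows "g ` {y \<in> X. E x y = q} = {y \<in> X. E (g x) y = q}"
proof (intro equalityI subsetI)
  fix z assume "z \<in> g ` {y \<in> X. E x y = q}"
  then show "z \<in> {y \<in> X. E (g x) y = q}" using assms Aut_E by auto
next
  fix z assume z: "z \<in> {y \<in> X. E (g x) y = q}"
  then obtain y where "y \<in> X" "z = g y" using assms(3) by auto
  then show "z \<in> g ` {y \<in> X. E x y = q}" using z assms Aut_E by auto
qed

lemma Aut_cls:
  assumes "Aut g" "\<forall>e\<in>F. g e = e" "F \<subseteq> V"
  shows "g ` cls F S = cls F S"
proof -
  have sub: "h ` cls F S \<subseteq> cls F S" if h: "Aut h" "\<forall>e\<in>F. h e = e" for h
  proof
    fix z assume "z \<in> h ` cls F S"
    then obtain v where v: "v \<in> V" "v \<notin> F" "nb v \<inter> F = S" "z = h v"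
      unfolding cls_def by blast
    have "h v \<notin> F"
    proof
      assume "h v \<in> F"
      then have "h (h v) = h v" using h by blast
      then have "h v = v" using Aut_eq_iff[OF h(1)] v(1) Aut_in[OF h(1)] by blast
      then show False using v \<open>h v \<in> F\<close> by simp
    qed
    moreover have "E (h v) e = E v e" if "e \<in> F" for e
      using Aut_E[OF h(1) v(1), of e] that h(2) assms(3) by auto
    ultimately show "z \<in> cls F S"
      using v Aut_in[OF h(1) v(1)] unfolding cls_def by auto
  qed
  obtain h where h: "Aut h" "\<And>x. x \<in> V \<Longrightarrow> h (g x) = x" "\<And>x. x \<in> V \<Longrightarrow> g (h x) = x"
    using Aut_inverse[OF assms(1)] by metis
  have "\<forall>e\<in>F. h e = e" using assms h(2) by (metis subsetD)
  then have "h ` cls F S \<subseteq> cls F S" using sub h(1) by blast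
  then have "cls F S \<subseteq> g ` cls F S"
  proof (intro subsetI)
    fix z assume z: "z \<in> cls F S" and hc: "h ` cls F S \<subseteq> cls F S"
    have "g (h z) = z" using h(3) z cls_subset by blast
    moreover have "h z \<in> cls F S" using hc z by blast
    ultimately show "z \<in> g ` cls F S" by (metis imageI)
  qed
  then show ?thesis using sub[OF assms(1,2)] by blast
qed

lemma ramsey_mono_set:
  assumes "infinite Z"
  obtains p Y where "Y \<subseteq> Z" "infinite Y" "mono_set p Y"
proof -
  define c where "c s = (if \<exists>x y. s = {x, y} \<and> E x y then 1 else 0 :: nat)" for s
  have c: "c {x, y} = (if E x y then 1 else 0)" for x y :: 'v
  proof -
    have "(\<exists>u v. {x, y} = {u, v} \<and> E u v) \<longleftrightarrow> E x y"
      using E_sym[of x y] by (auto simp: doubleton_eq_iff)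
    then show ?thesis by (simp add: c_def)
  qed
  have "\<forall>x\<in>Z. \<forall>y\<in>Z. x \<noteq> y \<longrightarrow> c {x, y} < 2"
    by (simp add: c)
  then obtain Y t where Y: "Y \<subseteq> Z" "infinite Y"
    and t: "\<forall>x\<in>Y. \<forall>y\<in>Y. x \<noteq> y \<longrightarrow> c {x, y} = t"
    using Ramsey2[of Z c 2, OF assms] by metis
  have "mono_set (t = 1) Y"
    unfolding mono_set_def
  proof (intro ballI impI)
    fix x y assume "x \<in> Y" "y \<in> Y" "x \<noteq> y"
    then have "t = (if E x y then 1 else 0)" using t c by metis
    then show "E x y = (t = 1)" by simp
  qed
  then show ?thesis using Y that by blast
qed

text \<open>A map that does not extend is reduced to moving one point: homogeneity for one size less
  gives an automorphism \<open>g\<close> agreeing with \<open>f\<close> on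
  \<open>F = A - {a}\<close>. Undoing \<open>g\<close> leaves the identity on \<open>F\<close> and
  takes \<open>a\<close> to \<open>b\<close>. An automorphism over \<open>F\<close> from
  \<open>a\<close> to \<open>b\<close>, followed by \<open>g\<close>, would extend
  \<open>f\<close>.\<close>

lemma non_homogeneous_witness:
  assumes "\<not> k_homogeneous r M" "r \<ge> 1" "r = 1 \<or> k_homogeneous (r - 1) M"
  obtains F Q a b where "finite F" "F \<subseteq> V" "card F = r - 1" "a \<in> cls F Q" "b \<in> cls F Q"
    "\<not> conj_over F a b"
proof -
  obtain A f where A: "A \<subseteq> V" "finite A" "card A = r"
    and f: "graph_embedding f (induced_subgraph M A) M"
    and no: "\<not> (\<exists>g. Aut g \<and> (\<forall>x\<in>A. g x = f x))"
    using assms(1) unfolding k_homogeneous_def by blast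
  have fV: "f x \<in> V" if "x \<in> A" for x
    using f that unfolding graph_embedding_def induced_subgraph_def by auto
  have fa: "E (f x) (f y) = E x y" if "x \<in> A" "y \<in> A" for x y
    using f that unfolding graph_embedding_def induced_subgraph_def by auto
  have fi: "inj_on f A"
    using f unfolding graph_embedding_def induced_subgraph_def by auto
  obtain a where a: "a \<in> A" using A assms(2) by fastforce
  define F where "F = A - {a}"
  have F: "finite F" "F \<subseteq> V" "card F = r - 1" "a \<notin> F" "F \<subseteq> A" "A = insert a F"
    using A a unfolding F_def by auto
  have "\<exists>g. Aut g \<and> (\<forall>x\<in>F. g x = f x)"
  proof (cases "r = 1")
    case True
    then have "F = {}" using F by simp
    then show ?thesis using Aut_id by blast
  next
    case False
    have "graph_embedding f (induced_subgraph M F) M"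
      using f F(5) unfolding graph_embedding_def induced_subgraph_def
      by (auto simp: inj_on_subset)
    then show ?thesis
      using assms(3) False F unfolding k_homogeneous_def by blast
  qed
  then obtain g where g: "Aut g" "\<forall>x\<in>F. g x = f x" by blast
  obtain h where h: "Aut h" "\<And>x. x \<in> V \<Longrightarrow> h (g x) = x" "\<And>x. x \<in> V \<Longrightarrow> g (h x) = x"
    using Aut_inverse[OF g(1)] by metis
  define b where "b = h (f a)"
  have bV: "b \<in> V" unfolding b_def using h(1) fV[OF a] Aut_in by blast
  have gb: "g b = f a" unfolding b_def using h(3) fV[OF a] by blast
  have "b \<notin> F"
  proof
    assume "b \<in> F"
    then have "f b = f a" using g gb by simp
    then show False using inj_onD[OF fi] \<open>b \<in> F\<close> F a by blast
  qed
  moreover have "E b e = E a e" if "e \<in> F" for e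
    using Aut_E[OF g(1) bV, of e] that gb g(2) fa[OF a, of e] F by auto
  ultimately have "b \<in> cls F (nb a \<inter> F)" unfolding cls_def using bV by auto
  moreover have "a \<in> cls F (nb a \<inter> F)" using F a A unfolding cls_def by auto
  moreover have "\<not> conj_over F a b"
  proof
    assume "conj_over F a b"
    then obtain u where u: "Aut u" "\<forall>e\<in>F. u e = e" "u a = b"
      unfolding conj_over_def by blast
    have "\<forall>x\<in>A. (g \<circ> u) x = f x" using u g gb F by auto
    then show False using no Aut_comp[OF u(1) g(1)] by blast
  qed
  ultimately show ?thesis using that F by blast
qed

end

section \<open>Extension of maps between large homogeneous sets, and the splitting of infinite
  types\<close>

locale ge_hom_graph = sgraph M for M :: "'v ugraph" +
  fixes k :: nat
  assumes ge_k: "ge_k_homogeneous k M"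
begin

lemma extend_embedding:
  assumes "finite A" "A \<subseteq> V" "card A \<ge> k" "inj_on f A" "f ` A \<subseteq> V"
    "\<And>x y. x \<in> A \<Longrightarrow> y \<in> A \<Longrightarrow> E x y = E (f x) (f y)"
  obtains g where "Aut g" "\<And>x. x \<in> A \<Longrightarrow> g x = f x"
proof -
  have "graph_embedding f (induced_subgraph M A) M"
    using assms(4-6) unfolding graph_embedding_def induced_subgraph_def by auto
  then have "\<exists>g. Aut g \<and> (\<forall>x\<in>A. g x = f x)"
    using ge_k assms(1-3) unfolding ge_k_homogeneous_def k_homogeneous_def by blast
  then show ?thesis using that by blast
qed

lemma cls_E: "a \<in> cls F Q \<Longrightarrow> b \<in> cls F Q \<Longrightarrow> e \<in> F \<Longrightarrow> E a e = E b e"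
  unfolding cls_def using in_nb by blast

text \<open>Any bijection from \<open>D\<close> to \<open>D'\<close> will do: within one type over
  \<open>F\<close> and one kind of homogeneous set all pairs look alike, so its union with the
  identity on \<open>F\<close> is an embedding of at least \<open>k\<close> vertices.\<close>

lemma extend_mono_sets:
  assumes F: "finite F" "F \<subseteq> V"
    and D: "D \<subseteq> cls F S" "D' \<subseteq> cls F S" "finite D" "finite D'" "card D = card D'" "card D \<ge> k"
      "mono_set p D" "mono_set p D'"
  obtains g where "Aut g" "\<forall>e\<in>F. g e = e" "g ` D = D'"
proof -
  obtain h where h: "bij_betw h D D'"
    using D by (meson finite_same_card_bij)
  define f where "f x = (if x \<in> F then x else h x)" for x
  have disj: "D \<inter> F = {}" "D' \<inter> F = {}" using D by (auto simp: cls_def)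
  have fD: "f x = h x" "h x \<in> D'" "x \<notin> F" if "x \<in> D" for x
    using that disj bij_betwE[OF h] unfolding f_def by auto
  have fF: "f x = x" if "x \<in> F" for x using that unfolding f_def by simp
  have inj: "inj_on f (F \<union> D)"
    unfolding inj_on_Un
  proof (intro conjI)
    show "inj_on f F" using fF by (simp add: inj_on_def)
    show "inj_on f D" using fD(1) bij_betw_imp_inj_on[OF h] by (simp add: inj_on_def)
    show "f ` (F - D) \<inter> f ` (D - F) = {}" using fF fD disj by fastforce
  qed
  have "E x y = E (f x) (f y)" if xy: "x \<in> F \<union> D" "y \<in> F \<union> D" for x y
  proof -
    have cross: "E u v = E (h u) v" if "u \<in> D" "v \<in> F" for u v
      using cls_E[of u F S "h u" v] that fD(2)[OF that(1)] D(1,2) by blast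
    consider "x \<in> F" "y \<in> F" | "x \<in> D" "y \<in> F" | "x \<in> F" "y \<in> D" | "x \<in> D" "y \<in> D"
      using xy by blast
    then show ?thesis
    proof cases
      case 4
      show ?thesis
      proof (cases "x = y")
        case False
        then have "h x \<noteq> h y" using 4 bij_betw_imp_inj_on[OF h] inj_onD by metis
        then show ?thesis using 4 False D(7,8) fD unfolding mono_set_def by metis
      qed simp
    qed (use fF fD cross E_sym in metis)+
  qed
  moreover have "finite (F \<union> D)" "F \<union> D \<subseteq> V" "card (F \<union> D) \<ge> k" "f ` (F \<union> D) \<subseteq> V"
  proof -
    show fin: "finite (F \<union> D)" using F D by blast
    show "F \<union> D \<subseteq> V" using F D cls_subset by blast
    show "card (F \<union> D) \<ge> k" using D(6) card_mono[OF fin, of D] by simp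
    have "D' \<subseteq> V" using D(2) cls_subset by blast
    then show "f ` (F \<union> D) \<subseteq> V" using fF fD F by auto
  qed
  ultimately obtain g where g: "Aut g" "\<And>x. x \<in> F \<union> D \<Longrightarrow> g x = f x"
    using extend_embedding[of "F \<union> D" f] inj by metis
  have "g ` D = h ` D" using g(2) fD by (auto simp: image_iff)
  then have "g ` D = D'" using bij_betw_imp_surj_on[OF h] by simp
  then show ?thesis using that g fF by (metis UnI1)
qed

text \<open>The map of \<open>extend_mono_sets\<close> with \<open>a\<close> sent to
  \<open>b\<close> in addition; equal types over \<open>F\<close> and the common value
  \<open>q\<close> keep it an embedding.\<close>

lemma conj_over_mono_sets:
  assumes F: "finite F" "F \<subseteq> V" and ab: "a \<in> cls F Q" "b \<in> cls F Q"
    and D: "D \<subseteq> cls F S" "D' \<subseteq> cls F S" "finite D" "finite D'" "card D = card D'" "card D \<ge> k"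
      "mono_set p D" "mono_set p D'"
    and aD: "a \<notin> D" "b \<notin> D'" "\<forall>d\<in>D. E a d = q" "\<forall>d\<in>D'. E b d = q"
  shows "conj_over F a b"
proof -
  obtain h where h: "bij_betw h D D'"
    using D by (meson finite_same_card_bij)
  define f where "f x = (if x \<in> F then x else if x = a then b else h x)" for x
  have disj: "D \<inter> F = {}" "D' \<inter> F = {}" "a \<notin> F" "b \<notin> F" using D ab by (auto simp: cls_def)
  have fD: "f x = h x" "h x \<in> D'" "x \<notin> F" if "x \<in> D" for x
    using that disj bij_betwE[OF h] aD unfolding f_def by auto
  have fF: "f x = x" if "x \<in> F" for x using that unfolding f_def by simp
  have fb: "f a = b" using disj unfolding f_def by simp
  have inj: "inj_on f (insert a (F \<union> D))"
  proof -
    have "inj_on f (F \<union> D)"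
      unfolding inj_on_Un
    proof (intro conjI)
      show "inj_on f F" using fF by (simp add: inj_on_def)
      show "inj_on f D" using fD(1) bij_betw_imp_inj_on[OF h] by (simp add: inj_on_def)
      show "f ` (F - D) \<inter> f ` (D - F) = {}" using fF fD disj by fastforce
    qed
    moreover have "b \<notin> f ` (F \<union> D)" using fF fD disj aD by auto
    ultimately show ?thesis using fb by (auto simp: inj_on_insert)
  qed
  have E1: "E x y = E (f x) (f y)" if xy: "x \<in> F \<union> D" "y \<in> F \<union> D" for x y
  proof -
    have cross: "E u v = E (h u) v" if "u \<in> D" "v \<in> F" for u v
      using cls_E[of u F S "h u" v] that fD(2)[OF that(1)] D(1,2) by blast
    consider "x \<in> F" "y \<in> F" | "x \<in> D" "y \<in> F" | "x \<in> F" "y \<in> D" | "x \<in> D" "y \<in> D"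
      using xy by blast
    then show ?thesis
    proof cases
      case 4
      show ?thesis
      proof (cases "x = y")
        case False
        then have "h x \<noteq> h y" using 4 bij_betw_imp_inj_on[OF h] inj_onD by metis
        then show ?thesis using 4 False D(7,8) fD unfolding mono_set_def by metis
      qed simp
    qed (use fF fD cross E_sym in metis)+
  qed
  have E2: "E a y = E b (f y)" if "y \<in> F \<union> D" for y
  proof (cases "y \<in> F")
    case True
    then show ?thesis using cls_E[OF ab] fF by metis
  next
    case False
    then show ?thesis using that aD fD by auto
  qed
  have "E x y = E (f x) (f y)" if xy: "x \<in> insert a (F \<union> D)" "y \<in> insert a (F \<union> D)" for x y
    using xy E1 E2 fb E_sym E_irrefl by (metis insertE)
  moreover have "finite (insert a (F \<union> D))" "insert a (F \<union> D) \<subseteq> V"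
    "card (insert a (F \<union> D)) \<ge> k" "f ` insert a (F \<union> D) \<subseteq> V"
  proof -
    show fin: "finite (insert a (F \<union> D))" using F D by blast
    show "insert a (F \<union> D) \<subseteq> V" using F D ab cls_subset by blast
    have "card D \<le> card (insert a (F \<union> D))" using fin by (intro card_mono) auto
    then show "card (insert a (F \<union> D)) \<ge> k" using D(6) by simp
    have "D' \<subseteq> V" "b \<in> V" using D(2) ab cls_subset by blast+
    then show "f ` insert a (F \<union> D) \<subseteq> V" using fF fD fb F by auto
  qed
  ultimately obtain g where g: "Aut g" "\<And>x. x \<in> insert a (F \<union> D) \<Longrightarrow> g x = f x"
    using extend_embedding[of "insert a (F \<union> D)" f] inj by metis
  then have "\<forall>e\<in>F. g e = e" "g a = b" using fF fb by auto
  then show ?thesis unfolding conj_over_def using g(1) by blast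
qed

text \<open>Size \<open>k\<close> is enough for extension to an automorphism. The vertex
  \<open>x\<close> is removed from \<open>R\<close> because it joins \<open>D\<close> as an extra
  point of the map.\<close>

definition hits :: "'v set \<Rightarrow> 'v \<Rightarrow> bool \<Rightarrow> bool \<Rightarrow> bool" where
  "hits R x p q \<longleftrightarrow>
     (\<exists>D\<subseteq>R - {x}. finite D \<and> card D = k \<and> mono_set p D \<and> (\<forall>d\<in>D. E x d = q))"

lemma hits_infinite:
  assumes "infinite Y" "Y \<subseteq> R" "mono_set p Y" "\<forall>y\<in>Y. E x y = q"
  shows "hits R x p q"
proof -
  have "infinite (Y - {x})" using assms(1) by simp
  then obtain D where D: "D \<subseteq> Y - {x}" "finite D" "card D = k"
    using infinite_arbitrarily_large by blast
  moreover have "mono_set p D" using mono_set_subset[OF assms(3)] D(1) by blast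
  ultimately show ?thesis
    unfolding hits_def using assms by (intro exI[of _ D]) auto
qed

lemma hits_mono_infinite:
  assumes "infinite Y" "Y \<subseteq> R" "mono_set p Y"
  shows "hits R x p True \<or> hits R x p False"
proof -
  have "Y = {y \<in> Y. E x y = True} \<union> {y \<in> Y. E x y = False}" by blast
  then have "infinite {y \<in> Y. E x y = True} \<or> infinite {y \<in> Y. E x y = False}"
    using assms(1) finite_UnI[of "{y \<in> Y. E x y = True}" "{y \<in> Y. E x y = False}"] by auto
  then obtain q where "infinite {y \<in> Y. E x y = q}" by blast
  then have "hits R x p q"
    by (rule hits_infinite) (use assms(2) mono_set_subset[OF assms(3)] in auto)
  then show ?thesis by (cases q) auto
qed

lemma hits_exclusive:
  assumes "finite F" "F \<subseteq> V" "a \<in> cls F Q" "b \<in> cls F Q" "\<not> conj_over F a b"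
  shows "\<not> (hits (cls F S) a p q \<and> hits (cls F S) b p q)"
proof
  assume *: "hits (cls F S) a p q \<and> hits (cls F S) b p q"
  obtain D where D: "D \<subseteq> cls F S - {a}" "finite D" "card D = k" "mono_set p D" "\<forall>d\<in>D. E a d = q"
    using * unfolding hits_def by blast
  obtain D' where D': "D' \<subseteq> cls F S - {b}" "finite D'" "card D' = k" "mono_set p D'"
    "\<forall>d\<in>D'. E b d = q"
    using * unfolding hits_def by blast
  have "conj_over F a b"
    by (rule conj_over_mono_sets[of F a Q b D S D' p q]) (use assms D D' in auto)
  then show False using assms by blast
qed

text \<open>
  A maximality argument: among the \<open>\<not> s\<close>-homogeneous sets choose one in which \<open>a\<close> has as many
  \<open>q\<close>-partners as possible, and enlarge it by an element of an \<open>s\<close>-homogeneous set.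
\<close>

lemma hits_alternative:
  assumes F: "finite F" "F \<subseteq> V"
    and n1: "\<not> hits (cls F S) a s (\<not> q)" and n2: "\<not> hits (cls F S) a (\<not> s) q"
    and inf: "\<And>n. \<exists>J D. J \<subseteq> cls F S \<and> D \<subseteq> cls F S \<and> finite J \<and> finite D \<and> card J = n \<and> card D = n \<and>
      J \<inter> D = {} \<and> mono_set (\<not> s) J \<and> mono_set s D \<and> (\<forall>j\<in>J. \<forall>d\<in>D. E j d = (\<not> s))"
  shows False
proof -
  let ?R = "cls F S"
  \<comment> \<open>The margin over \<open>k\<close> ensures that a set as large as \<open>J\<close>
    keeps \<open>k\<close> elements after the removal of \<open>a\<close>.\<close>
  define P where "P J \<longleftrightarrow> J \<subseteq> ?R - {a} \<and> finite J \<and> mono_set (\<not> s) J \<and> card J \<ge> k + 2" for J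
  define m where "m J = card {j \<in> J. E a j = q}" for J
  have bound: "m J < k" if "P J" for J
  proof (rule ccontr)
    assume "\<not> m J < k"
    then have "k \<le> card {j \<in> J. E a j = q}" unfolding m_def by simp
    from obtain_subset_with_card_n[OF this]
    obtain J' where J': "J' \<subseteq> {j \<in> J. E a j = q}" "card J' = k" "finite J'" .
    then have "hits ?R a (\<not> s) q"
      unfolding hits_def using that mono_set_subset[of "\<not> s" J J'] unfolding P_def
      by (intro exI[of _ J']) auto
    then show False using n2 by blast
  qed
  obtain J0 where "J0 \<subseteq> ?R" "finite J0" "card J0 = k + 3" "mono_set (\<not> s) J0"
    using inf[of "k + 3"] by blast
  then have "P (J0 - {a})"
    unfolding P_def using mono_set_subset[of "\<not> s" J0 "J0 - {a}"]
    by (auto simp: card_Diff_singleton_if)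
  then obtain J where J: "P J" "\<And>J'. P J' \<Longrightarrow> m J' \<le> m J"
    using bound by (metis ex_has_greatest_nat less_imp_le)
  obtain J1 D1 where JD1: "J1 \<subseteq> ?R" "D1 \<subseteq> ?R" "finite J1" "finite D1" "card J1 = card J"
    "card D1 = card J" "J1 \<inter> D1 = {}" "mono_set (\<not> s) J1" "mono_set s D1"
    "\<forall>j\<in>J1. \<forall>d\<in>D1. E j d = (\<not> s)"
    using inf[of "card J"] by blast
  \<comment> \<open>Moving \<open>J1\<close> onto the maximal \<open>J\<close> carries along
    \<open>D1\<close>, whose image is an \<open>s\<close>-homogeneous set each element of which can
    be added to \<open>J\<close>.\<close>
  obtain g where g: "Aut g" "\<forall>e\<in>F. g e = e" "g ` J1 = J"
    by (rule extend_mono_sets[of F J1 S J "\<not> s"]) (use F JD1 J(1) in \<open>auto simp: P_def\<close>)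
  have gR: "g ` ?R = ?R" using Aut_cls g F by blast
  have RV: "?R \<subseteq> V" by (rule cls_subset)
  define D where "D = g ` D1"
  have inj: "inj_on g ?R" using Aut_inj[OF g(1)] RV inj_on_subset by blast
  have cD: "card D = card J" "finite D"
    unfolding D_def using JD1 inj by (auto simp: card_image inj_on_subset)
  have D: "D \<subseteq> ?R" unfolding D_def using gR JD1(2) by blast
  have sD: "mono_set s D"
    unfolding mono_set_def D_def
  proof (intro ballI impI)
    fix x y assume "x \<in> g ` D1" "y \<in> g ` D1" "x \<noteq> y"
    then obtain u v where "u \<in> D1" "v \<in> D1" "u \<noteq> v" "x = g u" "y = g v" by blast
    then show "E x y = s"
      using JD1(2,9) RV Aut_E[OF g(1), of u v] unfolding mono_set_def by blast
  qed
  have JD: "J \<inter> D = {}"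
    unfolding g(3)[symmetric] D_def
    using inj_on_image_Int[OF inj JD1(1,2)] JD1(7) by simp
  have cr: "E j d = (\<not> s)" if jd: "j \<in> J" "d \<in> D" for j d
  proof -
    obtain u v where "u \<in> J1" "v \<in> D1" "j = g u" "d = g v"
      using jd g(3) unfolding D_def by blast
    then show ?thesis using JD1(1,2,10) RV Aut_E[OF g(1), of u v] by blast
  qed
  \<comment> \<open>Otherwise \<open>D - {a}\<close> would be a pattern forbidden by
    \<open>n1\<close>. Adding such a \<open>d\<close> to \<open>J\<close> raises \<open>m\<close> by
    one, against maximality.\<close>
  have "\<exists>d\<in>D - {a}. E a d = q"
  proof (rule ccontr)
    assume no: "\<not> (\<exists>d\<in>D - {a}. E a d = q)"
    have "card (D - {a}) \<ge> k"
      using cD J(1) unfolding P_def by (auto simp: card_Diff_singleton_if)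
    then obtain D' where "D' \<subseteq> D - {a}" "card D' = k" "finite D'"
      using obtain_subset_with_card_n by blast
    then have "hits ?R a s (\<not> q)"
      unfolding hits_def using mono_set_subset[OF sD, of D'] no D by (intro exI[of _ D']) blast
    then show False using n1 by blast
  qed
  then obtain d where d: "d \<in> D" "d \<noteq> a" "E a d = q" by blast
  have "mono_set (\<not> s) (insert d J)"
    unfolding mono_set_insert using J(1) cr[OF _ d(1)] E_sym unfolding P_def by metis
  moreover have "d \<notin> J" using JD d by blast
  ultimately have "P (insert d J)"
    using J(1) d D unfolding P_def by auto
  moreover have "{j \<in> insert d J. E a j = q} = insert d {j \<in> J. E a j = q}" using d by blast
  then have "m (insert d J) = Suc (m J)"
    unfolding m_def using \<open>d \<notin> J\<close> J(1) unfolding P_def by simp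
  ultimately show False using J(2) by fastforce
qed

text \<open>Infinitely many elements of \<open>C\<close> have the same trace on \<open>2 * n\<close>
  chosen elements of \<open>I\<close>, and this trace is constant on at least \<open>n\<close> of
  them. The value may depend on \<open>n\<close>, but it also serves all smaller sizes, so one of
  the two values serves every \<open>n\<close>.\<close>

lemma bipartite_homogeneous:
  assumes "infinite C" "infinite I" "mono_set s C" "mono_set (\<not> s) I"
  obtains c where "\<And>n. \<exists>J D. J \<subseteq> I \<and> D \<subseteq> C \<and> finite J \<and> finite D \<and> card J = n \<and> card D = n \<and>
      J \<inter> D = {} \<and> mono_set (\<not> s) J \<and> mono_set s D \<and> (\<forall>j\<in>J. \<forall>d\<in>D. E j d = c)"
proof -
  define T where "T c n \<longleftrightarrow> (\<exists>J D. J \<subseteq> I \<and> D \<subseteq> C \<and> finite J \<and> finite D \<and> card J = n \<and> card D = n \<and>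
      J \<inter> D = {} \<and> mono_set (\<not> s) J \<and> mono_set s D \<and> (\<forall>j\<in>J. \<forall>d\<in>D. E j d = c))" for c n
  have ex: "\<exists>c. T c n" for n
  proof -
    obtain J0 where J0: "J0 \<subseteq> I" "finite J0" "card J0 = 2 * n"
      using infinite_arbitrarily_large[OF assms(2)] by blast
    have "infinite (C - J0)" using assms(1) J0 by simp
    moreover have "finite ((\<lambda>x. nb x \<inter> J0) ` (C - J0))"
      by (rule finite_subset[of _ "Pow J0"]) (use J0 in auto)
    ultimately obtain x0 where x0: "infinite {x \<in> C - J0. nb x \<inter> J0 = nb x0 \<inter> J0}"
      using pigeonhole_infinite[of "C - J0" "\<lambda>x. nb x \<inter> J0"] by blast
    obtain D where D: "D \<subseteq> {x \<in> C - J0. nb x \<inter> J0 = nb x0 \<inter> J0}" "finite D" "card D = n"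
      using infinite_arbitrarily_large[OF x0, of n] by metis
    have "J0 = {j \<in> J0. E x0 j = True} \<union> {j \<in> J0. E x0 j = False}" by blast
    then have "2 * n \<le> card {j \<in> J0. E x0 j = True} + card {j \<in> J0. E x0 j = False}"
      using J0(3) card_Un_le by metis
    then have "n \<le> card {j \<in> J0. E x0 j = True} \<or> n \<le> card {j \<in> J0. E x0 j = False}"
      by linarith
    then have "\<exists>c. n \<le> card {j \<in> J0. E x0 j = c}" by blast
    then obtain c where "n \<le> card {j \<in> J0. E x0 j = c}" by blast
    then obtain J where J: "J \<subseteq> {j \<in> J0. E x0 j = c}" "card J = n" "finite J"
      using obtain_subset_with_card_n by blast
    have "E j d = c" if "j \<in> J" "d \<in> D" for j d
    proof -
      have "j \<in> nb d \<longleftrightarrow> j \<in> nb x0" using that D(1) J(1) by blast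
      then show ?thesis using that J(1) E_sym by auto
    qed
    moreover have "J \<subseteq> I" "D \<subseteq> C" "J \<inter> D = {}" using J(1) D(1) J0(1) by auto
    moreover from this have "mono_set (\<not> s) J" "mono_set s D"
      using assms(3,4) mono_set_subset by blast+
    ultimately have "T c n"
      unfolding T_def using J(2,3) D(2,3) by - (rule exI[of _ J], rule exI[of _ D], simp)
    then show ?thesis by blast
  qed
  have mono: "T c m" if "T c n" "m \<le> n" for c m n
  proof -
    obtain J D where JD: "J \<subseteq> I" "D \<subseteq> C" "finite J" "finite D" "card J = n" "card D = n"
      "J \<inter> D = {}" "mono_set (\<not> s) J" "mono_set s D" "\<forall>j\<in>J. \<forall>d\<in>D. E j d = c"
      using \<open>T c n\<close> unfolding T_def by blast
    obtain J' where J': "J' \<subseteq> J" "card J' = m" "finite J'"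
      using obtain_subset_with_card_n[of m J] \<open>m \<le> n\<close> JD(5) by metis
    obtain D' where D': "D' \<subseteq> D" "card D' = m" "finite D'"
      using obtain_subset_with_card_n[of m D] \<open>m \<le> n\<close> JD(6) by metis
    have "mono_set (\<not> s) J'" "mono_set s D'"
      using JD(8,9) J'(1) D'(1) mono_set_subset by blast+
    moreover have "J' \<subseteq> I" "D' \<subseteq> C" "J' \<inter> D' = {}" "\<forall>j\<in>J'. \<forall>d\<in>D'. E j d = c"
      using J'(1) D'(1) JD(1,2,7,10) by blast+
    ultimately show ?thesis
      unfolding T_def using J'(2,3) D'(2,3) by - (rule exI[of _ J'], rule exI[of _ D'], simp)
  qed
  have "\<exists>c. \<forall>n. T c n"
  proof (rule ccontr)
    assume "\<nexists>c. \<forall>n. T c n"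
    then obtain n1 n2 where "\<not> T True n1" "\<not> T False n2" by blast
    then have "\<not> T c (max n1 n2)" for c
      using mono[of c "max n1 n2"] by (cases c) auto
    then show False using ex by blast
  qed
  then show ?thesis using that unfolding T_def by blast
qed

text \<open>Large constantly joined pairs exist by \<open>bipartite_homogeneous\<close>. Whatever
  the joining value, it is the one that allows elements of one of the two sets to be added to the
  other, as \<open>hits_alternative\<close> requires.\<close>

lemma no_split_pattern:
  assumes F: "finite F" "F \<subseteq> V"
    and n1: "\<not> hits (cls F S) a s (\<not> q)" and n2: "\<not> hits (cls F S) a (\<not> s) q"
    and "infinite C" "infinite I" "mono_set s C" "mono_set (\<not> s) I" "C \<subseteq> cls F S" "I \<subseteq> cls F S"
  shows False
proof -
  obtain c where c: "\<And>n. \<exists>J D. J \<subseteq> I \<and> D \<subseteq> C \<and> finite J \<and> finite D \<and> card J = n \<and> card D = n \<and>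
      J \<inter> D = {} \<and> mono_set (\<not> s) J \<and> mono_set s D \<and> (\<forall>j\<in>J. \<forall>d\<in>D. E j d = c)"
    using bipartite_homogeneous[OF assms(5-8)] by blast
  show False
  proof (cases "c = s")
    case False
    then have "c = (\<not> s)" by blast
    show False
    proof (rule hits_alternative[OF F n1 n2])
      fix n
      obtain J D where JD: "J \<subseteq> I" "D \<subseteq> C" "finite J" "finite D" "card J = n" "card D = n"
        "J \<inter> D = {}" "mono_set (\<not> s) J" "mono_set s D" "\<forall>j\<in>J. \<forall>d\<in>D. E j d = c"
        using c[of n] by blast
      then show "\<exists>J D. J \<subseteq> cls F S \<and> D \<subseteq> cls F S \<and> finite J \<and> finite D \<and> card J = n \<and> card D = n \<and>
        J \<inter> D = {} \<and> mono_set (\<not> s) J \<and> mono_set s D \<and> (\<forall>j\<in>J. \<forall>d\<in>D. E j d = (\<not> s))"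
        using assms(9,10) \<open>c = (\<not> s)\<close>
        by - (rule exI[of _ J], rule exI[of _ D], auto)
    qed
  next
    case True
    \<comment> \<open>Here elements of \<open>J\<close> can be added to \<open>D\<close>; this is
      the same situation with \<open>s\<close> and \<open>q\<close> negated and the two sets
      exchanged.\<close>
    have n1': "\<not> hits (cls F S) a (\<not> s) (\<not> \<not> q)" and n2': "\<not> hits (cls F S) a (\<not> \<not> s) (\<not> q)"
      using n1 n2 by simp_all
    show False
    proof (rule hits_alternative[OF F n1' n2'])
      fix n
      obtain J D where JD: "J \<subseteq> I" "D \<subseteq> C" "finite J" "finite D" "card J = n" "card D = n"
        "J \<inter> D = {}" "mono_set (\<not> s) J" "mono_set s D" "\<forall>j\<in>J. \<forall>d\<in>D. E j d = c"
        using c[of n] by blast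
      then show "\<exists>J D. J \<subseteq> cls F S \<and> D \<subseteq> cls F S \<and> finite J \<and> finite D \<and> card J = n \<and> card D = n \<and>
        J \<inter> D = {} \<and> mono_set (\<not> \<not> s) J \<and> mono_set (\<not> s) D \<and> (\<forall>j\<in>J. \<forall>d\<in>D. E j d = (\<not> \<not> s))"
      proof -
        have "\<forall>j\<in>D. \<forall>d\<in>J. E j d = s" using JD(10) True E_sym by metis
        moreover have "D \<inter> J = {}" "J \<subseteq> cls F S" "D \<subseteq> cls F S" using JD assms(9,10) by blast+
        ultimately show ?thesis
          using JD(3-6,8,9) by - (rule exI[of _ D], rule exI[of _ J], simp)
      qed
    qed
  qed
qed

text \<open>For each kind of homogeneous set that occurs infinitely in the type, \<open>a\<close>
  has one value and \<open>b\<close> the opposite one. \<open>no_split_pattern\<close> forbids these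
  values to be reversed between the two kinds, so a single \<open>q\<close> serves, and by Ramsey
  only finitely many vertices can deviate from it.\<close>

lemma almost_split:
  assumes F: "finite F" "F \<subseteq> V" and ab: "a \<in> cls F Q" "b \<in> cls F Q" "\<not> conj_over F a b"
    and inf: "infinite (cls F S)"
  obtains q where "finite {x \<in> cls F S. E a x \<noteq> q}" "finite {x \<in> cls F S. E b x = q}"
proof -
  let ?R = "cls F S"
  have excl: "\<not> (hits ?R a p q \<and> hits ?R b p q)" for p q
    using hits_exclusive[OF F ab] .
  obtain p Y where Y: "Y \<subseteq> ?R" "infinite Y" "mono_set p Y"
    using ramsey_mono_set[OF inf] by metis
  \<comment> \<open>Each of \<open>a\<close> and \<open>b\<close> hits at least one value by
    \<open>hits_mono_infinite\<close>, and they share none, so the two values are divided between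
    them.\<close>
  have decide: "\<exists>q. hits ?R a p' q \<and> \<not> hits ?R a p' (\<not> q) \<and> hits ?R b p' (\<not> q) \<and> \<not> hits ?R b p' q"
    if "Z \<subseteq> ?R" "infinite Z" "mono_set p' Z" for p' Z
  proof (cases "hits ?R a p' True")
    case True
    then show ?thesis
      using hits_mono_infinite[OF that(2,1,3), of b] excl[of p' True] excl[of p' False]
      by (intro exI[of _ True]) auto
  next
    case False
    then show ?thesis
      using hits_mono_infinite[OF that(2,1,3), of a] hits_mono_infinite[OF that(2,1,3), of b]
        excl[of p' True] excl[of p' False]
      by (intro exI[of _ False]) auto
  qed
  obtain q where q: "\<not> hits ?R a p (\<not> q)" "\<not> hits ?R b p q"
    using decide[OF Y] by blast
  \<comment> \<open>The mixed behaviour: sets of kind \<open>p\<close> assign \<open>q\<close> to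
    \<open>a\<close>, those of the other kind assign it the opposite value.\<close>
  have main: False
    if Z: "Z \<subseteq> ?R" "infinite Z" "mono_set (\<not> p) Z"
      and h: "hits ?R a (\<not> p) (\<not> q) \<or> hits ?R b (\<not> p) q" for Z
  proof -
    have "\<not> hits ?R a (\<not> p) q"
      using decide[OF Z] h excl[of "\<not> p" q] excl[of "\<not> p" "\<not> q"]
      by (cases q) (auto simp: all_bool_eq ex_bool_eq)
    then show False
      using no_split_pattern[OF F q(1) _ Y(2) Z(2) Y(3) Z(3) Y(1) Z(1)] by blast
  qed
  \<comment> \<open>An infinite set of deviating vertices contains an infinite homogeneous one. It
    cannot be of kind \<open>p\<close>, so it is of the other kind and leads to
    \<open>main\<close>.\<close>
  have gen: "finite {x \<in> ?R. E z x = q'}"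
    if z: "\<not> hits ?R z p q'" "hits ?R z (\<not> p) q' \<Longrightarrow> hits ?R a (\<not> p) (\<not> q) \<or> hits ?R b (\<not> p) q"
    for z q'
  proof (rule ccontr)
    assume "infinite {x \<in> ?R. E z x = q'}"
    then obtain p' Z where Z: "Z \<subseteq> {x \<in> ?R. E z x = q'}" "infinite Z" "mono_set p' Z"
      using ramsey_mono_set by metis
    then have "hits ?R z p' q'"
      by (intro hits_infinite[of Z]) auto
    moreover from this z(1) have "p' = (\<not> p)" by (cases p; cases p') auto
    ultimately show False using main[of Z] Z z(2) by auto
  qed
  show ?thesis
  proof (rule that[of q])
    show "finite {x \<in> ?R. E a x \<noteq> q}" using gen[of a "\<not> q"] q(1) by simp
    show "finite {x \<in> ?R. E b x = q}" using gen[of b q] q(2) by simp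
  qed
qed

end

section \<open>Consequences of homogeneity for one size; neighbourhoods compared up to finite
  sets\<close>

context sgraph
begin

lemma homogeneous_extend:
  assumes "k_homogeneous s M" "finite A" "A \<subseteq> V" "card A = s" "inj_on f A" "f ` A \<subseteq> V"
    "\<And>x y. x \<in> A \<Longrightarrow> y \<in> A \<Longrightarrow> E x y = E (f x) (f y)"
  obtains g where "Aut g" "\<And>x. x \<in> A \<Longrightarrow> g x = f x"
proof -
  have "graph_embedding f (induced_subgraph M A) M"
    using assms(5-7) unfolding graph_embedding_def induced_subgraph_def by auto
  then have "\<exists>g. Aut g \<and> (\<forall>x\<in>A. g x = f x)"
    using assms(1-4) unfolding k_homogeneous_def by blast
  then show ?thesis using that by blast
qed

lemma homogeneous_transitive:
  assumes "k_homogeneous 1 M" "x \<in> V" "y \<in> V"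
  obtains g where "Aut g" "g x = y"
proof -
  obtain g where "Aut g" "\<And>z. z \<in> {x} \<Longrightarrow> g z = y"
    by (rule homogeneous_extend[of 1 "{x}" "\<lambda>_. y"]) (use assms in auto)
  then show ?thesis using that by blast
qed

lemma homogeneous_pair:
  assumes "k_homogeneous 2 M" "x \<in> V" "y \<in> V" "u \<in> V" "v \<in> V" "x \<noteq> y" "u \<noteq> v" "E x y = E u v"
  obtains g where "Aut g" "g x = u" "g y = v"
proof -
  obtain g where "Aut g" "\<And>z. z \<in> {x, y} \<Longrightarrow> g z = (if z = x then u else v)"
    by (rule homogeneous_extend[of 2 "{x, y}" "\<lambda>z. if z = x then u else v"])
      (use assms E_sym in auto)
  then show ?thesis using that assms(6) by auto
qed

lemma homogeneous_conj_over:
  assumes "k_homogeneous (Suc (card F)) M" "finite F" "F \<subseteq> V" "a \<in> cls F Q" "b \<in> cls F Q"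
  shows "conj_over F a b"
proof -
  have aF: "a \<notin> F" "b \<notin> F" "a \<in> V" "b \<in> V" using assms by (auto simp: cls_def)
  have ab: "E a e = E b e" if "e \<in> F" for e
  proof -
    have "e \<in> nb a \<inter> F \<longleftrightarrow> e \<in> nb b \<inter> F" using assms(4,5) by (simp add: cls_def)
    then show ?thesis using that by simp
  qed
  define f where "f x = (if x = a then b else x)" for x
  have ff: "f a = b" "\<And>e. e \<in> F \<Longrightarrow> f e = e" using aF unfolding f_def by auto
  have fin: "finite (insert a F)" "insert a F \<subseteq> V" "card (insert a F) = Suc (card F)"
    using assms(2,3) aF by auto
  have inj: "inj_on f (insert a F)"
    using aF ff by (auto simp: inj_on_def)
  have img: "f ` insert a F \<subseteq> V" using ff aF assms(3) by auto
  have "E x y = E (f x) (f y)" if "x \<in> insert a F" "y \<in> insert a F" for x y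
    using that ff ab E_sym E_irrefl by (metis insertE)
  from homogeneous_extend[OF assms(1) fin inj img this]
  obtain g where "Aut g" "\<And>x. x \<in> insert a F \<Longrightarrow> g x = f x" by metis
  then show ?thesis unfolding conj_over_def using ff by auto
qed

definition par :: "'v \<Rightarrow> 'v \<Rightarrow> bool" where
  "par x y \<longleftrightarrow> finite {v \<in> V. E x v \<noteq> E y v}"

text \<open>With \<open>par\<close> this obeys the rule of signs: two \<open>anti\<close> steps give
  \<open>par\<close>, a mixed pair gives \<open>anti\<close>. If all pairs are comparable,
  \<open>par\<close> has at most two classes.\<close>

definition anti :: "'v \<Rightarrow> 'v \<Rightarrow> bool" where
  "anti x y \<longleftrightarrow> finite {v \<in> V. E x v = E y v}"

lemma par_refl: "par x x"
  by (simp add: par_def)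

lemma par_sym: "par x y \<longleftrightarrow> par y x"
proof -
  have "{v \<in> V. E x v \<noteq> E y v} = {v \<in> V. E y v \<noteq> E x v}" by blast
  then show ?thesis unfolding par_def by simp
qed

lemma anti_sym: "anti x y \<longleftrightarrow> anti y x"
proof -
  have "{v \<in> V. E x v = E y v} = {v \<in> V. E y v = E x v}" by blast
  then show ?thesis unfolding anti_def by simp
qed

lemma par_trans: "par x y \<Longrightarrow> par y z \<Longrightarrow> par x z"
  unfolding par_def
  by (rule finite_subset[of _ "{v \<in> V. E x v \<noteq> E y v} \<union> {v \<in> V. E y v \<noteq> E z v}"]) auto

lemma par_anti: "par x y \<Longrightarrow> anti y z \<Longrightarrow> anti x z"
  unfolding par_def anti_def
  by (rule finite_subset[of _ "{v \<in> V. E x v \<noteq> E y v} \<union> {v \<in> V. E y v = E z v}"]) auto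

lemma anti_anti: "anti x y \<Longrightarrow> anti y z \<Longrightarrow> par x z"
  unfolding par_def anti_def
  by (rule finite_subset[of _ "{v \<in> V. E x v = E y v} \<union> {v \<in> V. E y v = E z v}"]) auto

lemma par_not_anti: "infinite V \<Longrightarrow> par x y \<Longrightarrow> \<not> anti x y"
proof
  assume "infinite V" "par x y" "anti x y"
  then have "finite ({v \<in> V. E x v \<noteq> E y v} \<union> {v \<in> V. E x v = E y v})"
    unfolding par_def anti_def by (intro finite_UnI)
  then have "finite V" by (rule rev_finite_subset) blast
  then show False using \<open>infinite V\<close> by blast
qed

text \<open>The Boolean covers both relations at once: \<open>True\<close> gives the set that
  defines \<open>anti\<close>, \<open>False\<close> the one that defines \<open>par\<close>.\<close>

lemma Aut_relation:
  assumes "Aut g" "x \<in> V" "y \<in> V"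
  shows "{v \<in> V. E (g x) v = (E (g y) v = q)} = g ` {v \<in> V. E x v = (E y v = q)}"
proof (intro equalityI subsetI)
  fix z assume z: "z \<in> {v \<in> V. E (g x) v = (E (g y) v = q)}"
  then have "z \<in> g ` V" using Aut_image[OF assms(1)] by simp
  then obtain v where v: "v \<in> V" "z = g v" by blast
  have "E (g x) z = E x v" "E (g y) z = E y v"
    unfolding v(2) using Aut_E[OF assms(1)] assms(2,3) v(1) by blast+
  then show "z \<in> g ` {v \<in> V. E x v = (E y v = q)}" using z v by auto
next
  fix z assume "z \<in> g ` {v \<in> V. E x v = (E y v = q)}"
  then obtain v where v: "v \<in> V" "z = g v" "E x v = (E y v = q)" by blast
  have "E (g x) z = E x v" "E (g y) z = E y v"
    unfolding v(2) using Aut_E[OF assms(1)] assms(2,3) v(1) by blast+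
  then show "z \<in> {v \<in> V. E (g x) v = (E (g y) v = q)}"
    using v Aut_in[OF assms(1)] by simp
qed

lemma par_Aut:
  assumes "Aut g" "x \<in> V" "y \<in> V"
  shows "par (g x) (g y) \<longleftrightarrow> par x y"
proof -
  have *: "{v \<in> V. E (g x) v \<noteq> E (g y) v} = g ` {v \<in> V. E x v \<noteq> E y v}"
    using Aut_relation[OF assms, of False] by simp
  have "inj_on g {v \<in> V. E x v \<noteq> E y v}"
    using Aut_inj[OF assms(1)] by (rule inj_on_subset) blast
  then show ?thesis unfolding par_def * by (rule finite_image_iff)
qed

lemma anti_Aut:
  assumes "Aut g" "x \<in> V" "y \<in> V"
  shows "anti (g x) (g y) \<longleftrightarrow> anti x y"
proof -
  have *: "{v \<in> V. E (g x) v = E (g y) v} = g ` {v \<in> V. E x v = E y v}"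
    using Aut_relation[OF assms, of True] by simp
  have "inj_on g {v \<in> V. E x v = E y v}"
    using Aut_inj[OF assms(1)] by (rule inj_on_subset) blast
  then show ?thesis unfolding anti_def * by (rule finite_image_iff)
qed

end

section \<open>A first failure at size three or more is impossible\<close>

context ge_hom_graph
begin

text \<open>Apart from \<open>e\<close>, the type \<open>W\<close> over \<open>F - {e}\<close> is
  the union of the two types in the conclusion. If one were finite, \<open>almost_split\<close> on
  the other would relate \<open>a\<close> by \<open>q\<close> to almost all of \<open>W\<close> and
  \<open>b\<close> by \<open>q\<close> to almost none, although an automorphism over
  \<open>F - {e}\<close> takes \<open>a\<close> to \<open>b\<close> and preserves
  \<open>W\<close>.\<close>

lemma infinite_cls_split:
  assumes F: "finite F" "F \<subseteq> V" and ab: "a \<in> cls F Q" "b \<in> cls F Q" "\<not> conj_over F a b"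
    and e: "e \<in> F" "conj_over (F - {e}) a b"
    and S: "infinite (cls F S)"
  shows "infinite (cls F (S - {e})) \<and> infinite (cls F (insert e S))"
proof -
  define W where "W = cls (F - {e}) (S - {e})"
  have S_sub: "S \<subseteq> F"
  proof -
    obtain v where "v \<in> cls F S" using S by (metis finite.emptyI ex_in_conv)
    then show ?thesis unfolding cls_def by blast
  qed
  have W1: "W \<subseteq> {e} \<union> cls F (S - {e}) \<union> cls F (insert e S)"
    unfolding W_def cls_def using e(1) S_sub by auto
  have W2: "cls F (S - {e}) \<subseteq> W" "cls F (insert e S) \<subseteq> W" "cls F S \<subseteq> W"
    unfolding W_def cls_def by auto
  have Winf: "infinite W" using S W2(3) finite_subset by blast
  obtain g where g: "Aut g" "\<forall>e'\<in>F - {e}. g e' = e'" "g a = b"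
    using e(2) unfolding conj_over_def by blast
  have gW: "g ` W = W"
    unfolding W_def using Aut_cls[OF g(1,2)] F by blast
  have aV: "a \<in> V" using ab(1) cls_subset by blast
  have WV: "W \<subseteq> V" unfolding W_def by (rule cls_subset)
  have split: False if T: "finite (W - cls F T)" "cls F T \<subseteq> W" for T
  proof -
    have inf: "infinite (cls F T)"
    proof
      assume "finite (cls F T)"
      from finite_UnI[OF this T(1)] have "finite W" by (rule rev_finite_subset) blast
      then show False using Winf by blast
    qed
    obtain q where q: "finite {x \<in> cls F T. E a x \<noteq> q}" "finite {x \<in> cls F T. E b x = q}"
      by (rule almost_split[OF F ab inf])
    have "finite {x \<in> W. E a x = (\<not> q)}"
      by (rule finite_subset[OF _ finite_UnI[OF q(1) T(1)]]) auto
    then have "finite (g ` {x \<in> W. E a x = (\<not> q)})" by simp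
    then have "finite {x \<in> W. E b x = (\<not> q)}"
      unfolding Aut_image_rel[OF g(1) WV gW aV] g(3) .
    moreover have "finite {x \<in> W. E b x = q}"
      by (rule finite_subset[OF _ finite_UnI[OF q(2) T(1)]]) auto
    ultimately have "finite ({x \<in> W. E b x = (\<not> q)} \<union> {x \<in> W. E b x = q})" by (intro finite_UnI)
    then have "finite W" by (rule rev_finite_subset) blast
    then show False using Winf by blast
  qed
  have "infinite (cls F (S - {e}))"
  proof
    assume *: "finite (cls F (S - {e}))"
    have "finite (W - cls F (insert e S))"
      by (rule finite_subset[of _ "{e} \<union> cls F (S - {e})"]) (use W1 * in auto)
    then show False using split W2 by blast
  qed
  moreover have "infinite (cls F (insert e S))"
  proof
    assume *: "finite (cls F (insert e S))"
    have "finite (W - cls F (S - {e}))"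
      by (rule finite_subset[of _ "{e} \<union> cls F (insert e S)"]) (use W1 * in auto)
    then show False using split W2 by blast
  qed
  ultimately show ?thesis by blast
qed

lemma V_cover: "V \<subseteq> F \<union> (\<Union>S\<in>Pow F. cls F S)"
proof
  fix v assume "v \<in> V"
  then have "v \<in> F \<or> v \<in> cls F (nb v \<inter> F)" by (simp add: cls_def)
  moreover have "nb v \<inter> F \<in> Pow F" by blast
  ultimately show "v \<in> F \<union> (\<Union>S\<in>Pow F. cls F S)" by blast
qed

text \<open>Some type is infinite, since finitely many types cover \<open>V\<close> up to
  \<open>F\<close>. By \<open>infinite_cls_split\<close>, infinity passes up to the type
  \<open>F\<close> by adding elements one at a time, and from there down to any \<open>S\<close> by
  removing them.\<close>

lemma infinite_all_cls:
  assumes V: "infinite V" and F: "finite F" "F \<subseteq> V"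
    and ab: "a \<in> cls F Q" "b \<in> cls F Q" "\<not> conj_over F a b"
    and conj: "\<And>e. e \<in> F \<Longrightarrow> conj_over (F - {e}) a b"
    and S: "S \<subseteq> F"
  shows "infinite (cls F S)"
proof -
  note split = infinite_cls_split[OF F ab _ conj]
  have "\<exists>S0. S0 \<subseteq> F \<and> infinite (cls F S0)"
  proof (rule ccontr)
    assume "\<nexists>S0. S0 \<subseteq> F \<and> infinite (cls F S0)"
    then have "finite (\<Union>S0\<in>Pow F. cls F S0)" using F(1) by (intro finite_UN_I) auto
    moreover have "V \<subseteq> F \<union> (\<Union>S0\<in>Pow F. cls F S0)" by (rule V_cover)
    ultimately show False using V F(1) by (meson finite_UnI finite_subset)
  qed
  then obtain S0 where S0: "S0 \<subseteq> F" "infinite (cls F S0)" by blast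
  have "infinite (cls F (T \<union> S0))" if "finite T" "T \<subseteq> F" for T
    using that
  proof (induction T rule: finite_induct)
    case (insert e T)
    then show ?case using split[of e "T \<union> S0"] by auto
  qed (use S0 in simp)
  then have FF: "infinite (cls F F)" using F(1) S0(1) by (metis sup.absorb1 order_refl)
  have "infinite (cls F (F - T))" if "finite T" "T \<subseteq> F" for T
    using that
  proof (induction T rule: finite_induct)
    case (insert e T)
    then have "infinite (cls F (F - T - {e}))" using split[of e "F - T"] by auto
    then show ?case by (metis Diff_insert)
  qed (use FF in simp)
  then have "infinite (cls F (F - (F - S)))" using F(1) by blast
  then show ?thesis using S by (simp add: double_diff)
qed

text \<open>The contradiction is between spreading and separating: 2-homogeneity spreads
  \<open>par\<close> from one pair to all pairs with the same adjacency, which makes two elements of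
  \<open>F\<close> \<open>par\<close> to each other, while an infinite type over \<open>F\<close>
  tells them apart.\<close>

lemma no_late_failure:
  assumes V: "infinite V" and F: "finite F" "F \<subseteq> V" "card F \<ge> 2"
    and ab: "a \<in> cls F Q" "b \<in> cls F Q" "\<not> conj_over F a b"
    and hom: "k_homogeneous (card F) M" "k_homogeneous 2 M"
  shows False
proof -
  have abV: "a \<in> V" "b \<in> V" using ab cls_subset by blast+
  have conj: "conj_over (F - {e}) a b" if "e \<in> F" for e
  proof (rule homogeneous_conj_over)
    have "Suc (card (F - {e})) = card F" using that F(1) by (metis card_Suc_Diff1)
    then show "k_homogeneous (Suc (card (F - {e}))) M" using hom(1) by simp
    show "a \<in> cls (F - {e}) (Q - {e})" "b \<in> cls (F - {e}) (Q - {e})"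
      using ab(1,2) unfolding cls_def by auto
  qed (use F in auto)
  note inf = infinite_all_cls[OF V F(1,2) ab conj]
  have Qinf: "infinite (cls F Q)" using inf[of Q] ab(1) unfolding cls_def by blast
  have abc: "\<not> conj_over F z a \<or> \<not> conj_over F z b" if "z \<in> V" for z
    using ab(3) conj_over_sym[OF _ F(2) that] conj_over_trans by blast
  \<comment> \<open>For \<open>z\<close> in the type of \<open>a\<close> and \<open>b\<close> this
    determines the neighbourhood up to a finite set, because \<open>z\<close> fails to be conjugate
    to one of them and so is almost constant on every type. There are finitely many values.\<close>
  define pat where "pat z = {S \<in> Pow F. finite {x \<in> cls F S. \<not> E z x}}" for z
  have pat: "finite {x \<in> cls F S. E z x}" if "z \<in> cls F Q" "S \<subseteq> F" "S \<notin> pat z" for z S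
  proof -
    have zV: "z \<in> V" using that cls_subset by blast
    obtain c where c: "c \<in> cls F Q" "\<not> conj_over F z c"
      using abc[OF zV] ab(1,2) by blast
    have "infinite (cls F S)" using inf \<open>S \<subseteq> F\<close> by simp
    then obtain q where "finite {x \<in> cls F S. E z x \<noteq> q}"
      using almost_split[OF F(1,2) \<open>z \<in> cls F Q\<close> c] by metis
    then show ?thesis
      using \<open>S \<subseteq> F\<close> \<open>S \<notin> pat z\<close> unfolding pat_def by (cases q) auto
  qed
  have "finite (pat ` cls F Q)"
    by (rule finite_subset[of _ "Pow (Pow F)"]) (use F(1) in \<open>auto simp: pat_def\<close>)
  then obtain z0 where "infinite {z \<in> cls F Q. pat z = pat z0}"
    using pigeonhole_infinite[OF Qinf] by metis
  then obtain p Z where Z: "Z \<subseteq> {z \<in> cls F Q. pat z = pat z0}" "infinite Z" "mono_set p Z"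
    using ramsey_mono_set by metis
  obtain z where z: "z \<in> Z" using Z(2) by (metis finite.emptyI ex_in_conv)
  have "infinite (Z - {z})" using Z(2) by simp
  then obtain z' where z': "z' \<in> Z" "z' \<noteq> z" by (metis finite.emptyI ex_in_conv DiffE singletonI)
  have zQ: "z \<in> cls F Q" "z' \<in> cls F Q" and zpat: "pat z = pat z'" using Z(1) z z' by auto
  have zV: "z \<in> V" "z' \<in> V" using zQ cls_subset by blast+
  have "finite {x \<in> cls F S. E z x \<noteq> E z' x}" if "S \<subseteq> F" for S
  proof (cases "S \<in> pat z")
    case True
    then have "finite {x \<in> cls F S. \<not> E z x}" "finite {x \<in> cls F S. \<not> E z' x}"
      using zpat unfolding pat_def by blast+
    from finite_UnI[OF this] show ?thesis by (rule rev_finite_subset) blast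
  next
    case False
    then have "finite {x \<in> cls F S. E z x}" "finite {x \<in> cls F S. E z' x}"
      using pat zQ that zpat by blast+
    from finite_UnI[OF this] show ?thesis by (rule rev_finite_subset) blast
  qed
  then have "finite (F \<union> (\<Union>S\<in>Pow F. {x \<in> cls F S. E z x \<noteq> E z' x}))"
    using F(1) by blast
  then have "par z z'"
    unfolding par_def by (rule rev_finite_subset) (use V_cover[of F] in blast)
  moreover have "E z z' = p" using Z(3) z z' unfolding mono_set_def by metis
  ultimately have par: "par x y" if "x \<in> V" "y \<in> V" "x \<noteq> y" "E x y = p" for x y
    using homogeneous_pair[OF hom(2) zV that(1,2)] z'(2) that par_Aut zV by metis
  obtain e1 e2 where e: "e1 \<in> F" "e2 \<in> F" "e1 \<noteq> e2"
  proof -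
    have "\<not> card F \<le> Suc 0" using F(3) by simp
    then show thesis using that card_le_Suc0_iff_eq[OF F(1)] by blast
  qed
  \<comment> \<open>The type whose members relate by \<open>p\<close> to every element of
    \<open>F\<close>; such a \<open>v\<close> is \<open>par\<close> to \<open>e1\<close> and to
    \<open>e2\<close>.\<close>
  define T where "T = (if p then F else {})"
  have "infinite (cls F T)" using inf[of T] unfolding T_def by simp
  then obtain v where v: "v \<in> cls F T" by (metis finite.emptyI ex_in_conv)
  have vE: "E v e' = p" "v \<noteq> e'" if "e' \<in> F" for e'
  proof -
    have "v \<notin> F" "nb v \<inter> F = T" using v by (simp_all add: cls_def)
    then have "v \<notin> F" "E v e' \<longleftrightarrow> e' \<in> T" using that by auto
    then show "E v e' = p" "v \<noteq> e'" using that unfolding T_def by (cases p; auto)+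
  qed
  have "v \<in> V" "e1 \<in> V" "e2 \<in> V" using v e F(2) cls_subset by blast+
  then have "par v e1" "par v e2" using par vE e by blast+
  then have "par e1 e2" using par_sym par_trans by blast
  moreover have "cls F {e1} \<subseteq> {x \<in> V. E e1 x \<noteq> E e2 x}"
  proof
    fix x assume "x \<in> cls F {e1}"
    then have x: "x \<in> V" "nb x \<inter> F = {e1}" by (simp_all add: cls_def)
    have "e1 \<in> nb x \<inter> F" "e2 \<notin> nb x \<inter> F" unfolding x(2) using e by auto
    then have "e1 \<in> nb x" "e2 \<notin> nb x" using e by blast+
    then show "x \<in> {x \<in> V. E e1 x \<noteq> E e2 x}" using x E_sym by simp
  qed
  ultimately have "finite (cls F {e1})" unfolding par_def by (rule rev_finite_subset)
  then show False using inf[of "{e1}"] e by simp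
qed

end

section \<open>Blow-ups of graphs by independent sets\<close>

text \<open>The whole index type is the vertex set of the pattern \<open>W\<close>, and
  \<open>c\<close> names the fibre of a vertex. Vertices of one fibre are interchangeable.\<close>

definition blow_up :: "('i \<Rightarrow> 'i \<Rightarrow> bool) \<Rightarrow> nat \<Rightarrow> ('v \<Rightarrow> 'i) \<Rightarrow> 'v ugraph \<Rightarrow> bool" where
  "blow_up W t c G \<longleftrightarrow>
     (\<forall>i. card {x \<in> verts G. c x = i} = t) \<and>
     (\<forall>x\<in>verts G. \<forall>y\<in>verts G. adj G x y \<longleftrightarrow> W (c x) (c y))"

text \<open>Inside the finite union \<open>U\<close> of \<open>A\<close> and its image both have
  complements of equal size, so \<open>f\<close> extends to a permutation of \<open>U\<close>;
  outside \<open>U\<close> the identity is used.\<close>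

lemma extend_partial_injection:
  assumes "finite A" "A \<subseteq> X" "inj_on f A" "f ` A \<subseteq> X"
  obtains g where "bij_betw g X X" "\<And>x. x \<in> A \<Longrightarrow> g x = f x"
proof -
  define U where "U = A \<union> f ` A"
  have U: "finite U" "U \<subseteq> X" using assms unfolding U_def by auto
  have "card (U - A) = card (U - f ` A)"
    using assms(1,3) unfolding U_def by (simp add: card_Diff_subset card_image)
  then obtain h where h: "bij_betw h (U - A) (U - f ` A)"
    using U(1) by (meson finite_Diff finite_same_card_bij)
  define g where "g x = (if x \<in> A then f x else if x \<in> U then h x else x)" for x
  have "bij_betw g A (f ` A)"
    using assms(3) by (simp add: bij_betw_def g_def cong: inj_on_cong)
  moreover have "bij_betw g (U - A) (U - f ` A)"
    using h by (rule bij_betw_cong[THEN iffD1, rotated]) (simp add: g_def)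
  ultimately have "bij_betw g (A \<union> (U - A)) (f ` A \<union> (U - f ` A))"
    by (rule bij_betw_combine) auto
  moreover have "A \<union> (U - A) = U" "f ` A \<union> (U - f ` A) = U" unfolding U_def by auto
  ultimately have 1: "bij_betw g U U" by simp
  have "bij_betw g (X - U) (X - U)"
    by (rule bij_betw_cong[THEN iffD1, OF _ bij_betw_id]) (auto simp: g_def U_def)
  with 1 have "bij_betw g (U \<union> (X - U)) (U \<union> (X - U))"
    by (rule bij_betw_combine) auto
  moreover have "U \<union> (X - U) = X" using U by blast
  ultimately have "bij_betw g X X" by simp
  then show ?thesis using that[of g] by (simp add: g_def)
qed

text \<open>The permutation \<open>\<pi>\<close> prescribes the target of each fibre. There a
  bijection \<open>h\<close> back to the source turns \<open>f\<close> into a partial injection of a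
  finite set into itself, which can be completed.\<close>

lemma extend_fibrewise:
  fixes c :: "'v \<Rightarrow> 'i" and c' :: "'w \<Rightarrow> 'j"
  assumes \<pi>: "bij \<pi>"
    and card: "\<And>i. card {x \<in> X. c x = i} = t" "\<And>j. card {x \<in> X'. c' x = j} = t" and "t \<ge> 1"
    and A: "finite A" "A \<subseteq> X" "inj_on f A" "f ` A \<subseteq> X'" "\<And>x. x \<in> A \<Longrightarrow> c' (f x) = \<pi> (c x)"
  obtains g where "bij_betw g X X'" "\<And>x. x \<in> X \<Longrightarrow> c' (g x) = \<pi> (c x)" "\<And>x. x \<in> A \<Longrightarrow> g x = f x"
proof -
  define X1 where "X1 i = {x \<in> X. c x = i}" for i
  define X2 where "X2 j = {x \<in> X'. c' x = j}" for j
  have fin: "finite (X1 i)" "finite (X2 j)" for i j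
    unfolding X1_def X2_def using card \<open>t \<ge> 1\<close> by (metis card.infinite not_one_le_zero)+
  have "\<exists>g. bij_betw g (X1 i) (X2 (\<pi> i)) \<and> (\<forall>x\<in>A \<inter> X1 i. g x = f x)" for i
  proof -
    obtain h where h: "bij_betw h (X2 (\<pi> i)) (X1 i)"
      using finite_same_card_bij fin card unfolding X1_def X2_def by metis
    have fX2: "f ` (A \<inter> X1 i) \<subseteq> X2 (\<pi> i)"
      using A unfolding X1_def X2_def by auto
    have inj: "inj_on (h \<circ> f) (A \<inter> X1 i)"
      using A(3) h fX2 by (intro comp_inj_on) (auto simp: bij_betw_def inj_on_subset)
    have img: "(h \<circ> f) ` (A \<inter> X1 i) \<subseteq> X1 i"
      using fX2 h bij_betwE by fastforce
    have "finite (A \<inter> X1 i)" "A \<inter> X1 i \<subseteq> X1 i" using A(1) by auto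
    from extend_partial_injection[OF this inj img]
    obtain s where s: "bij_betw s (X1 i) (X1 i)" "\<And>x. x \<in> A \<inter> X1 i \<Longrightarrow> s x = (h \<circ> f) x"
      by metis
    define r where "r = inv_into (X2 (\<pi> i)) h"
    have r: "bij_betw r (X1 i) (X2 (\<pi> i))"
      unfolding r_def using h by (rule bij_betw_inv_into)
    have "bij_betw (r \<circ> s) (X1 i) (X2 (\<pi> i))"
      using s(1) r by (rule bij_betw_trans)
    moreover have "(r \<circ> s) x = f x" if "x \<in> A \<inter> X1 i" for x
    proof -
      have "f x \<in> X2 (\<pi> i)" using that fX2 by blast
      then have "r (h (f x)) = f x"
        unfolding r_def using bij_betw_imp_inj_on[OF h] by simp
      then show ?thesis using s(2)[OF that] by simp
    qed
    ultimately show ?thesis by blast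
  qed
  then obtain G where G: "\<And>i. bij_betw (G i) (X1 i) (X2 (\<pi> i))"
    "\<And>i x. x \<in> A \<inter> X1 i \<Longrightarrow> G i x = f x"
    by metis
  define g where "g x = G (c x) x" for x
  have gX2: "g x \<in> X2 (\<pi> (c x))" if "x \<in> X" for x
  proof -
    have "x \<in> X1 (c x)" using that by (simp add: X1_def)
    then show ?thesis unfolding g_def using G(1) bij_betwE by blast
  qed
  have gc: "c' (g x) = \<pi> (c x)" "g x \<in> X'" if "x \<in> X" for x
    using gX2[OF that] by (simp_all add: X2_def)
  have "bij_betw g X X'"
    unfolding bij_betw_def
  proof
    show "inj_on g X"
    proof (rule inj_onI)
      fix x y assume xy: "x \<in> X" "y \<in> X" "g x = g y"
      then have "\<pi> (c x) = \<pi> (c y)" using gc by metis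
      then have "c x = c y" using \<pi> by (meson bij_def injD)
      then have "G (c x) x = G (c x) y" "x \<in> X1 (c x)" "y \<in> X1 (c x)"
        using xy by (simp_all add: g_def X1_def)
      then show "x = y" using bij_betw_imp_inj_on[OF G(1)] by (metis inj_onD)
    qed
    show "g ` X = X'"
    proof (intro equalityI subsetI)
      fix z assume "z \<in> X'"
      obtain i where i: "\<pi> i = c' z" using \<pi> by (metis bij_pointE)
      then have "z \<in> X2 (\<pi> i)" using \<open>z \<in> X'\<close> by (simp add: X2_def)
      then have "z \<in> G i ` X1 i" using bij_betw_imp_surj_on[OF G(1)] by simp
      then obtain x where "x \<in> X1 i" "z = G i x" by blast
      then have "x \<in> X" "z = g x" by (auto simp: X1_def g_def)
      then show "z \<in> g ` X" by blast
    qed (use gc in blast)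
  qed
  moreover have "g x = f x" if "x \<in> A" for x
    using G(2)[of x "c x"] that A(2) by (auto simp: g_def X1_def)
  ultimately show ?thesis using that gc by blast
qed

text \<open>Adjacency depends on the fibres only, so an isomorphism of the patterns lifts by any
  fibrewise bijection. An empty \<open>A\<close> compares two presentations of one pattern; a
  non-empty one extends an embedding.\<close>

lemma blow_up_extend:
  assumes "blow_up W t c G" "blow_up W' t c' G'" "t \<ge> 1" "bij \<pi>"
    and "\<And>i j. W i j \<longleftrightarrow> W' (\<pi> i) (\<pi> j)"
    and A: "finite A" "A \<subseteq> verts G" "inj_on f A" "f ` A \<subseteq> verts G'"
      "\<And>x. x \<in> A \<Longrightarrow> c' (f x) = \<pi> (c x)"
  obtains g where "graph_isomorphism g G G'" "\<And>x. x \<in> A \<Longrightarrow> g x = f x"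
proof -
  have card: "\<And>i. card {x \<in> verts G. c x = i} = t" "\<And>j. card {x \<in> verts G'. c' x = j} = t"
    using assms(1,2) unfolding blow_up_def by blast+
  obtain g where g: "bij_betw g (verts G) (verts G')"
    "\<And>x. x \<in> verts G \<Longrightarrow> c' (g x) = \<pi> (c x)" "\<And>x. x \<in> A \<Longrightarrow> g x = f x"
    by (rule extend_fibrewise[where X = "verts G" and X' = "verts G'" and c = c and c' = c',
          OF \<open>bij \<pi>\<close> card \<open>t \<ge> 1\<close> A]) blast+
  have "g x \<in> verts G'" if "x \<in> verts G" for x using g(1) that bij_betwE by blast
  then have "adj G x y = adj G' (g x) (g y)" if "x \<in> verts G" "y \<in> verts G" for x y
    using assms(1,2,5) g(2) that unfolding blow_up_def by simp
  then have "graph_isomorphism g G G'"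
    using g(1) unfolding graph_isomorphism_def by blast
  then show ?thesis using that g(3) by blast
qed

lemma blow_up_isomorphic:
  assumes "blow_up W t c G" "blow_up W t c' G'" "t \<ge> 1"
  shows "G \<cong>\<^sub>g G'"
proof -
  obtain g where "graph_isomorphism g G G'"
    by (rule blow_up_extend[OF assms bij_id, of "{}" undefined]) auto
  then show ?thesis unfolding graph_isomorphic_def by blast
qed

definition W_G :: "int \<Rightarrow> int \<Rightarrow> bool" where
  "W_G a b \<longleftrightarrow> a \<noteq> b"

text \<open>Two disjoint infinite complete graphs; the Boolean is the side.\<close>

definition W_H1 :: "int \<times> bool \<Rightarrow> int \<times> bool \<Rightarrow> bool" where
  "W_H1 p q \<longleftrightarrow> snd p = snd q \<and> fst p \<noteq> fst q"

text \<open>Two infinite complete graphs with a perfect matching between them: the equivalence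
  demands different integers on one side and equal integers across.\<close>

definition W_H2 :: "int \<times> bool \<Rightarrow> int \<times> bool \<Rightarrow> bool" where
  "W_H2 p q \<longleftrightarrow> (snd p = snd q \<longleftrightarrow> fst p \<noteq> fst q)"

lemma blow_up_graph_G: "blow_up W_G t fst (graph_G t)"
proof -
  have "{x \<in> verts (graph_G t). fst x = i} = {i} \<times> {1..t}" for i
    by (auto simp: graph_G_def)
  then show ?thesis
    unfolding blow_up_def by (auto simp: graph_G_def W_G_def card_cartesian_product)
qed

lemma card_side:
  "card {x :: int \<times> nat. x \<in> UNIV \<times> {1..2 * t} \<and> (fst x, snd x \<le> t) = i} = t"
proof -
  have "{x :: int \<times> nat. x \<in> UNIV \<times> {1..2 * t} \<and> (fst x, snd x \<le> t) = i} =
    {fst i} \<times> (if snd i then {1..t} else {t + 1..2 * t})"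
    by (cases i) auto
  then show ?thesis by (simp add: card_cartesian_product)
qed

lemma blow_up_graph_H1: "blow_up W_H1 t (\<lambda>x. (fst x, snd x \<le> t)) (graph_H1 t)"
  unfolding blow_up_def
proof (intro conjI allI ballI)
  fix i show "card {x \<in> verts (graph_H1 t). (fst x, snd x \<le> t) = i} = t"
    using card_side[of t i] by (simp add: graph_H1_def)
qed (auto simp: graph_H1_def W_H1_def)

lemma blow_up_graph_H2: "blow_up W_H2 t (\<lambda>x. (fst x, snd x \<le> t)) (graph_H2 t)"
  unfolding blow_up_def
proof (intro conjI allI ballI)
  fix i show "card {x \<in> verts (graph_H2 t). (fst x, snd x \<le> t) = i} = t"
    using card_side[of t i] by (simp add: graph_H2_def)
qed (auto simp: graph_H2_def graph_H1_def W_H2_def)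

section \<open>The listed graphs are homogeneous from some size on\<close>

text \<open>Two labellings with the same coincidences differ by an injection between finite sets of
  labels, and this extends to a permutation of all labels.\<close>

lemma extend_to_bij:
  fixes \<alpha> \<beta> :: "'v \<Rightarrow> 'i"
  assumes "finite A" "\<And>x y. x \<in> A \<Longrightarrow> y \<in> A \<Longrightarrow> \<alpha> x = \<alpha> y \<longleftrightarrow> \<beta> x = \<beta> y"
  shows "\<exists>\<pi>. bij \<pi> \<and> (\<forall>x\<in>A. \<beta> x = \<pi> (\<alpha> x))"
proof -
  define h where "h z = \<beta> (inv_into A \<alpha> z)" for z
  have h: "h (\<alpha> x) = \<beta> x" if "x \<in> A" for x
    using that assms(2)[of "inv_into A \<alpha> (\<alpha> x)" x] unfolding h_def
    by (simp add: f_inv_into_f inv_into_into)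
  have inj: "inj_on h (\<alpha> ` A)"
  proof (rule inj_onI)
    fix u v assume "u \<in> \<alpha> ` A" "v \<in> \<alpha> ` A" "h u = h v"
    then obtain x y where "x \<in> A" "y \<in> A" "u = \<alpha> x" "v = \<alpha> y" by blast
    then show "u = v" using h assms(2) \<open>h u = h v\<close> by metis
  qed
  obtain \<pi> where "bij \<pi>" "\<And>z. z \<in> \<alpha> ` A \<Longrightarrow> \<pi> z = h z"
    by (rule extend_partial_injection[of "\<alpha> ` A" UNIV h]) (use assms(1) inj in auto)
  then show ?thesis using h by (intro exI[of _ \<pi>]) simp
qed

lemma card_fibre_le_1:
  assumes "inj_on \<phi> D"
  shows "card {d \<in> D. \<phi> d = z} \<le> 1"
proof (cases "finite {d \<in> D. \<phi> d = z}")
  case True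
  then show ?thesis
    using assms by (simp add: card_le_Suc0_iff_eq inj_on_def)
\<comment> \<open>For an infinite set \<open>card\<close> is 0.\<close>
qed simp

lemma card_le_fibres:
  assumes "finite A" "\<And>i. card {x \<in> A. c x = i} \<le> t"
  shows "card A \<le> t * card (c ` A)"
proof -
  have "A = (\<Union>i\<in>c ` A. {x \<in> A. c x = i})" by blast
  then have "card A \<le> (\<Sum>i\<in>c ` A. card {x \<in> A. c x = i})"
    using card_UN_le[of "c ` A" "\<lambda>i. {x \<in> A. c x = i}"] assms(1) by simp
  also have "\<dots> \<le> (\<Sum>i\<in>c ` A. t)" by (rule sum_mono) (rule assms(2))
  finally show ?thesis by (simp add: mult.commute)
qed

lemma transversal:
  assumes "I \<subseteq> c ` A"
  obtains D where "D \<subseteq> A" "inj_on c D" "c ` D = I" "card D = card I"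
proof -
  have "inj_on (inv_into A c) I" using assms by (rule inj_on_inv_into)
  moreover have "c (inv_into A c i) = i" if "i \<in> I" for i
    using that assms by (simp add: f_inv_into_f subset_iff)
  moreover have "inv_into A c ` I \<subseteq> A" using assms by (auto intro!: inv_into_into)
  ultimately show ?thesis
  proof (intro that[of "inv_into A c ` I"])
    assume inv: "inj_on (inv_into A c) I" and c: "\<And>i. i \<in> I \<Longrightarrow> c (inv_into A c i) = i"
    show "inj_on c (inv_into A c ` I)" by (rule inj_onI) (use c in force)
    show "c ` inv_into A c ` I = I" using c by force
    show "card (inv_into A c ` I) = card I" using inv by (rule card_image)
  qed
qed

text \<open>What \<open>W_H1\<close> and \<open>W_H2\<close> have in common: complete sides, and
  nothing beyond the matching between them.\<close>

definition two_sided :: "(int \<times> bool \<Rightarrow> int \<times> bool \<Rightarrow> bool) \<Rightarrow> bool" where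
  "two_sided W \<longleftrightarrow> (\<forall>p q. (snd p = snd q \<longrightarrow> (W p q \<longleftrightarrow> fst p \<noteq> fst q)) \<and>
     (snd p \<noteq> snd q \<longrightarrow> W p q \<longrightarrow> fst p = fst q))"

lemma two_sided_W: "two_sided W_H1" "two_sided W_H2"
  by (auto simp: two_sided_def W_H1_def W_H2_def)

text \<open>More than \<open>6 * t\<close> vertices meet at least seven fibres, hence four on one
  side, and these provide a clique \<open>D\<close>. Its image is again a clique and lies on one
  side; adjacency to \<open>D\<close> then reveals the side of every other vertex. As every
  permutation of \<open>bool\<close> compares with a constant, \<open>r = True\<close> means that
  sides are kept and \<open>r = False\<close> that they are exchanged.\<close>

lemma embedding_sides:
  assumes W: "two_sided W" and G: "blow_up W t c G" and "t \<ge> 1"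
    and A: "finite A" "A \<subseteq> verts G" "card A \<ge> 6 * t + 1"
    and f: "inj_on f A" "f ` A \<subseteq> verts G" "\<And>x y. x \<in> A \<Longrightarrow> y \<in> A \<Longrightarrow> adj G x y = adj G (f x) (f y)"
  obtains r where "\<And>x. x \<in> A \<Longrightarrow> snd (c (f x)) = (snd (c x) = r)"
proof -
  have adj: "adj G x y \<longleftrightarrow> W (c x) (c y)" if "x \<in> verts G" "y \<in> verts G" for x y
    using G that unfolding blow_up_def by blast
  have same: "W p q \<longleftrightarrow> fst p \<noteq> fst q" if "snd p = snd q" for p q
    using W that unfolding two_sided_def by blast
  have diff: "fst p = fst q" if "snd p \<noteq> snd q" "W p q" for p q
    using W that unfolding two_sided_def by blast
  have "card {x \<in> A. c x = i} \<le> t" for i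
  proof -
    have c: "card {x \<in> verts G. c x = i} = t" using G unfolding blow_up_def by blast
    then have "finite {x \<in> verts G. c x = i}" using \<open>t \<ge> 1\<close> by (intro card_ge_0_finite) simp
    then have "card {x \<in> A. c x = i} \<le> card {x \<in> verts G. c x = i}"
      by (rule card_mono) (use A in auto)
    then show ?thesis using c by simp
  qed
  then have "card A \<le> t * card (c ` A)" by (rule card_le_fibres[OF A(1)])
  have seven: "7 \<le> card (c ` A)"
  proof (rule ccontr)
    assume "\<not> 7 \<le> card (c ` A)"
    then have "card (c ` A) \<le> 6" by simp
    then have "t * card (c ` A) \<le> t * 6" by (rule mult_le_mono2)
    then show False using A(3) \<open>card A \<le> t * card (c ` A)\<close> by linarith
  qed
  have eq: "{i \<in> c ` A. snd i = True} \<union> {i \<in> c ` A. snd i = False} = c ` A" by auto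
  have "7 \<le> card ({i \<in> c ` A. snd i = True} \<union> {i \<in> c ` A. snd i = False})"
    unfolding eq by (rule seven)
  also note card_Un_le
  finally have "7 \<le> card {i \<in> c ` A. snd i = True} + card {i \<in> c ` A. snd i = False}" .
  then have "4 \<le> card {i \<in> c ` A. snd i = True} \<or> 4 \<le> card {i \<in> c ` A. snd i = False}"
    by linarith
  then obtain s where "4 \<le> card {i \<in> c ` A. snd i = s}" by blast
  from obtain_subset_with_card_n[OF this]
  obtain I where I: "I \<subseteq> {i \<in> c ` A. snd i = s}" "card I = 4" by metis
  then have "I \<subseteq> c ` A" by blast
  from transversal[OF this]
  obtain D where D: "D \<subseteq> A" "inj_on c D" "c ` D = I" "card D = 4" using I(2) by metis
  have finD: "finite D" using D(1) A(1) finite_subset by blast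
  have Ds: "snd (c d) = s" if "d \<in> D" for d using that D(3) I(1) by blast
  have Dinj: "inj_on (\<lambda>d. fst (c d)) D"
  proof (rule inj_onI)
    fix x y assume xy: "x \<in> D" "y \<in> D" "fst (c x) = fst (c y)"
    then have "c x = c y" using Ds by (simp add: prod_eq_iff)
    then show "x = y" using D(2) xy by (meson inj_onD)
  qed
  have DV: "d \<in> verts G" "f d \<in> verts G" if "d \<in> D" for d using that D(1) A(2) f(2) by blast+
  have clique: "W (c (f d)) (c (f e))" if "d \<in> D" "e \<in> D" "d \<noteq> e" for d e
  proof -
    have "fst (c d) \<noteq> fst (c e)" using that Dinj by (meson inj_onD)
    then have "adj G d e" using adj[OF DV(1)[OF that(1)] DV(1)[OF that(2)]] same Ds that by simp
    then have "adj G (f d) (f e)" using f(3) that D(1) by blast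
    then show ?thesis using adj DV that by blast
  qed
  obtain d0 where d0: "d0 \<in> D" using D(4) by fastforce
  define s' where "s' = snd (c (f d0))"
  have Ds': "snd (c (f d)) = s'" if "d \<in> D" for d
  proof (rule ccontr)
    assume ne: "snd (c (f d)) \<noteq> s'"
    then have dd0: "d \<noteq> d0" unfolding s'_def by auto
    \<comment> \<open>If the images of \<open>d0\<close> and \<open>d\<close> lie on opposite sides,
      they share their integer. The image of a third member \<open>w\<close> is beside one and
      across from the other, so its integer would be both different from and equal to the shared
      one.\<close>
    have "card {d0, d} < card D" using D(4) dd0 by simp
    then have "\<not> D \<subseteq> {d0, d}" using card_mono[of "{d0, d}" D] by fastforce
    then obtain w where w: "w \<in> D" "w \<noteq> d0" "w \<noteq> d" by blast
    have e: "fst (c (f d)) = fst (c (f d0))"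
      using diff[OF _ clique[OF that d0 dd0]] ne unfolding s'_def by blast
    show False
    proof (cases "snd (c (f w)) = snd (c (f d))")
      case True
      then have "fst (c (f w)) \<noteq> fst (c (f d))" using same clique[OF w(1) that w(3)] by blast
      moreover have "snd (c (f w)) \<noteq> snd (c (f d0))" using True ne unfolding s'_def by simp
      ultimately show False using diff clique[OF w(1) d0 w(2)] e by metis
    next
      case False
      then have "fst (c (f w)) = fst (c (f d))" using diff clique[OF w(1) that w(3)] by blast
      moreover have "snd (c (f w)) = snd (c (f d0))" using False ne unfolding s'_def by auto
      ultimately show False using same clique[OF w(1) d0 w(2)] e by metis
    qed
  qed
  have D'inj: "inj_on (\<lambda>d. fst (c (f d))) D"
  proof (rule inj_onI, rule ccontr)
    fix d e assume de: "d \<in> D" "e \<in> D" "fst (c (f d)) = fst (c (f e))" "d \<noteq> e"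
    then show False using clique[OF de(1,2,4)] same Ds' by metis
  qed
  have le1: "card {d \<in> D. fst (c d) = z} \<le> 1" "card {d \<in> D. fst (c (f d)) = z} \<le> 1" for z
    using card_fibre_le_1[OF Dinj] card_fibre_le_1[OF D'inj] by blast+
  have sides: "snd (c (f x)) = s' \<longleftrightarrow> snd (c x) = s" if x: "x \<in> A" for x
  proof (rule ccontr)
    assume ne: "\<not> ?thesis"
    have xV: "x \<in> verts G" "f x \<in> verts G" using x A f by blast+
    have a1: "adj G x d = W (c x) (c d)" "adj G x d = W (c (f x)) (c (f d))" if "d \<in> D" for d
      using adj[OF xV(1) DV(1)[OF that]] adj[OF xV(2) DV(2)[OF that]] f(3)[OF x, of d] that D(1)
      by blast+
    \<comment> \<open>A vertex beside a clique misses only a member with its own integer, and a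
      vertex across from it meets at most such a member. If \<open>x\<close> changes between these
      positions under \<open>f\<close>, every \<open>d\<close> is exceptional before or after
      \<open>f\<close>, but at most two members can be.\<close>
    have "D \<subseteq> {d \<in> D. fst (c d) = fst (c x)} \<union> {d \<in> D. fst (c (f d)) = fst (c (f x))}"
    proof
      fix d assume d: "d \<in> D"
      show "d \<in> {d \<in> D. fst (c d) = fst (c x)} \<union> {d \<in> D. fst (c (f d)) = fst (c (f x))}"
      proof (cases "snd (c x) = s")
        case True
        then have s: "snd (c (f x)) \<noteq> snd (c (f d))" "snd (c x) = snd (c d)"
          using ne Ds'[OF d] Ds[OF d] by auto
        have "fst (c x) = fst (c d) \<or> fst (c (f x)) = fst (c (f d))"
          using a1[OF d] same[OF s(2)] diff[OF s(1)] by blast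
        then show ?thesis using d by auto
      next
        case False
        then have s: "snd (c (f x)) = snd (c (f d))" "snd (c x) \<noteq> snd (c d)"
          using ne Ds'[OF d] Ds[OF d] by auto
        have "fst (c x) = fst (c d) \<or> fst (c (f x)) = fst (c (f d))"
          using a1[OF d] same[OF s(1)] diff[OF s(2)] by blast
        then show ?thesis using d by auto
      qed
    qed
    then have "card D \<le> card ({d \<in> D. fst (c d) = fst (c x)} \<union> {d \<in> D. fst (c (f d)) = fst (c (f x))})"
      using finD by (intro card_mono) auto
    also note card_Un_le
    also have "card {d \<in> D. fst (c d) = fst (c x)} + card {d \<in> D. fst (c (f d)) = fst (c (f x))} \<le> 1 + 1"
      using le1(1)[of "fst (c x)"] le1(2)[of "fst (c (f x))"] by (rule add_le_mono)
    finally show False using D(4) by simp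
  qed
  show ?thesis
  proof (rule that[of "s = s'"])
    fix x assume "x \<in> A"
    from sides[OF this] show "snd (c (f x)) = (snd (c x) = (s = s'))" by (cases s; cases s') auto
  qed
qed

text \<open>Once the sides are respected, adjacency constrains the integers only within each side,
  so the two sides receive independent permutations \<open>\<pi> True\<close> and
  \<open>\<pi> False\<close>.\<close>

lemma blow_up_H1_homogeneous:
  assumes G: "blow_up W_H1 t c G" and "t \<ge> 1" "n \<ge> 6 * t + 1"
  shows "k_homogeneous n G"
  unfolding k_homogeneous_def
proof (intro allI impI; elim conjE)
  fix A f assume A: "A \<subseteq> verts G" "finite A" "card A = n"
    and f: "graph_embedding f (induced_subgraph G A) G"
  have f': "inj_on f A" "f ` A \<subseteq> verts G" "\<And>x y. x \<in> A \<Longrightarrow> y \<in> A \<Longrightarrow> adj G x y = adj G (f x) (f y)"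
    using f unfolding graph_embedding_def induced_subgraph_def by auto
  have "card A \<ge> 6 * t + 1" using A assms(3) by simp
  from embedding_sides[OF two_sided_W(1) G assms(2) A(2,1) this f']
  obtain r where r: "\<And>x. x \<in> A \<Longrightarrow> snd (c (f x)) = (snd (c x) = r)" by metis
  have adj: "adj G x y \<longleftrightarrow> W_H1 (c x) (c y)" if "x \<in> verts G" "y \<in> verts G" for x y
    using G that unfolding blow_up_def by blast
  have "\<exists>\<pi>. bij \<pi> \<and> (\<forall>x\<in>{x \<in> A. snd (c x) = u}. fst (c (f x)) = \<pi> (fst (c x)))" for u
  proof -
    have "fst (c x) = fst (c y) \<longleftrightarrow> fst (c (f x)) = fst (c (f y))"
      if xy: "x \<in> {x \<in> A. snd (c x) = u}" "y \<in> {x \<in> A. snd (c x) = u}" for x y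
    proof -
      have V: "x \<in> verts G" "y \<in> verts G" "f x \<in> verts G" "f y \<in> verts G"
        using xy A f'(2) by blast+
      have "W_H1 (c x) (c y) = W_H1 (c (f x)) (c (f y))"
        using adj[OF V(1,2)] adj[OF V(3,4)] f'(3)[of x y] xy by simp
      then show ?thesis using r[of x] r[of y] xy unfolding W_H1_def by simp
    qed
    then show ?thesis
      by (intro extend_to_bij[of "{x \<in> A. snd (c x) = u}" "\<lambda>x. fst (c x)" "\<lambda>x. fst (c (f x))"])
        (use A(2) in auto)
  qed
  then have "\<forall>u. \<exists>\<pi>. bij \<pi> \<and> (\<forall>x\<in>{x \<in> A. snd (c x) = u}. fst (c (f x)) = \<pi> (fst (c x)))"
    by blast
  from choice[OF this] obtain \<pi> where \<pi>': "\<forall>u. bij (\<pi> u) \<and>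
    (\<forall>x\<in>{x \<in> A. snd (c x) = u}. fst (c (f x)) = \<pi> u (fst (c x)))" by blast
  then have \<pi>: "\<And>u. bij (\<pi> u)"
    "\<And>u x. x \<in> A \<Longrightarrow> snd (c x) = u \<Longrightarrow> fst (c (f x)) = \<pi> u (fst (c x))"
    by auto
  define \<rho> where "\<rho> p = (\<pi> (snd p) (fst p), snd p = r)" for p
  have inj\<pi>: "\<pi> u a = \<pi> u b \<longleftrightarrow> a = b" for u a b using \<pi>(1) by (meson bij_def injD)
  have "bij \<rho>"
  proof (rule bijI)
    show "inj \<rho>"
    proof (rule injI)
      fix p q assume eq: "\<rho> p = \<rho> q"
      then have "(snd p = r) = (snd q = r)" by (simp add: \<rho>_def)
      then have s: "snd p = snd q" by blast
      have "\<pi> (snd p) (fst p) = \<pi> (snd p) (fst q)" using eq unfolding \<rho>_def s by simp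
      then show "p = q" using s inj\<pi> by (simp add: prod_eq_iff)
    qed
    show "surj \<rho>"
    proof (rule surjI)
      fix q show "\<rho> (inv (\<pi> (snd q = r)) (fst q), snd q = r) = q"
        using \<pi>(1)[of "snd q = r"] by (auto simp: \<rho>_def prod_eq_iff bij_is_surj surj_f_inv_f)
    qed
  qed
  moreover have "W_H1 p q \<longleftrightarrow> W_H1 (\<rho> p) (\<rho> q)" for p q
  proof (cases "snd p = snd q")
    case True
    then show ?thesis by (simp add: W_H1_def \<rho>_def inj\<pi>)
  next
    case False
    then have "(snd p = r) \<noteq> (snd q = r)" by blast
    then show ?thesis using False by (simp add: W_H1_def \<rho>_def)
  qed
  moreover have "c (f x) = \<rho> (c x)" if "x \<in> A" for x
    using \<pi>(2)[OF that refl] r[OF that] by (simp add: \<rho>_def prod_eq_iff)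
  ultimately obtain g where "graph_isomorphism g G G" "\<And>x. x \<in> A \<Longrightarrow> g x = f x"
    using blow_up_extend[OF G G assms(2) _ _ A(2,1) f'(1,2)] by metis
  then show "\<exists>g. graph_automorphism g G \<and> (\<forall>x\<in>A. g x = f x)"
    unfolding graph_automorphism_def by blast
qed

text \<open>Unlike for \<open>W_H1\<close>, the matching makes \<open>f\<close> preserve equality of
  integers across the sides as well, so one permutation serves both sides, as the matching
  requires.\<close>

lemma blow_up_H2_homogeneous:
  assumes G: "blow_up W_H2 t c G" and "t \<ge> 1" "n \<ge> 6 * t + 1"
  shows "k_homogeneous n G"
  unfolding k_homogeneous_def
proof (intro allI impI; elim conjE)
  fix A f assume A: "A \<subseteq> verts G" "finite A" "card A = n"
    and f: "graph_embedding f (induced_subgraph G A) G"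
  have f': "inj_on f A" "f ` A \<subseteq> verts G" "\<And>x y. x \<in> A \<Longrightarrow> y \<in> A \<Longrightarrow> adj G x y = adj G (f x) (f y)"
    using f unfolding graph_embedding_def induced_subgraph_def by auto
  have "card A \<ge> 6 * t + 1" using A assms(3) by simp
  from embedding_sides[OF two_sided_W(2) G assms(2) A(2,1) this f']
  obtain r where r: "\<And>x. x \<in> A \<Longrightarrow> snd (c (f x)) = (snd (c x) = r)" by metis
  have adj: "adj G x y \<longleftrightarrow> W_H2 (c x) (c y)" if "x \<in> verts G" "y \<in> verts G" for x y
    using G that unfolding blow_up_def by blast
  have "fst (c x) = fst (c y) \<longleftrightarrow> fst (c (f x)) = fst (c (f y))"
    if xy: "x \<in> A" "y \<in> A" for x y
  proof -
    have V: "x \<in> verts G" "y \<in> verts G" "f x \<in> verts G" "f y \<in> verts G"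
      using xy A f'(2) by blast+
    have "W_H2 (c x) (c y) = W_H2 (c (f x)) (c (f y))"
      using adj[OF V(1,2)] adj[OF V(3,4)] f'(3)[of x y] xy by simp
    then show ?thesis using r[OF xy(1)] r[OF xy(2)] unfolding W_H2_def by auto
  qed
  from extend_to_bij[OF A(2), of "\<lambda>x. fst (c x)" "\<lambda>x. fst (c (f x))", OF this]
  obtain \<pi> where \<pi>: "bij \<pi>" "\<And>x. x \<in> A \<Longrightarrow> fst (c (f x)) = \<pi> (fst (c x))" by blast
  define \<rho> where "\<rho> p = (\<pi> (fst p), snd p = r)" for p
  have inj\<pi>: "\<pi> a = \<pi> b \<longleftrightarrow> a = b" for a b using \<pi>(1) by (meson bij_def injD)
  have "bij \<rho>"
  proof (rule bijI)
    show "inj \<rho>" by (rule injI) (auto simp: \<rho>_def inj\<pi> prod_eq_iff)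
    show "surj \<rho>"
    proof (rule surjI)
      fix q show "\<rho> (inv \<pi> (fst q), snd q = r) = q"
        using \<pi>(1) by (auto simp: \<rho>_def prod_eq_iff bij_is_surj surj_f_inv_f)
    qed
  qed
  moreover have "W_H2 p q \<longleftrightarrow> W_H2 (\<rho> p) (\<rho> q)" for p q
    by (auto simp: W_H2_def \<rho>_def inj\<pi>)
  moreover have "c (f x) = \<rho> (c x)" if "x \<in> A" for x
    using \<pi>(2)[OF that] r[OF that] by (simp add: \<rho>_def prod_eq_iff)
  ultimately obtain g where "graph_isomorphism g G G" "\<And>x. x \<in> A \<Longrightarrow> g x = f x"
    using blow_up_extend[OF G G assms(2) _ _ A(2,1) f'(1,2)] by metis
  then show "\<exists>g. graph_automorphism g G \<and> (\<forall>x\<in>A. g x = f x)"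
    unfolding graph_automorphism_def by blast
qed

section \<open>Disjoint unions with a finite homogeneous graph\<close>

lemma disjoint_union_simps [simp]:
  "Inl x \<in> verts (G \<union>\<^sub>g H) \<longleftrightarrow> x \<in> verts G"
  "Inr y \<in> verts (G \<union>\<^sub>g H) \<longleftrightarrow> y \<in> verts H"
  "adj (G \<union>\<^sub>g H) (Inl x) (Inl x') \<longleftrightarrow> adj G x x'"
  "adj (G \<union>\<^sub>g H) (Inr y) (Inr y') \<longleftrightarrow> adj H y y'"
  "\<not> adj (G \<union>\<^sub>g H) (Inl x) (Inr y)"
  "\<not> adj (G \<union>\<^sub>g H) (Inr y) (Inl x)"
  by (auto simp: disjoint_union_def)

text \<open>With \<open>h\<close> vertices in \<open>H\<close>, at least
  \<open>t * (h + 1) + 1\<close> members of \<open>A\<close> lie in \<open>graph_G t\<close>. They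
  meet \<open>h + 2\<close> fibres and contain a clique \<open>D\<close> of that size, which is too
  large to be mapped into \<open>H\<close> and has two members even if \<open>H\<close> is empty.
  Adjacency to \<open>D\<close> then shows that \<open>f\<close> respects the two parts, and each
  part is extended separately.\<close>

lemma graph_G_union_homogeneous:
  assumes "t \<ge> 1" and H: "finite (verts H)" "homogeneous H"
    and n: "n \<ge> t * (card (verts H) + 1) + 1 + card (verts H)"
  shows "k_homogeneous n (graph_G t \<union>\<^sub>g H)"
  unfolding k_homogeneous_def
proof (intro allI impI; elim conjE)
  let ?G = "graph_G t \<union>\<^sub>g H"
  fix A f assume A: "A \<subseteq> verts ?G" "finite A" "card A = n"
    and f: "graph_embedding f (induced_subgraph ?G A) ?G"
  have f': "inj_on f A" "f ` A \<subseteq> verts ?G" "\<And>x y. x \<in> A \<Longrightarrow> y \<in> A \<Longrightarrow> adj ?G x y = adj ?G (f x) (f y)"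
    using f unfolding graph_embedding_def induced_subgraph_def by auto
  define h where "h = card (verts H)"
  define A1 where "A1 = {x. Inl x \<in> A}"
  define A2 where "A2 = {y. Inr y \<in> A}"
  have A12: "A = Inl ` A1 \<union> Inr ` A2"
  proof (intro equalityI subsetI)
    fix z assume "z \<in> A"
    then show "z \<in> Inl ` A1 \<union> Inr ` A2" by (cases z) (auto simp: A1_def A2_def)
  qed (auto simp: A1_def A2_def)
  have fin: "finite A1" "finite A2"
    using A(2) unfolding A12 by (auto intro: finite_imageD)
  have A1V: "A1 \<subseteq> verts (graph_G t)" and A2V: "A2 \<subseteq> verts H"
    using A(1) unfolding A1_def A2_def by auto
  have G: "blow_up W_G t fst (graph_G t)" by (rule blow_up_graph_G)
  have adjG: "adj (graph_G t) x y \<longleftrightarrow> fst x \<noteq> fst y" if "x \<in> verts (graph_G t)" "y \<in> verts (graph_G t)" for x y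
    using G that unfolding blow_up_def W_G_def by blast
  have "card A2 \<le> h" unfolding h_def using A2V H(1) by (intro card_mono)
  moreover have "card A \<le> card A1 + card A2"
    unfolding A12 by (metis card_Un_le card_image inj_Inl inj_Inr)
  ultimately have c1: "card A1 \<ge> t * (h + 1) + 1" using A(3) n unfolding h_def by linarith
  have "card {x \<in> A1. fst x = i} \<le> t" for i
  proof -
    have c: "card {x \<in> verts (graph_G t). fst x = i} = t" using G unfolding blow_up_def by blast
    then have "finite {x \<in> verts (graph_G t). fst x = i}" using \<open>t \<ge> 1\<close> by (intro card_ge_0_finite) simp
    then have "card {x \<in> A1. fst x = i} \<le> card {x \<in> verts (graph_G t). fst x = i}"
      by (rule card_mono) (use A1V in auto)
    then show ?thesis using c by simp
  qed
  then have "card A1 \<le> t * card (fst ` A1)" by (rule card_le_fibres[OF fin(1)])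
  have "h + 2 \<le> card (fst ` A1)"
  proof (rule ccontr)
    assume "\<not> h + 2 \<le> card (fst ` A1)"
    then have "card (fst ` A1) \<le> h + 1" by simp
    then have "t * card (fst ` A1) \<le> t * (h + 1)" by (rule mult_le_mono2)
    then show False using c1 \<open>card A1 \<le> t * card (fst ` A1)\<close> by linarith
  qed
  from obtain_subset_with_card_n[OF this]
  obtain I where I: "I \<subseteq> fst ` A1" "card I = h + 2" by metis
  obtain D where D: "D \<subseteq> A1" "inj_on fst D" "card D = h + 2"
    using transversal[OF I(1)] I(2) by metis
  have finD: "finite D" using D(1) fin finite_subset by blast
  have clique: "adj ?G (f (Inl d)) (f (Inl e))" if "d \<in> D" "e \<in> D" "d \<noteq> e" for d e
  proof -
    have "fst d \<noteq> fst e" using that D(2) by (meson inj_onD)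
    moreover have "d \<in> verts (graph_G t)" "e \<in> verts (graph_G t)"
      using that D(1) A1V by blast+
    ultimately have "adj ?G (Inl d) (Inl e)" using adjG by simp
    then show ?thesis using f'(3)[of "Inl d" "Inl e"] that D(1) unfolding A1_def by blast
  qed
  have "\<exists>d0\<in>D. isl (f (Inl d0))"
  proof (rule ccontr)
    assume no: "\<not> (\<exists>d0\<in>D. isl (f (Inl d0)))"
    have "(\<lambda>d. f (Inl d)) ` D \<subseteq> Inr ` verts H"
    proof
      fix z assume "z \<in> (\<lambda>d. f (Inl d)) ` D"
      then obtain d where d: "d \<in> D" "z = f (Inl d)" by blast
      then have "z \<in> verts ?G" "\<not> isl z" using no f'(2) D(1) unfolding A1_def by blast+
      then show "z \<in> Inr ` verts H" by (cases z) auto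
    qed
    then have "card ((\<lambda>d. f (Inl d)) ` D) \<le> card (Inr ` verts H :: ((int \<times> nat) + 'a) set)"
      using H(1) by (intro card_mono) auto
    moreover have "inj_on (\<lambda>d. f (Inl d)) D"
      using f'(1) D(1) unfolding A1_def inj_on_def by blast
    ultimately have "card D \<le> h" unfolding h_def by (simp add: card_image)
    then show False using D(3) by simp
  qed
  then obtain d0 z0 where d0: "d0 \<in> D" "f (Inl d0) = Inl z0" by (auto simp: isl_def)
  have DInl: "isl (f (Inl d))" if "d \<in> D" for d
  proof (cases "d = d0")
    case False
    then show ?thesis using clique[OF that d0(1)] d0(2) by (cases "f (Inl d)") auto
  qed (use d0 in simp)
  have f1: "isl (f (Inl x))" if "x \<in> A1" for x
  proof -
    have "\<exists>d\<in>D. fst d \<noteq> fst x"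
    proof (rule ccontr)
      assume "\<not> (\<exists>d\<in>D. fst d \<noteq> fst x)"
      then have "{d \<in> D. fst d = fst x} = D" by blast
      then show False using card_fibre_le_1[OF D(2), of "fst x"] D(3) by simp
    qed
    then obtain d where d: "d \<in> D" "fst d \<noteq> fst x" by blast
    then have "adj ?G (Inl x) (Inl d)" using adjG[of x d] that D(1) A1V by auto
    then have "adj ?G (f (Inl x)) (f (Inl d))"
      using f'(3)[of "Inl x" "Inl d"] that d D(1) unfolding A1_def by blast
    then show ?thesis using DInl[OF d(1)] by (cases "f (Inl x)"; cases "f (Inl d)") auto
  qed
  have f2: "\<not> isl (f (Inr y))" if "y \<in> A2" for y
  proof
    assume "isl (f (Inr y))"
    then obtain z where z: "f (Inr y) = Inl z" by (auto simp: isl_def)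
    have zV: "z \<in> verts (graph_G t)"
      using z f'(2) that unfolding A2_def by (metis disjoint_union_simps(1) image_subset_iff mem_Collect_eq)
    have "\<exists>d\<in>D. d \<noteq> d0"
    proof (rule ccontr)
      assume "\<not> (\<exists>d\<in>D. d \<noteq> d0)"
      then have "D \<subseteq> {d0}" by blast
      then have "card D \<le> card {d0}" by (intro card_mono) auto
      then show False using D(3) by simp
    qed
    then obtain d1 where d1: "d1 \<in> D" "d1 \<noteq> d0" by blast
    obtain z1 where z1: "f (Inl d1) = Inl z1" using DInl[OF d1(1)] by (auto simp: isl_def)
    have e: "fst z' = fst z" "z' \<in> verts (graph_G t)" if d: "d \<in> D" "f (Inl d) = Inl z'" for d z'
    proof -
      have dA: "Inl d \<in> A" using d(1) D(1) unfolding A1_def by blast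
      show z'V: "z' \<in> verts (graph_G t)"
        using dA d(2) f'(2) by (metis disjoint_union_simps(1) image_subset_iff)
      have "\<not> adj ?G (f (Inr y)) (f (Inl d))"
        using f'(3)[of "Inr y" "Inl d"] dA \<open>y \<in> A2\<close> unfolding A2_def by auto
      then show "fst z' = fst z" using adjG[OF zV z'V] z d(2) by simp
    qed
    \<comment> \<open>By \<open>e\<close> all images of members of \<open>D\<close> lie in the fibre
      of \<open>z\<close>, yet they form a clique.\<close>
    have "adj (graph_G t) z1 z0" using clique[OF d1(1) d0(1) d1(2)] z1 d0(2) by simp
    then show False using adjG e[OF d1(1) z1] e[OF d0] by simp
  qed
  define f1' where "f1' x = projl (f (Inl x))" for x
  define f2' where "f2' y = projr (f (Inr y))" for y
  have F1: "f (Inl x) = Inl (f1' x)" if "x \<in> A1" for x using f1[OF that] by (simp add: f1'_def)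
  have F2: "f (Inr y) = Inr (f2' y)" if "y \<in> A2" for y using f2[OF that] by (simp add: f2'_def)
  have f1V: "f1' ` A1 \<subseteq> verts (graph_G t)"
    using F1 f'(2) unfolding A12 by fastforce
  have f2V: "f2' ` A2 \<subseteq> verts H"
    using F2 f'(2) unfolding A12 by fastforce
  have inj1: "inj_on f1' A1"
  proof (rule inj_onI)
    fix x y assume "x \<in> A1" "y \<in> A1" "f1' x = f1' y"
    then show "x = y" using inj_onD[OF f'(1), of "Inl x" "Inl y"] F1 by (simp add: A12)
  qed
  have inj2: "inj_on f2' A2"
  proof (rule inj_onI)
    fix x y assume "x \<in> A2" "y \<in> A2" "f2' x = f2' y"
    then show "x = y" using inj_onD[OF f'(1), of "Inr x" "Inr y"] F2 by (simp add: A12)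
  qed
  have "fst x = fst y \<longleftrightarrow> fst (f1' x) = fst (f1' y)" if xy: "x \<in> A1" "y \<in> A1" for x y
  proof -
    have V: "x \<in> verts (graph_G t)" "y \<in> verts (graph_G t)"
      "f1' x \<in> verts (graph_G t)" "f1' y \<in> verts (graph_G t)"
      using xy A1V f1V by blast+
    have "adj (graph_G t) x y = adj (graph_G t) (f1' x) (f1' y)"
      using f'(3)[of "Inl x" "Inl y"] xy F1 by (simp add: A12)
    then show ?thesis using adjG[OF V(1,2)] adjG[OF V(3,4)] by blast
  qed
  from extend_to_bij[OF fin(1), of fst "\<lambda>x. fst (f1' x)", OF this]
  obtain \<pi> where \<pi>: "bij \<pi>" "\<And>x. x \<in> A1 \<Longrightarrow> fst (f1' x) = \<pi> (fst x)" by blast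
  have "W_G a b \<longleftrightarrow> W_G (\<pi> a) (\<pi> b)" for a b
    unfolding W_G_def using \<pi>(1) by (metis bij_def injD)
  from blow_up_extend[OF G G \<open>t \<ge> 1\<close> \<pi>(1) this fin(1) A1V inj1 f1V \<pi>(2)]
  obtain g1 where g1: "graph_isomorphism g1 (graph_G t) (graph_G t)" "\<And>x. x \<in> A1 \<Longrightarrow> g1 x = f1' x"
    by metis
  have "\<exists>g2. graph_isomorphism g2 H H \<and> (\<forall>y\<in>A2. g2 y = f2' y)"
  \<comment> \<open>\<open>homogeneous\<close> speaks of non-empty sets only; for the empty set the
    identity serves.\<close>
  proof (cases "A2 = {}")
    case True
    have "graph_isomorphism id H H" unfolding graph_isomorphism_def by auto
    then show ?thesis using True by blast
  next
    case False
    have "adj H x y = adj H (f2' x) (f2' y)" if "x \<in> A2" "y \<in> A2" for x y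
      using f'(3)[of "Inr x" "Inr y"] that F2 by (simp add: A12)
    then have "graph_embedding f2' (induced_subgraph H A2) H"
      unfolding graph_embedding_def induced_subgraph_def using inj2 f2V by auto
    moreover have "card A2 \<ge> 1" using False fin(2) by (simp add: Suc_leI card_gt_0_iff)
    ultimately show ?thesis
      using H(2) A2V fin(2) unfolding homogeneous_def k_homogeneous_def graph_automorphism_def
      by blast
  qed
  then obtain g2 where g2: "graph_isomorphism g2 H H" "\<And>y. y \<in> A2 \<Longrightarrow> g2 y = f2' y" by blast
  define g where "g = map_sum g1 g2"
  have "graph_isomorphism g ?G ?G"
    unfolding graph_isomorphism_def
  proof (intro conjI ballI)
    have b: "bij_betw g1 (verts (graph_G t)) (verts (graph_G t))" "bij_betw g2 (verts H) (verts H)"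
      using g1 g2 unfolding graph_isomorphism_def by blast+
    show "bij_betw g (verts ?G) (verts ?G)"
      unfolding bij_betw_def
    proof
      show "inj_on g (verts ?G)"
      proof (rule inj_onI)
        fix x y assume "x \<in> verts ?G" "y \<in> verts ?G" "g x = g y"
        then show "x = y"
          using inj_onD[OF bij_betw_imp_inj_on[OF b(1)]] inj_onD[OF bij_betw_imp_inj_on[OF b(2)]]
          by (cases x; cases y) (simp_all add: g_def)
      qed
      have "g ` verts ?G = g1 ` verts (graph_G t) <+> g2 ` verts H"
        unfolding g_def disjoint_union_def by (force simp: image_iff)
      then show "g ` verts ?G = verts ?G"
        using b unfolding bij_betw_def disjoint_union_def by simp
    qed
    fix x y assume "x \<in> verts ?G" "y \<in> verts ?G"
    then show "adj ?G x y = adj ?G (g x) (g y)"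
      using g1(1) g2(1) unfolding graph_isomorphism_def g_def
      by (cases x; cases y) auto
  qed
  moreover have "g x = f x" if "x \<in> A" for x
    using that F1 F2 g1(2) g2(2) unfolding A12 g_def by auto
  ultimately show "\<exists>g. graph_automorphism g ?G \<and> (\<forall>x\<in>A. g x = f x)"
    unfolding graph_automorphism_def by blast
qed

section \<open>Parts in which every vertex has finitely many non-neighbours\<close>

text \<open>Each \<open>y\<close> excludes only finitely many \<open>x\<close>, so some
  \<open>x\<close> is related to \<open>n + 1\<close> chosen elements of \<open>Y\<close>.\<close>

lemma no_infinite_biregular:
  assumes "infinite X" "infinite Y"
    and "\<And>x. x \<in> X \<Longrightarrow> finite {y \<in> Y. R x y}" "\<And>x. x \<in> X \<Longrightarrow> card {y \<in> Y. R x y} = n"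
    and "\<And>y. y \<in> Y \<Longrightarrow> finite {x \<in> X. \<not> R x y}"
  shows False
proof -
  obtain Y0 where Y0: "Y0 \<subseteq> Y" "finite Y0" "card Y0 = Suc n"
    using infinite_arbitrarily_large[OF assms(2)] by metis
  have "finite (\<Union>y\<in>Y0. {x \<in> X. \<not> R x y})" using Y0 assms(5) by (intro finite_UN_I) auto
  then obtain x where x: "x \<in> X" "x \<notin> (\<Union>y\<in>Y0. {x \<in> X. \<not> R x y})"
    using assms(1) by (meson finite_subset subsetI)
  then have "Y0 \<subseteq> {y \<in> Y. R x y}" using Y0(1) by auto
  then have "card Y0 \<le> n" using card_mono[OF assms(3)[OF x(1)]] assms(4)[OF x(1)] by metis
  then show False using Y0(3) by simp
qed

context sgraph
begin

lemma Aut_nb: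
  assumes "Aut g" "x \<in> V"
  shows "nb (g x) = g ` nb x"
proof -
  have "nb y = {v \<in> V. E y v = True}" for y using nb_subset by auto
  then show ?thesis
    using Aut_image_rel[OF assms(1) order_refl Aut_image[OF assms(1)] assms(2), of True] by simp
qed

lemma Aut_image_Diff:
  assumes "Aut g" "X \<subseteq> V" "Y \<subseteq> V"
  shows "g ` (X - Y) = g ` X - g ` Y"
  using inj_on_image_set_diff[OF Aut_inj[OF assms(1)]] assms(2,3) by blast

lemma card_Aut: "Aut g \<Longrightarrow> X \<subseteq> V \<Longrightarrow> card (g ` X) = card X"
  and finite_Aut: "Aut g \<Longrightarrow> X \<subseteq> V \<Longrightarrow> finite (g ` X) \<longleftrightarrow> finite X"
  by (meson Aut_inj card_image inj_on_subset, meson Aut_inj finite_image_iff inj_on_subset)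

text \<open>Greedy choice: every vertex chosen so far excludes only finitely many elements of
  \<open>P\<close>.\<close>

lemma large_clique:
  assumes P: "infinite P" "P \<subseteq> V" "\<And>x. x \<in> P \<Longrightarrow> finite (P - nb x)"
    and U: "finite U" "U \<subseteq> P" and B: "finite B"
  shows "\<exists>D. D \<subseteq> P - B \<and> finite D \<and> card D = n \<and> mono_set True D \<and> (\<forall>u\<in>U. \<forall>d\<in>D. E u d)"
proof (induction n)
  case 0
  then show ?case by (intro exI[of _ "{}"]) (simp add: mono_set_def)
next
  case (Suc n)
  then obtain D where D: "D \<subseteq> P - B" "finite D" "card D = n" "mono_set True D"
    "\<forall>u\<in>U. \<forall>d\<in>D. E u d" by blast
  have "finite (B \<union> D \<union> (\<Union>u\<in>U \<union> D. P - nb u))"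
    using B D U P(3) by (intro finite_UnI finite_UN_I) auto
  then obtain x where x: "x \<in> P" "x \<notin> B \<union> D \<union> (\<Union>u\<in>U \<union> D. P - nb u)"
    using P(1) by (meson finite_subset subsetI)
  then have xE: "E u x" if "u \<in> U \<union> D" for u using that by auto
  have "mono_set True (insert x D)"
    unfolding mono_set_insert using D(4) xE E_sym by blast
  then show ?case
    using D x xE by (intro exI[of _ "insert x D"]) auto
qed

end

context ge_hom_graph
begin

text \<open>One \<open>k\<close>-clique joined to all of \<open>e\<close>, \<open>a\<close> and
  \<open>b\<close> serves as source and as target in \<open>conj_over_mono_sets\<close>.\<close>

lemma conj_over_clique:
  assumes P: "infinite P" "P \<subseteq> V" "\<And>x. x \<in> P \<Longrightarrow> finite (P - nb x)"
    and e: "e \<in> P" and ab: "a \<in> P" "b \<in> P" "E e a" "E e b"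
  shows "conj_over {e} a b"
proof -
  obtain D where D: "D \<subseteq> P - {e, a, b}" "finite D" "card D = k" "mono_set True D"
    "\<forall>u\<in>{e, a, b}. \<forall>d\<in>D. E u d"
    using large_clique[OF P, of "{e, a, b}" "{e, a, b}" k] e ab by blast
  have eV: "e \<in> V" using e P by blast
  have "v \<in> cls {e} {e}" if "v \<in> P" "E e v" for v
    using that P(2) E_sym unfolding cls_def by auto
  then have "a \<in> cls {e} {e}" "b \<in> cls {e} {e}" "D \<subseteq> cls {e} {e}"
    using ab D(1,5) by blast+
  then show ?thesis
    using D eV by (intro conj_over_mono_sets[of "{e}" a "{e}" b D "{e}" D True True]) auto
qed

text \<open>If \<open>x\<close> and \<open>z\<close> were adjacent, \<open>z\<close> could be moved
  over \<open>x\<close> to a vertex \<open>w\<close> adjacent to every non-neighbour of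
  \<open>x\<close> in \<open>P\<close>. The image of \<open>y\<close> stays in \<open>P\<close> by
  \<open>block\<close> and is a non-neighbour of both \<open>x\<close> and \<open>w\<close>, which
  is absurd.\<close>

lemma nonadjacency_trans:
  assumes P: "infinite P" "P \<subseteq> V" "\<And>x. x \<in> P \<Longrightarrow> finite (P - nb x)"
    and block: "\<And>g x. Aut g \<Longrightarrow> x \<in> P \<Longrightarrow> g x \<in> P \<Longrightarrow> g ` P \<subseteq> P"
    and xyz: "x \<in> P" "y \<in> P" "z \<in> P" "\<not> E x y" "\<not> E y z"
  shows "\<not> E x z"
proof
  assume xz: "E x z"
  define B where "B = (\<Union>u\<in>P - nb x. P - nb u)"
  have "finite B" unfolding B_def using P(3)[OF xyz(1)] P(3) by (intro finite_UN_I) auto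
  then obtain w where w: "w \<in> P" "w \<notin> B" using P(1) by (meson finite_subset subsetI)
  have far: "E u w" if "u \<in> P" "\<not> E x u" for u
    using w that unfolding B_def by auto
  have "conj_over {x} z w"
    using conj_over_clique[OF P xyz(1,3) w(1) xz] far[OF xyz(1)] by simp
  then obtain g where g: "Aut g" "g x = x" "g z = w" unfolding conj_over_def by auto
  have V: "x \<in> V" "y \<in> V" "z \<in> V" using xyz P(2) by blast+
  have "g y \<in> P" using block[OF g(1) xyz(1)] g(2) xyz(1,2) by auto
  moreover have "\<not> E x (g y)" using Aut_E[OF g(1) V(1,2)] g(2) xyz(4) by simp
  moreover have "\<not> E (g y) w" using Aut_E[OF g(1) V(2,3)] g(3) xyz(5) by simp
  ultimately show False using far by blast
qed

text \<open>The colours are the classes of non-adjacency. They are finite, so there are countably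
  infinitely many of them, and they can be numbered by all integers.\<close>

lemma multipartite_colouring:
  assumes P: "infinite P" "P \<subseteq> V" "\<And>x. x \<in> P \<Longrightarrow> finite (P - nb x)"
    and block: "\<And>g x. Aut g \<Longrightarrow> x \<in> P \<Longrightarrow> g x \<in> P \<Longrightarrow> g ` P \<subseteq> P"
    and t: "\<And>x. x \<in> P \<Longrightarrow> card (P - nb x) = t" and count: "countable V"
  obtains c :: "'v \<Rightarrow> int" where "\<And>i. card {x \<in> P. c x = i} = t"
    "\<And>x y. x \<in> P \<Longrightarrow> y \<in> P \<Longrightarrow> E x y \<longleftrightarrow> c x \<noteq> c y"
proof -
  define cl where "cl x = P - nb x" for x
  have trans: "\<not> E x z" if "x \<in> P" "y \<in> P" "z \<in> P" "\<not> E x y" "\<not> E y z" for x y z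
    by (rule nonadjacency_trans[OF P block that])
  have cl_eq: "cl x = cl y \<longleftrightarrow> \<not> E x y" if xy: "x \<in> P" "y \<in> P" for x y
  proof
    assume "cl x = cl y"
    moreover have "y \<in> cl y" using xy by (simp add: cl_def)
    ultimately have "y \<in> cl x" by simp
    then show "\<not> E x y" by (simp add: cl_def)
  next
    assume n: "\<not> E x y"
    then have n': "\<not> E y x" using E_sym by simp
    have "z \<in> cl x \<longleftrightarrow> z \<in> cl y" for z
      using trans[OF xy(2,1) _ n'] trans[OF xy _ n] unfolding cl_def by auto
    then show "cl x = cl y" by blast
  qed
  have inf: "infinite (cl ` P)"
  proof
    assume "finite (cl ` P)"
    then have "finite (\<Union>(cl ` P))" by (rule finite_Union) (use P(3) in \<open>auto simp: cl_def\<close>)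
    moreover have "P \<subseteq> \<Union>(cl ` P)" by (auto simp: cl_def)
    ultimately show False using P(1) finite_subset by blast
  qed
  have "countable P" using count P(2) countable_subset by blast
  then have "countable (cl ` P)" by simp
  then have b1: "bij_betw (to_nat_on (cl ` P)) (cl ` P) UNIV"
    using inf by (rule to_nat_on_infinite)
  have "bij_betw (to_nat_on (UNIV :: int set)) UNIV UNIV"
    by (rule to_nat_on_infinite) (auto simp: infinite_UNIV_int)
  then have b2: "bij_betw (inv (to_nat_on (UNIV :: int set))) UNIV UNIV"
    by (rule bij_betw_inv_into)
  obtain \<beta> :: "'v set \<Rightarrow> int" where \<beta>: "bij_betw \<beta> (cl ` P) UNIV"
    using bij_betw_trans[OF b1 b2] by blast
  define c where "c x = \<beta> (cl x)" for x
  have c_eq: "c x = c y \<longleftrightarrow> cl x = cl y" if "x \<in> P" "y \<in> P" for x y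
    using that bij_betw_imp_inj_on[OF \<beta>] unfolding c_def by (auto simp: inj_on_def)
  show ?thesis
  proof (rule that[of c])
    fix i
    have "i \<in> \<beta> ` cl ` P" using bij_betw_imp_surj_on[OF \<beta>] by simp
    then obtain y where y: "y \<in> P" "i = c y" by (auto simp: c_def)
    have "{x \<in> P. c x = i} = cl y"
    proof (intro set_eqI)
      fix x
      show "x \<in> {x \<in> P. c x = i} \<longleftrightarrow> x \<in> cl y"
        using y c_eq[of x y] cl_eq[of x y] E_sym[of x y] unfolding cl_def by auto
    qed
    then show "card {x \<in> P. c x = i} = t" using t[OF y(1)] by (simp add: cl_def)
  qed (use c_eq cl_eq in blast)
qed

section \<open>Graphs that are not 1-homogeneous\<close>

definition fin_deg :: "'v set" where
  "fin_deg = {x \<in> V. finite (nb x)}"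

definition cofin_deg :: "'v set" where
  "cofin_deg = {x \<in> V. finite (V - nb x)}"

text \<open>Over the empty set the only type is \<open>V\<close> itself, so
  \<open>almost_split\<close> is a statement about degrees.\<close>

lemma nontransitive_degrees:
  assumes V: "infinite V" and ab: "a \<in> V" "b \<in> V" "\<not> conj_over {} a b"
  shows "a \<in> cofin_deg \<and> b \<in> fin_deg \<or> a \<in> fin_deg \<and> b \<in> cofin_deg"
proof -
  obtain q where q: "finite {x \<in> V. E a x \<noteq> q}" "finite {x \<in> V. E b x = q}"
    using almost_split[of "{}" a "{}" b "{}"] ab V by auto
  have "nb x = {v \<in> V. E x v}" "V - nb x = {v \<in> V. \<not> E x v}" for x
    using nb_subset by auto
  then show ?thesis using q ab unfolding cofin_deg_def fin_deg_def by (cases q) simp_all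
qed

lemma fin_cofin_disjoint: "infinite V \<Longrightarrow> fin_deg \<inter> cofin_deg = {}"
  unfolding fin_deg_def cofin_deg_def using Diff_infinite_finite by blast

lemma Aut_fin_deg: "Aut g \<Longrightarrow> x \<in> V \<Longrightarrow> g x \<in> fin_deg \<longleftrightarrow> x \<in> fin_deg"
  unfolding fin_deg_def using Aut_in finite_Aut[OF _ nb_subset] Aut_nb by simp

lemma Aut_cofin_deg:
  assumes "Aut g" "x \<in> V"
  shows "g x \<in> cofin_deg \<longleftrightarrow> x \<in> cofin_deg"
proof -
  have "V - nb (g x) = g ` (V - nb x)"
    using Aut_image_Diff[OF assms(1) order_refl nb_subset] Aut_image[OF assms(1)] Aut_nb[OF assms]
    by simp
  then show ?thesis
    unfolding cofin_deg_def using finite_Aut[OF assms(1), of "V - nb x"] Aut_in assms by auto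
qed

text \<open>Every vertex fails to be conjugate to \<open>a\<close> or to \<open>b\<close>, and
  non-conjugate vertices have degrees of opposite kinds; hence the two kinds are orbits. If both
  were infinite, all vertices of \<open>fin_deg\<close> would have the same finite number of
  neighbours in \<open>cofin_deg\<close>, while each vertex there is adjacent to almost all of
  \<open>fin_deg\<close>.\<close>

lemma nontransitive_orbits:
  assumes V: "infinite V" and ab: "a \<in> V" "b \<in> V" "\<not> conj_over {} a b"
  shows "V = fin_deg \<union> cofin_deg"
    and "\<And>x y. x \<in> fin_deg \<Longrightarrow> y \<in> fin_deg \<Longrightarrow> conj_over {} x y"
    and "\<And>x y. x \<in> cofin_deg \<Longrightarrow> y \<in> cofin_deg \<Longrightarrow> conj_over {} x y"
    and "finite fin_deg \<or> finite cofin_deg"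
proof -
  have sub: "fin_deg \<subseteq> V" "cofin_deg \<subseteq> V" unfolding fin_deg_def cofin_deg_def by auto
  have "z \<in> fin_deg \<union> cofin_deg" if "z \<in> V" for z
  proof -
    have "\<not> conj_over {} z a \<or> \<not> conj_over {} z b"
      using ab(3) conj_over_sym[OF _ _ that, of "{}" a] conj_over_trans by blast
    then show ?thesis
      using nontransitive_degrees[OF V that ab(1)] nontransitive_degrees[OF V that ab(2)] by blast
  qed
  then show VV: "V = fin_deg \<union> cofin_deg" using sub by blast
  show fin_orbit: "conj_over {} x y" if "x \<in> fin_deg" "y \<in> fin_deg" for x y
    using nontransitive_degrees[OF V, of x y] that fin_cofin_disjoint[OF V] sub by blast
  show cofin_orbit: "conj_over {} x y" if "x \<in> cofin_deg" "y \<in> cofin_deg" for x y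
    using nontransitive_degrees[OF V, of x y] that fin_cofin_disjoint[OF V] sub by blast
  show "finite fin_deg \<or> finite cofin_deg"
  proof (rule ccontr)
    assume "\<not> (finite fin_deg \<or> finite cofin_deg)"
    then have inf: "infinite fin_deg" "infinite cofin_deg" by auto
    obtain x0 where x0: "x0 \<in> fin_deg" using inf(1) by (metis finite.emptyI ex_in_conv)
    have card: "card {y \<in> cofin_deg. E x y} = card {y \<in> cofin_deg. E x0 y}" if x: "x \<in> fin_deg" for x
    proof -
      obtain g where g: "Aut g" "g x0 = x"
        using fin_orbit[OF x0 x] unfolding conj_over_def by blast
      have gc: "h ` cofin_deg \<subseteq> cofin_deg" if "Aut h" for h
        using Aut_cofin_deg[OF that] sub by blast
      obtain h where h: "Aut h" "\<And>x. x \<in> V \<Longrightarrow> g (h x) = x" using Aut_inverse[OF g(1)] by metis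
      have "cofin_deg \<subseteq> g ` cofin_deg"
      proof
        fix z assume z: "z \<in> cofin_deg"
        then have "h z \<in> cofin_deg" "g (h z) = z" using gc[OF h(1)] h(2) sub by blast+
        then show "z \<in> g ` cofin_deg" by (metis imageI)
      qed
      then have "g ` cofin_deg = cofin_deg" using gc[OF g(1)] by blast
      from Aut_image_rel[OF g(1) sub(2) this, of x0 True]
      have "{y \<in> cofin_deg. E x y} = g ` {y \<in> cofin_deg. E x0 y}" using g(2) x0 sub by auto
      then show ?thesis using card_Aut[OF g(1), of "{y \<in> cofin_deg. E x0 y}"] sub by auto
    qed
    show False
    proof (rule no_infinite_biregular[OF inf, of E])
      fix x assume "x \<in> fin_deg"
      then show "finite {y \<in> cofin_deg. E x y}"
        unfolding fin_deg_def by (auto intro: rev_finite_subset[of "nb x"])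
    next
      fix y assume y: "y \<in> cofin_deg"
      have "{x \<in> fin_deg. \<not> E x y} \<subseteq> V - nb y"
        using sub(1) E_sym[of y] by (simp add: subset_iff)
      moreover have "finite (V - nb y)" using y by (simp add: cofin_deg_def)
      ultimately show "finite {x \<in> fin_deg. \<not> E x y}" by (rule finite_subset)
    qed (rule card)
  qed
qed

lemma nontransitive_structure:
  assumes V: "infinite V" "countable V" and ab: "a \<in> V" "b \<in> V" "\<not> conj_over {} a b"
    and fin: "finite fin_deg"
  shows "\<exists>(H :: nat ugraph) t. simple_graph H \<and> finite (verts H) \<and> homogeneous H \<and> t \<ge> 1 \<and>
    M \<cong>\<^sub>g graph_G t \<union>\<^sub>g H"
proof -
  let ?O = cofin_deg and ?Y = fin_deg
  note orbits = nontransitive_orbits[OF V(1) ab]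
  have sub: "?Y \<subseteq> V" "?O \<subseteq> V" unfolding fin_deg_def cofin_deg_def by auto
  have inf: "infinite ?O" using V(1) orbits(1) fin by (metis finite_UnI)
  have cof: "finite (?O - nb x)" if "x \<in> ?O" for x
    using that sub(2) unfolding cofin_deg_def by (auto intro: rev_finite_subset[of "V - nb x"])
  have block: "g ` ?O \<subseteq> ?O" "g ` ?Y \<subseteq> ?Y" if "Aut g" for g
    using Aut_cofin_deg[OF that] Aut_fin_deg[OF that] sub by blast+
  have surj: "g ` ?O = ?O" "g ` ?Y = ?Y" if g: "Aut g" for g
  proof -
    have "V = g ` ?O \<union> g ` ?Y"
      using Aut_image[OF g] orbits(1) by (metis image_Un sup_commute)
    then show "g ` ?O = ?O" "g ` ?Y = ?Y"
      using block[OF g] orbits(1) fin_cofin_disjoint[OF V(1)] by blast+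
  qed
  \<comment> \<open>Since \<open>cofin_deg\<close> is an orbit, one such edge would give each of its
    infinitely many vertices a neighbour in \<open>fin_deg\<close>; but finitely many finite
    neighbourhoods cannot cover it.\<close>
  have sep: "\<not> E x y" if xy: "x \<in> ?O" "y \<in> ?Y" for x y
  proof
    assume xyE: "E x y"
    have "?O \<subseteq> (\<Union>y\<in>?Y. nb y)"
    proof
      fix x' assume "x' \<in> ?O"
      then obtain g where g: "Aut g" "g x = x'"
        using orbits(3)[OF xy(1)] unfolding conj_over_def by blast
      have "E x' (g y)" using Aut_E[OF g(1), of x y] g(2) xyE xy sub by blast
      moreover have "g y \<in> ?Y" using block[OF g(1)] xy(2) by blast
      ultimately show "x' \<in> (\<Union>y\<in>?Y. nb y)" using E_sym by auto
    qed
    moreover have "finite (\<Union>y\<in>?Y. nb y)"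
      by (rule finite_UN_I[OF fin]) (simp add: fin_deg_def)
    ultimately show False using inf finite_subset by blast
  qed
  obtain x0 where x0: "x0 \<in> ?O" using inf by (metis finite.emptyI ex_in_conv)
  define t where "t = card (?O - nb x0)"
  have card: "card (?O - nb x) = t" if x: "x \<in> ?O" for x
  proof -
    obtain g where g: "Aut g" "g x0 = x"
      using orbits(3)[OF x0 x] unfolding conj_over_def by blast
    have "?O - nb x = g ` (?O - nb x0)"
      using Aut_image_Diff[OF g(1) sub(2) nb_subset, of x0] surj(1)[OF g(1)] Aut_nb[OF g(1), of x0]
        g(2) x0 sub by auto
    then show ?thesis using card_Aut[OF g(1), of "?O - nb x0"] sub unfolding t_def by auto
  qed
  have "x0 \<in> ?O - nb x0" using x0 by simp
  then have t1: "t \<ge> 1" unfolding t_def using cof[OF x0]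
    by (metis One_nat_def Suc_leI card_gt_0_iff empty_iff)
  obtain c :: "'v \<Rightarrow> int" where c: "\<And>i. card {x \<in> ?O. c x = i} = t"
    "\<And>x y. x \<in> ?O \<Longrightarrow> y \<in> ?O \<Longrightarrow> E x y \<longleftrightarrow> c x \<noteq> c y"
    using multipartite_colouring[OF inf sub(2) cof block(1) card V(2)] by blast
  have "blow_up W_G t c (induced_subgraph M ?O)"
    using c unfolding blow_up_def induced_subgraph_def W_G_def by simp
  then have "induced_subgraph M ?O \<cong>\<^sub>g graph_G t"
    using blow_up_graph_G t1 by (rule blow_up_isomorphic)
  then obtain f1 where f1: "graph_isomorphism f1 (induced_subgraph M ?O) (graph_G t)"
    unfolding graph_isomorphic_def by blast
  obtain h :: "'v \<Rightarrow> nat" where h: "inj_on h ?Y"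
    using fin by (metis countable_def countable_finite)
  define H :: "nat ugraph" where "H = \<lparr>verts = h ` ?Y,
    adj = (\<lambda>i j. i \<in> h ` ?Y \<and> j \<in> h ` ?Y \<and> E (inv_into ?Y h i) (inv_into ?Y h j))\<rparr>"
  have f2: "graph_isomorphism h (induced_subgraph M ?Y) H"
    unfolding graph_isomorphism_def induced_subgraph_def H_def using h
    by (auto simp: bij_betw_def)
  have "simple_graph H"
    unfolding simple_graph_def H_def using E_sym by auto
  moreover have "finite (verts H)" unfolding H_def using fin by simp
  moreover have "homogeneous H"
    unfolding homogeneous_def
  proof (intro allI impI)
    fix n :: nat assume "n \<ge> 1"
    have "k_homogeneous n (induced_subgraph M ?Y)"
      unfolding k_homogeneous_def
    proof (intro allI impI; elim conjE)
      fix A f assume A: "A \<subseteq> verts (induced_subgraph M ?Y)" "finite A" "card A = n"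
        and f: "graph_embedding f (induced_subgraph (induced_subgraph M ?Y) A) (induced_subgraph M ?Y)"
      have AY: "A \<subseteq> ?Y" using A(1) by (simp add: induced_subgraph_def)
      have f': "inj_on f A" "f ` A \<subseteq> ?Y"
        using f unfolding graph_embedding_def induced_subgraph_def by auto
      have fE: "E x y = E (f x) (f y)" if xy: "x \<in> A" "y \<in> A" for x y
      proof -
        have "x \<in> ?Y" "y \<in> ?Y" "f x \<in> ?Y" "f y \<in> ?Y" using xy AY f'(2) by blast+
        then show ?thesis
          using f xy unfolding graph_embedding_def induced_subgraph_def by auto
      qed
      \<comment> \<open>Fixing \<open>k\<close> vertices that have no edges to
        \<open>fin_deg\<close> raises a map between small sets to a size for which it
        extends.\<close>
      obtain D where D: "D \<subseteq> ?O" "finite D" "card D = k"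
        using large_clique[OF inf sub(2) cof, of "{}" "{}" k] by blast
      define p where "p x = (if x \<in> A then f x else x)" for x
      have dj: "D \<inter> ?Y = {}" using D(1) fin_cofin_disjoint[OF V(1)] by blast
      have p: "x \<in> A \<Longrightarrow> p x = f x" "x \<in> D \<Longrightarrow> p x = x" for x
        using dj AY unfolding p_def by auto
      have inj: "inj_on p (A \<union> D)"
        unfolding inj_on_Un
      proof (intro conjI)
        show "inj_on p A" using f'(1) p(1) by (simp add: inj_on_def)
        show "inj_on p D" using p(2) by (simp add: inj_on_def)
        show "p ` (A - D) \<inter> p ` (D - A) = {}" using p f'(2) dj by fastforce
      qed
      have pE: "E x y = E (p x) (p y)" if xy: "x \<in> A \<union> D" "y \<in> A \<union> D" for x y
      proof -
        have "\<not> E u v" "\<not> E v u" if "u \<in> A \<union> f ` A" "v \<in> D" for u v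
          using sep[of v u] E_sym[of u v] that D(1) AY f'(2) by blast+
        then show ?thesis using xy p fE by (metis Un_iff image_eqI)
      qed
      have "card D \<le> card (A \<union> D)" using A(2) D(2) by (intro card_mono) auto
      then have "card (A \<union> D) \<ge> k" using D(3) by simp
      moreover have "p ` (A \<union> D) \<subseteq> V" "A \<union> D \<subseteq> V" using p f'(2) sub AY D(1) by auto
      ultimately obtain g where g: "Aut g" "\<And>x. x \<in> A \<union> D \<Longrightarrow> g x = p x"
        using extend_embedding[of "A \<union> D" p] A(2) D(2) inj pE by auto
      have "graph_automorphism g (induced_subgraph M ?Y)"
        unfolding graph_automorphism_def graph_isomorphism_def bij_betw_def induced_subgraph_def
        using surj(2)[OF g(1)] inj_on_subset[OF Aut_inj[OF g(1)] sub(1)] Aut_E[OF g(1)] sub(1)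
        by auto
      then show "\<exists>g. graph_automorphism g (induced_subgraph M ?Y) \<and> (\<forall>x\<in>A. g x = f x)"
        using g(2) p(1) by auto
    qed
    moreover have "induced_subgraph M ?Y \<cong>\<^sub>g H" using f2 unfolding graph_isomorphic_def by blast
    ultimately show "k_homogeneous n H" using k_homogeneous_iso by blast
  qed
  moreover have "M \<cong>\<^sub>g graph_G t \<union>\<^sub>g H"
  proof -
    define F where "F x = (if x \<in> ?O then Inl (f1 x) else Inr (h x))" for x
    have b: "bij_betw f1 ?O (verts (graph_G t))" "bij_betw h ?Y (verts H)"
      using f1 f2 unfolding graph_isomorphism_def induced_subgraph_def by simp_all
    have FO: "F x = Inl (f1 x)" if "x \<in> ?O" for x using that by (simp add: F_def)
    have FY: "F x = Inr (h x)" if "x \<in> ?Y" for x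
      using that fin_cofin_disjoint[OF V(1)] by (auto simp: F_def)
    have "bij_betw F V (verts (graph_G t \<union>\<^sub>g H))"
      unfolding bij_betw_def
    proof
      show "inj_on F V"
      proof (rule inj_onI)
        fix x y assume xy: "x \<in> V" "y \<in> V" "F x = F y"
        consider "x \<in> ?O" "y \<in> ?O" | "x \<in> ?Y" "y \<in> ?Y" | "x \<in> ?O" "y \<in> ?Y" | "x \<in> ?Y" "y \<in> ?O"
          using xy orbits(1) by blast
        then show "x = y"
        proof cases
          case 1
          then show ?thesis using xy(3) FO inj_onD[OF bij_betw_imp_inj_on[OF b(1)]] by simp
        next
          case 2
          then show ?thesis using xy(3) FY inj_onD[OF bij_betw_imp_inj_on[OF b(2)]] by simp
        qed (use xy(3) FO FY in simp_all)
      qed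
      have "F ` ?O = Inl ` f1 ` ?O" "F ` ?Y = Inr ` h ` ?Y"
        using FO FY by (simp_all add: image_image)
      then have "F ` V = Inl ` verts (graph_G t) \<union> Inr ` verts H"
        using orbits(1) bij_betw_imp_surj_on[OF b(1)] bij_betw_imp_surj_on[OF b(2)]
        by (metis image_Un sup_commute)
      then show "F ` V = verts (graph_G t \<union>\<^sub>g H)" by (simp add: disjoint_union_def Plus_def)
    qed
    moreover have "E x y = adj (graph_G t \<union>\<^sub>g H) (F x) (F y)" if xy: "x \<in> V" "y \<in> V" for x y
    proof -
      consider "x \<in> ?O" "y \<in> ?O" | "x \<in> ?Y" "y \<in> ?Y" | "x \<in> ?O" "y \<in> ?Y" | "x \<in> ?Y" "y \<in> ?O"
        using xy orbits(1) by blast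
      then show ?thesis
      proof cases
        case 1
        then show ?thesis using f1 FO unfolding graph_isomorphism_def induced_subgraph_def by simp
      next
        case 2
        then show ?thesis using f2 FY unfolding graph_isomorphism_def induced_subgraph_def by simp
      next
        case 3
        then show ?thesis using sep[of x y] FO FY by simp
      next
        case 4
        then show ?thesis using sep[of y x] E_sym[of x y] FO FY by simp
      qed
    qed
    ultimately show ?thesis unfolding graph_isomorphic_def graph_isomorphism_def by blast
  qed
  ultimately show ?thesis using t1 by blast
qed

end

section \<open>Graphs that are 1-homogeneous but not 2-homogeneous\<close>

context sgraph
begin

definition cell :: "'v \<Rightarrow> 'v set" where
  "cell x = {y \<in> V. par x y}"

definition cross :: "'v \<Rightarrow> 'v set" where
  "cross x = nb x - cell x"

lemma cell_subset: "cell x \<subseteq> V"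
  by (auto simp: cell_def)

lemma cell_eq: "par x y \<Longrightarrow> cell x = cell y"
  unfolding cell_def using par_trans par_sym by blast

lemma in_cell_self: "x \<in> V \<Longrightarrow> x \<in> cell x"
  by (simp add: cell_def par_refl)

lemma in_cross: "y \<in> cross x \<longleftrightarrow> E x y \<and> \<not> par x y"
  unfolding cross_def cell_def using E_verts by auto

lemma cross_sym: "y \<in> cross x \<longleftrightarrow> x \<in> cross y"
  using in_cross E_sym par_sym by blast

lemma cls_single_E: "e \<in> V \<Longrightarrow> cls {e} {e} = nb e"
  unfolding cls_def using nb_subset E_sym by auto

lemma cls_single_nE: "cls {e} {} = V - {e} - nb e"
  unfolding cls_def using E_sym by auto

lemma Aut_cell:
  assumes "Aut g" "x \<in> V"
  shows "g ` cell x = cell (g x)"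
proof (intro equalityI subsetI)
  fix z assume "z \<in> g ` cell x"
  then show "z \<in> cell (g x)"
    using par_Aut[OF assms(1) assms(2)] Aut_in[OF assms(1)] unfolding cell_def by auto
next
  fix z assume z: "z \<in> cell (g x)"
  then have "z \<in> g ` V" using Aut_image[OF assms(1)] cell_subset by blast
  then obtain y where "y \<in> V" "z = g y" by blast
  then show "z \<in> g ` cell x" using z par_Aut[OF assms] unfolding cell_def by auto
qed

text \<open>Passing to the complement changes the disagreement of \<open>x\<close> and
  \<open>y\<close> at most at these two vertices, so a graph and its complement have the same
  cells.\<close>

lemma par_complement:
  assumes "x \<in> V" "y \<in> V"
  shows "finite {v \<in> V. adj (complement M) x v \<noteq> adj (complement M) y v} \<longleftrightarrow> par x y"
proof
  assume "finite {v \<in> V. adj (complement M) x v \<noteq> adj (complement M) y v}"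
  then have "finite ({x, y} \<union> {v \<in> V. adj (complement M) x v \<noteq> adj (complement M) y v})" by simp
  then show "par x y"
    unfolding par_def by (rule rev_finite_subset) (use assms in \<open>auto simp: adj_complement\<close>)
next
  assume "par x y"
  then have "finite ({x, y} \<union> {v \<in> V. E x v \<noteq> E y v})" by (simp add: par_def)
  then show "finite {v \<in> V. adj (complement M) x v \<noteq> adj (complement M) y v}"
    by (rule rev_finite_subset) (use assms in \<open>auto simp: adj_complement\<close>)
qed

end

text \<open>The outcome of \<open>non_homogeneous_witness\<close> for size two, where
  \<open>F\<close> is a single vertex \<open>e\<close>: either \<open>a\<close> and \<open>b\<close>
  are both adjacent to \<open>e\<close> or neither is.\<close>

locale edge_failure = ge_hom_graph M k for M :: "'v ugraph" and k +
  fixes e a b :: 'v and Q :: "'v set"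
  assumes V: "infinite V" and hom1: "k_homogeneous 1 M"
    and e: "e \<in> V" and ab: "a \<in> cls {e} Q" "b \<in> cls {e} Q" "\<not> conj_over {e} a b"
begin

lemma transitive:
  assumes "x \<in> V" "y \<in> V"
  obtains g where "Aut g" "g x = y"
  using homogeneous_transitive[OF hom1 assms] by blast

lemma finite_nb_iff: "x \<in> V \<Longrightarrow> y \<in> V \<Longrightarrow> finite (nb x) \<longleftrightarrow> finite (nb y)"
  by (metis transitive finite_Aut nb_subset Aut_nb)

lemma finite_conb_iff:
  assumes "x \<in> V" "y \<in> V"
  shows "finite (V - nb x) \<longleftrightarrow> finite (V - nb y)"
proof -
  obtain g where g: "Aut g" "g x = y" using transitive[OF assms] .
  have "V - nb y = g ` (V - nb x)"
    using Aut_image_Diff[OF g(1) order_refl nb_subset] Aut_image[OF g(1)] Aut_nb[OF g(1) assms(1)] g(2)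
    by simp
  then show ?thesis using finite_Aut[OF g(1), of "V - nb x"] by simp
qed

lemma abV: "a \<in> V" "b \<in> V" "a \<noteq> e" "b \<noteq> e"
  using ab unfolding cls_def by auto

text \<open>Otherwise all degrees are finite by transitivity, whereas \<open>almost_split\<close> on
  the non-neighbours of \<open>e\<close> gives \<open>a\<close> or \<open>b\<close> infinitely many
  neighbours.\<close>

lemma infinite_nb:
  assumes "x \<in> V"
  shows "infinite (nb x)"
proof
  assume "finite (nb x)"
  then have fin: "finite (nb y)" if "y \<in> V" for y using finite_nb_iff[OF assms that] by simp
  have "infinite (cls {e} {})"
    unfolding cls_single_nE using V fin[OF e] by (simp add: Diff_infinite_finite)
  moreover have "{e} \<subseteq> V" using e by simp
  ultimately obtain q where q: "finite {x \<in> cls {e} {}. E a x \<noteq> q}" "finite {x \<in> cls {e} {}. E b x = q}"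
    using almost_split[of "{e}" a Q b "{}"] ab by blast
  have "finite {x \<in> cls {e} {}. E y x = True}" if "y \<in> V" for y
    using fin[OF that] by (rule rev_finite_subset) auto
  then have "finite {x \<in> cls {e} {}. E a x = True}" "finite {x \<in> cls {e} {}. E b x = True}"
    using abV by blast+
  then have "\<exists>y. finite ({x \<in> cls {e} {}. E y x = True} \<union> {x \<in> cls {e} {}. E y x = False})"
    using q by (cases q) auto
  then obtain y where "finite ({x \<in> cls {e} {}. E y x = True} \<union> {x \<in> cls {e} {}. E y x = False})"
    by blast
  then have "finite (cls {e} {})" by (rule rev_finite_subset) blast
  then show False using \<open>infinite (cls {e} {})\<close> by blast
qed

lemma infinite_conb:
  assumes "x \<in> V"
  shows "infinite (V - nb x)"
proof
  assume "finite (V - nb x)"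
  then have fin: "finite (V - nb y)" if "y \<in> V" for y using finite_conb_iff[OF assms that] by simp
  have inf: "infinite (cls {e} {e})"
    unfolding cls_single_E[OF e] using infinite_nb[OF e] .
  have "{e} \<subseteq> V" using e by simp
  then obtain q where q: "finite {x \<in> cls {e} {e}. E a x \<noteq> q}" "finite {x \<in> cls {e} {e}. E b x = q}"
    using almost_split[of "{e}" a Q b "{e}"] ab inf by blast
  have "finite {x \<in> cls {e} {e}. E y x = False}" if "y \<in> V" for y
    using fin[OF that] by (rule rev_finite_subset) (use cls_subset in auto)
  then have "finite {x \<in> cls {e} {e}. E a x = False}" "finite {x \<in> cls {e} {e}. E b x = False}"
    using abV by blast+
  then have "\<exists>y. finite ({x \<in> cls {e} {e}. E y x = True} \<union> {x \<in> cls {e} {e}. E y x = False})"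
    using q by (cases q) auto
  then obtain y where "finite ({x \<in> cls {e} {e}. E y x = True} \<union> {x \<in> cls {e} {e}. E y x = False})"
    by blast
  then have "finite (cls {e} {e})" by (rule rev_finite_subset) blast
  then show False using inf by blast
qed

text \<open>\<open>almost_split\<close> applies to the neighbours of \<open>c\<close> with a value
  \<open>q1\<close> and to its non-neighbours with a value \<open>q0\<close>. Equal values would
  give \<open>z\<close> finite or cofinite degree; so \<open>z\<close> almost follows or almost
  opposes \<open>c\<close>, and \<open>z'\<close> does the reverse.\<close>

lemma par_anti_split:
  assumes "c \<in> V" "z \<in> cls {c} S" "z' \<in> cls {c} S" "\<not> conj_over {c} z z'"
  shows "par c z \<and> anti c z' \<or> anti c z \<and> par c z'"
proof -
  have c: "finite {c}" "{c} \<subseteq> V" using assms(1) by auto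
  have zV: "z \<in> V" "z' \<in> V" using assms cls_subset by blast+
  have inf: "infinite (cls {c} {c})" "infinite (cls {c} {})"
  proof -
    show "infinite (cls {c} {c})" unfolding cls_single_E[OF assms(1)] by (rule infinite_nb[OF assms(1)])
    have "cls {c} {} = V - nb c - {c}" unfolding cls_single_nE by blast
    then show "infinite (cls {c} {})" using infinite_conb[OF assms(1)] by simp
  qed
  obtain q1 where q1: "finite {x \<in> cls {c} {c}. E z x \<noteq> q1}" "finite {x \<in> cls {c} {c}. E z' x = q1}"
    using almost_split[OF c assms(2-4) inf(1)] .
  obtain q0 where q0: "finite {x \<in> cls {c} {}. E z x \<noteq> q0}" "finite {x \<in> cls {c} {}. E z' x = q0}"
    using almost_split[OF c assms(2-4) inf(2)] .
  have cover: "V \<subseteq> insert c (cls {c} {c} \<union> cls {c} {})"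
    unfolding cls_single_E[OF assms(1)] cls_single_nE by blast
  have all: "finite {x \<in> V. P x}" if "finite {x \<in> cls {c} {c}. P x}" "finite {x \<in> cls {c} {}. P x}" for P
    by (rule finite_subset[of _ "insert c ({x \<in> cls {c} {c}. P x} \<union> {x \<in> cls {c} {}. P x})"])
      (use that cover in auto)
  have c1: "E c x" if "x \<in> cls {c} {c}" for x using that cls_single_E[OF assms(1)] by simp
  have c0: "\<not> E c x" if "x \<in> cls {c} {}" for x using that cls_single_nE by simp
  have "q1 \<noteq> q0"
  proof
    assume "q1 = q0"
    then have f: "finite {x \<in> V. E z x \<noteq> q1}" using all[OF q1(1)] q0(1) by simp
    show False
    proof (cases q1)
      case True
      have "V - nb z = {x \<in> V. E z x \<noteq> q1}" using True by auto
      then show False using f infinite_conb[OF zV(1)] by simp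
    next
      case False
      have "nb z = {x \<in> V. E z x \<noteq> q1}" using False nb_subset by auto
      then show False using f infinite_nb[OF zV(1)] by simp
    qed
  qed
  show ?thesis
  proof (cases q1)
    case True
    then have "q0 = False" using \<open>q1 \<noteq> q0\<close> by simp
    have "finite {x \<in> V. E c x \<noteq> E z x}"
    proof (rule all)
      show "finite {x \<in> cls {c} {c}. E c x \<noteq> E z x}"
        using q1(1) by (rule rev_finite_subset) (use c1 True in auto)
      show "finite {x \<in> cls {c} {}. E c x \<noteq> E z x}"
        using q0(1) by (rule rev_finite_subset) (use c0 \<open>q0 = False\<close> in auto)
    qed
    moreover have "finite {x \<in> V. E c x = E z' x}"
    proof (rule all)
      show "finite {x \<in> cls {c} {c}. E c x = E z' x}"
        using q1(2) by (rule rev_finite_subset) (use c1 True in auto)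
      show "finite {x \<in> cls {c} {}. E c x = E z' x}"
        using q0(2) by (rule rev_finite_subset) (use c0 \<open>q0 = False\<close> in auto)
    qed
    ultimately show ?thesis unfolding par_def anti_def by blast
  next
    case False
    then have "q0 = True" using \<open>q1 \<noteq> q0\<close> by simp
    have "finite {x \<in> V. E c x = E z x}"
    proof (rule all)
      show "finite {x \<in> cls {c} {c}. E c x = E z x}"
        using q1(1) by (rule rev_finite_subset) (use c1 False in auto)
      show "finite {x \<in> cls {c} {}. E c x = E z x}"
        using q0(1) by (rule rev_finite_subset) (use c0 \<open>q0 = True\<close> in auto)
    qed
    moreover have "finite {x \<in> V. E c x \<noteq> E z' x}"
    proof (rule all)
      show "finite {x \<in> cls {c} {c}. E c x \<noteq> E z' x}"
        using q1(2) by (rule rev_finite_subset) (use c1 False in auto)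
      show "finite {x \<in> cls {c} {}. E c x \<noteq> E z' x}"
        using q0(2) by (rule rev_finite_subset) (use c0 \<open>q0 = True\<close> in auto)
    qed
    ultimately show ?thesis unfolding par_def anti_def by blast
  qed
qed

lemma ab_split: "par e a \<and> anti e b \<or> anti e a \<and> par e b"
  using par_anti_split[OF e ab] .

lemma exists_anti:
  assumes "x \<in> V"
  obtains y where "y \<in> V" "anti x y"
proof -
  obtain z where z: "z \<in> V" "anti e z" using ab_split abV by blast
  obtain g where g: "Aut g" "g e = x" using transitive[OF e assms] .
  have "anti x (g z)" using anti_Aut[OF g(1) e z(1)] g(2) z(2) by simp
  then show ?thesis using that Aut_in[OF g(1) z(1)] by blast
qed

text \<open>Moved so that \<open>x\<close> becomes \<open>e\<close>, the vertex \<open>y\<close>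
  acquires the type of \<open>a\<close> and \<open>b\<close>, and it fails to be conjugate to one of
  them.\<close>

lemma same_type_par_or_anti:
  assumes "x \<in> V" "y \<in> V" "x \<noteq> y" "E x y = E e a"
  shows "par x y \<or> anti x y"
proof -
  obtain g where g: "Aut g" "g x = e" using transitive[OF assms(1) e] .
  have gy: "g y \<in> V" "g y \<noteq> e" "E e (g y) = E e a"
    using Aut_in[OF g(1) assms(2)] Aut_eq_iff[OF g(1) assms(1,2)] Aut_E[OF g(1) assms(1,2)] g(2) assms(3,4)
    by auto
  have "nb a \<inter> {e} = Q" using ab(1) by (simp add: cls_def)
  moreover have "nb (g y) \<inter> {e} = nb a \<inter> {e}" using gy(3) E_sym by auto
  ultimately have gyQ: "g y \<in> cls {e} Q" using gy unfolding cls_def by simp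
  have "\<not> conj_over {e} (g y) a \<or> \<not> conj_over {e} (g y) b"
    using ab(3) conj_over_sym[OF _ _ gy(1), of "{e}" a] conj_over_trans e by blast
  then have "par e (g y) \<or> anti e (g y)"
    using par_anti_split[OF e gyQ ab(1)] par_anti_split[OF e gyQ ab(2)] by blast
  then show ?thesis using par_Aut[OF g(1) assms(1,2)] anti_Aut[OF g(1) assms(1,2)] g(2) by simp
qed

text \<open>If \<open>z\<close> were comparable to neither, the infinitely many vertices related to
  \<open>z\<close> by the value \<open>E e a\<close> would, by the rule of signs, be incomparable to
  \<open>e\<close> and to an opposite vertex \<open>o'\<close>. Both would relate to them by the
  other value, but \<open>e\<close> and \<open>o'\<close> agree only finitely often.\<close>

lemma par_or_anti_e:
  assumes z: "z \<in> V"
  shows "par e z \<or> anti e z"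
proof (rule ccontr)
  assume no: "\<not> (par e z \<or> anti e z)"
  obtain o' where o: "o' \<in> V" "anti e o'" using exists_anti[OF e] .
  define T where "T = {y \<in> V. y \<noteq> z \<and> E z y = E e a}"
  have "infinite T"
  proof (cases "E e a")
    case True
    have "nb z \<subseteq> T" unfolding T_def using True nb_subset by auto
    then show ?thesis using infinite_nb[OF z] finite_subset by blast
  next
    case False
    have "V - nb z \<subseteq> insert z T" unfolding T_def using False by auto
    then show ?thesis using infinite_conb[OF z] finite_subset by blast
  qed
  moreover have "T \<subseteq> {v \<in> V. E e v = E o' v}"
  proof
    fix y assume "y \<in> T"
    then have y: "y \<in> V" "par z y \<or> anti z y"
      unfolding T_def using same_type_par_or_anti[OF z, of y] by auto
    have 1: "\<not> (par e y \<or> anti e y)"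
      using no y(2) par_trans par_anti anti_anti par_sym anti_sym by metis
    have 2: "\<not> (par o' y \<or> anti o' y)"
      using 1 o(2) par_trans par_anti anti_anti par_sym anti_sym by metis
    have "e \<noteq> y" "o' \<noteq> y" using 1 2 par_refl by blast+
    then have "E e y \<noteq> E e a" "E o' y \<noteq> E e a"
      using 1 2 same_type_par_or_anti[OF e y(1)] same_type_par_or_anti[OF o(1) y(1)] by blast+
    then show "y \<in> {v \<in> V. E e v = E o' v}" using y(1) by auto
  qed
  ultimately show False using o(2) finite_subset unfolding anti_def by blast
qed

lemma par_or_anti:
  assumes "x \<in> V" "y \<in> V"
  shows "par x y \<or> anti x y"
  using par_or_anti_e[OF assms(1)] par_or_anti_e[OF assms(2)]
    par_trans par_anti anti_anti par_sym anti_sym by metis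

lemma two_cells:
  assumes "x \<in> V" "y \<in> V" "\<not> par x y"
  shows "V = cell x \<union> cell y" "cell x \<inter> cell y = {}"
proof -
  have "anti x y" using par_or_anti assms by blast
  have "par x z \<or> par y z" if "z \<in> V" for z
    using par_or_anti[OF assms(1) that] \<open>anti x y\<close> anti_anti anti_sym by blast
  then show "V = cell x \<union> cell y" unfolding cell_def by blast
  show "cell x \<inter> cell y = {}" unfolding cell_def using assms(3) par_sym par_trans by blast
qed

lemma infinite_cell:
  assumes "x \<in> V"
  shows "infinite (cell x)"
proof
  assume fin: "finite (cell x)"
  have fin': "finite (cell y)" if y: "y \<in> V" for y
  proof -
    obtain g where "Aut g" "g x = y" using transitive[OF assms y] .
    then show ?thesis using Aut_cell[OF _ assms] fin by (metis finite_imageI)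
  qed
  obtain y where y: "y \<in> V" "anti x y" using exists_anti[OF assms] .
  then have "\<not> par x y" using par_not_anti[OF V] by blast
  then show False using two_cells(1)[OF assms y(1)] fin fin'[OF y(1)] V by (metis finite_UnI)
qed

lemma par_conj_over:
  assumes "x \<in> cls {e} S" "y \<in> cls {e} S" "par e x" "par e y"
  shows "conj_over {e} x y"
  using par_anti_split[OF e assms(1,2)] assms(3,4) par_not_anti[OF V] by blast

text \<open>Members of a cell behave like \<open>e\<close> up to finite sets: a neighbour of
  \<open>e\<close> in the cell has few neighbours in \<open>Y\<close>, and a non-neighbour is
  adjacent to almost all of \<open>X\<close>. By \<open>par_conj_over\<close> the first number is
  constant, so \<open>no_infinite_biregular\<close> applies if both parts are infinite.\<close>

lemma cell_dichotomy_e: "finite (cell e \<inter> nb e) \<or> finite (cell e - nb e)"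
proof (rule ccontr)
  define X where "X = cell e \<inter> nb e"
  define Y where "Y = cell e - nb e"
  assume "\<not> (finite (cell e \<inter> nb e) \<or> finite (cell e - nb e))"
  then have inf: "infinite X" "infinite Y" by (simp_all add: X_def Y_def)
  have XV: "X \<subseteq> V" and YV: "Y \<subseteq> V" unfolding X_def Y_def using cell_subset by auto
  obtain x0 where x0: "x0 \<in> X" using inf(1) by (metis finite.emptyI ex_in_conv)
  have Xpar: "par e x" "x \<in> cls {e} {e}" if "x \<in> X" for x
    using that unfolding X_def cell_def cls_single_E[OF e] by auto
  show False
  proof (rule no_infinite_biregular[OF inf, of E])
    fix x assume x: "x \<in> X"
    show "finite {y \<in> Y. E x y}"
      using Xpar(1)[OF x] unfolding par_def
      by (rule rev_finite_subset) (use YV in \<open>auto simp: Y_def\<close>)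
    have "conj_over {e} x0 x" using par_conj_over Xpar x x0 by blast
    then obtain g where g: "Aut g" "g e = e" "g x0 = x" unfolding conj_over_def by blast
    have "g ` Y = Y"
      unfolding Y_def
      using Aut_image_Diff[OF g(1) cell_subset nb_subset] Aut_cell[OF g(1) e] Aut_nb[OF g(1) e] g(2)
      by simp
    from Aut_image_rel[OF g(1) YV this, of x0 True]
    have "{y \<in> Y. E x y} = g ` {y \<in> Y. E x0 y}" using g(3) x0 XV by auto
    moreover have "{y \<in> Y. E x0 y} \<subseteq> V" using YV by auto
    ultimately show "card {y \<in> Y. E x y} = card {y \<in> Y. E x0 y}"
      using card_Aut[OF g(1)] by simp
  next
    fix y assume y: "y \<in> Y"
    then have "par e y" unfolding Y_def cell_def by simp
    then show "finite {x \<in> X. \<not> E x y}"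
      unfolding par_def
      by (rule rev_finite_subset) (use XV E_sym[of y] in \<open>auto simp: X_def\<close>)
  qed
qed

lemma cell_dichotomy:
  "(\<forall>x\<in>V. finite (cell x \<inter> nb x)) \<or> (\<forall>x\<in>V. finite (cell x - nb x))"
proof -
  have "finite (cell x \<inter> nb x) \<longleftrightarrow> finite (cell e \<inter> nb e)"
    "finite (cell x - nb x) \<longleftrightarrow> finite (cell e - nb e)" if x: "x \<in> V" for x
  proof -
    obtain g where g: "Aut g" "g e = x" using transitive[OF e x] .
    have "cell x - nb x = g ` (cell e - nb e)"
      using Aut_image_Diff[OF g(1) cell_subset nb_subset] Aut_cell[OF g(1) e] Aut_nb[OF g(1) e] g(2)
      by simp
    moreover have "cell x \<inter> nb x = g ` (cell e \<inter> nb e)"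
      using inj_on_image_Int[OF Aut_inj[OF g(1)] cell_subset nb_subset]
        Aut_cell[OF g(1) e] Aut_nb[OF g(1) e] g(2) by simp
    moreover have "cell e - nb e \<subseteq> V" "cell e \<inter> nb e \<subseteq> V" using cell_subset by auto
    ultimately show "finite (cell x \<inter> nb x) \<longleftrightarrow> finite (cell e \<inter> nb e)"
      "finite (cell x - nb x) \<longleftrightarrow> finite (cell e - nb e)"
      using finite_Aut[OF g(1)] by simp_all
  qed
  then show ?thesis using cell_dichotomy_e by blast
qed

end

text \<open>The alternative of \<open>cell_dichotomy\<close> in which cells are almost complete; the
  other one becomes this in the complement.\<close>

locale clique_cells = edge_failure +
  assumes cell_nb: "\<And>x. x \<in> V \<Longrightarrow> finite (cell x - nb x)"
begin

text \<open>A vertex \<open>y\<close> of the opposite cell is adjacent to almost all of that cell,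
  and \<open>x\<close> opposes \<open>y\<close> almost everywhere.\<close>

lemma finite_cross:
  assumes "x \<in> V"
  shows "finite (cross x)"
proof -
  obtain y where y: "y \<in> V" "anti x y" using exists_anti[OF assms] .
  have np: "\<not> par x y" using y par_not_anti[OF V] by blast
  have "cross x \<subseteq> {v \<in> V. E x v = E y v} \<union> (cell y - nb y)"
  proof
    fix v assume v: "v \<in> cross x"
    then have "v \<in> V" "E x v" "v \<notin> cell x" unfolding cross_def using E_verts by auto
    then show "v \<in> {v \<in> V. E x v = E y v} \<union> (cell y - nb y)"
      using two_cells(1)[OF assms y(1) np] by auto
  qed
  then show ?thesis
    using y(2) cell_nb[OF y(1)] unfolding anti_def by (meson finite_UnI finite_subset)
qed

lemma Aut_cross: "Aut g \<Longrightarrow> x \<in> V \<Longrightarrow> g ` cross x = cross (g x)"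
  unfolding cross_def using Aut_image_Diff[OF _ nb_subset cell_subset] Aut_cell Aut_nb by simp

lemma cell_props:
  assumes "x \<in> V"
  shows "infinite (cell x)" "cell x \<subseteq> V" "\<And>y. y \<in> cell x \<Longrightarrow> finite (cell x - nb y)"
    "\<And>g y. Aut g \<Longrightarrow> y \<in> cell x \<Longrightarrow> g y \<in> cell x \<Longrightarrow> g ` cell x \<subseteq> cell x"
proof -
  show "infinite (cell x)" using infinite_cell[OF assms] .
  show "cell x \<subseteq> V" using cell_subset .
  show "finite (cell x - nb y)" if "y \<in> cell x" for y
    using that cell_nb[of y] cell_eq[of x y] unfolding cell_def by simp
  show "g ` cell x \<subseteq> cell x" if "Aut g" "y \<in> cell x" "g y \<in> cell x" for g y
  proof -
    have "par (g x) (g y)" "par x (g y)"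
      using that par_Aut[OF that(1) assms, of y] unfolding cell_def by auto
    then have "cell (g x) = cell x" using cell_eq by metis
    then show ?thesis using Aut_cell[OF that(1) assms] by simp
  qed
qed

definition width :: nat where
  "width = card (cell e - nb e)"

lemma card_cell_diff:
  assumes "y \<in> V" "x \<in> cell y"
  shows "card (cell y - nb x) = width"
proof -
  have x: "x \<in> V" "cell y = cell x" using assms(2) cell_eq unfolding cell_def by auto
  obtain g where g: "Aut g" "g e = x" using transitive[OF e x(1)] .
  have "cell x - nb x = g ` (cell e - nb e)"
    using Aut_image_Diff[OF g(1) cell_subset nb_subset] Aut_cell[OF g(1) e] Aut_nb[OF g(1) e] g(2)
    by simp
  moreover have "cell e - nb e \<subseteq> V" using cell_subset by auto
  ultimately show ?thesis unfolding width_def x(2) using card_Aut[OF g(1)] by simp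
qed

lemma width_ge_1: "width \<ge> 1"
proof -
  have "e \<in> cell e - nb e" using in_cell_self[OF e] by simp
  then show ?thesis unfolding width_def using cell_nb[OF e] by (metis One_nat_def Suc_leI card_gt_0_iff empty_iff)
qed

lemma cell_colouring:
  assumes "countable V" "x \<in> V"
  obtains c :: "'a \<Rightarrow> int" where "\<And>i. card {y \<in> cell x. c y = i} = width"
    "\<And>y z. y \<in> cell x \<Longrightarrow> z \<in> cell x \<Longrightarrow> E y z \<longleftrightarrow> c y \<noteq> c z"
proof (rule multipartite_colouring[of "cell x" width])
  show "infinite (cell x)" "cell x \<subseteq> V" using cell_props(1,2)[OF assms(2)] .
  show "finite (cell x - nb y)" "card (cell x - nb y) = width" if "y \<in> cell x" for y
    using cell_props(3)[OF assms(2) that] card_cell_diff[OF assms(2) that] .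
  show "g ` cell x \<subseteq> cell x" if "Aut g" "y \<in> cell x" "g y \<in> cell x" for g y
    using cell_props(4)[OF assms(2) that] .
qed (use assms(1) that in blast)+

lemma isomorphic_H1:
  assumes count: "countable V" and no_cross: "cross e = {}"
  shows "width \<ge> 2 \<and> M \<cong>\<^sub>g graph_H1 width"
proof -
  have cr: "cross x = {}" if x: "x \<in> V" for x
  proof -
    obtain g where "Aut g" "g e = x" using transitive[OF e x] .
    then show ?thesis using Aut_cross[OF _ e] no_cross by (metis image_empty)
  qed
  obtain y where y: "y \<in> V" "anti e y" using exists_anti[OF e] .
  have np: "\<not> par e y" using y par_not_anti[OF V] by blast
  note cells = two_cells[OF e y(1) np]
  obtain c1 :: "'a \<Rightarrow> int" where c1: "\<And>i. card {y \<in> cell e. c1 y = i} = width"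
    "\<And>y z. y \<in> cell e \<Longrightarrow> z \<in> cell e \<Longrightarrow> E y z \<longleftrightarrow> c1 y \<noteq> c1 z"
    using cell_colouring[OF count e] by blast
  obtain c2 :: "'a \<Rightarrow> int" where c2: "\<And>i. card {z \<in> cell y. c2 z = i} = width"
    "\<And>u z. u \<in> cell y \<Longrightarrow> z \<in> cell y \<Longrightarrow> E u z \<longleftrightarrow> c2 u \<noteq> c2 z"
    using cell_colouring[OF count y(1)] by blast
  define c where "c x = (if x \<in> cell e then (c1 x, True) else (c2 x, False))" for x
  have c1': "c x = (c1 x, True)" if "x \<in> cell e" for x using that by (simp add: c_def)
  have c2': "c x = (c2 x, False)" if "x \<in> cell y" for x using that cells(2) by (auto simp: c_def)
  have "blow_up W_H1 width c M"
    unfolding blow_up_def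
  proof (intro conjI allI ballI)
    fix i :: "int \<times> bool"
    have "{x \<in> V. c x = i} = (if snd i then {x \<in> cell e. c1 x = fst i} else {x \<in> cell y. c2 x = fst i})"
      using cells(1) c1' c2' by (cases i) (auto split: if_splits)
    then show "card {x \<in> V. c x = i} = width" using c1(1) c2(1) by simp
  next
    fix u v assume uv: "u \<in> V" "v \<in> V"
    have sep: "\<not> E p q" if "p \<in> cell e" "q \<in> cell y" for p q
    proof
      assume "E p q"
      moreover have "\<not> par p q"
        using that np par_sym par_trans unfolding cell_def by blast
      ultimately have "q \<in> cross p" by (simp add: in_cross)
      then show False using cr cell_subset that by blast
    qed
    consider "u \<in> cell e" "v \<in> cell e" | "u \<in> cell y" "v \<in> cell y"
      | "u \<in> cell e" "v \<in> cell y" | "u \<in> cell y" "v \<in> cell e"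
      using uv cells(1) by blast
    then show "E u v \<longleftrightarrow> W_H1 (c u) (c v)"
    proof cases
      case 1 then show ?thesis using c1(2) c1' by (simp add: W_H1_def)
    next
      case 2 then show ?thesis using c2(2) c2' by (simp add: W_H1_def)
    next
      case 3 then show ?thesis using sep c1' c2' by (simp add: W_H1_def)
    next
      case 4 then show ?thesis using sep[of v u] E_sym[of u v] c1' c2' by (simp add: W_H1_def)
    qed
  qed
  then have "M \<cong>\<^sub>g graph_H1 width"
    using blow_up_graph_H1 width_ge_1 by (rule blow_up_isomorphic)
  \<comment> \<open>Without edges between cells, the one of \<open>a\<close> and \<open>b\<close>
    that is \<open>anti\<close> to \<open>e\<close> is not adjacent to \<open>e\<close>. Hence
    neither is the other, which lies in \<open>cell e\<close> and is a second member of the class of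
    \<open>e\<close>.\<close>
  moreover have "width \<ge> 2"
  proof -
    obtain u v where uv: "u \<in> cls {e} Q" "par e u" "v \<in> cls {e} Q" "anti e v"
      using ab_split ab by blast
    have "\<not> par e v" using uv(4) par_not_anti[OF V] by blast
    have "\<not> E e v" using no_cross in_cross[of v e] \<open>\<not> par e v\<close> by blast
    have "nb u \<inter> {e} = nb v \<inter> {e}" using uv by (simp add: cls_def)
    then have "e \<in> nb u \<longleftrightarrow> e \<in> nb v" by blast
    then have "\<not> E e u" using \<open>\<not> E e v\<close> E_sym by simp
    moreover have "u \<noteq> e" "u \<in> V" using uv(1) by (auto simp: cls_def)
    ultimately have "{e, u} \<subseteq> cell e - nb e"
      using uv(2) in_cell_self[OF e] by (simp add: cell_def)
    then have "card {e, u} \<le> width" unfolding width_def by (intro card_mono cell_nb e)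
    then show ?thesis using \<open>u \<noteq> e\<close> by simp
  qed
  ultimately show ?thesis by blast
qed

section \<open>Edges between the two cells\<close>

lemma cross_opposite:
  assumes "x \<in> V" "y \<in> cross x" "y' \<in> cross x"
  shows "par y y'"
proof -
  have yV: "y \<in> V" "y' \<in> V" using assms(2,3) in_cross E_verts by blast+
  then have "anti x y" "anti x y'"
    using par_or_anti[OF assms(1)] assms(2,3) in_cross by blast+
  then show ?thesis using anti_anti anti_sym by blast
qed

lemma finite_cross_Union: "finite X \<Longrightarrow> X \<subseteq> V \<Longrightarrow> finite (\<Union>u\<in>X. cross u)"
  using finite_cross by (intro finite_UN_I) auto

text \<open>If \<open>y\<close> and \<open>y'\<close> were adjacent, \<open>y'\<close> could be
  moved over \<open>y\<close> to any neighbour \<open>w\<close> of \<open>y\<close> in their cell.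
  The image of \<open>x\<close> would be a common cross neighbour of \<open>y\<close> and
  \<open>w\<close>; but only finitely many \<open>w\<close> are reached from \<open>y\<close> by two
  cross edges.\<close>

lemma cross_independent:
  assumes x: "x \<in> V" and y: "y \<in> cross x" "y' \<in> cross x"
  shows "\<not> E y y'"
proof
  assume yy': "E y y'"
  have yV: "y \<in> V" "y' \<in> V" using y in_cross E_verts by blast+
  have cV: "cross y \<subseteq> V" using in_cross E_verts by blast
  have "finite ((\<Union>u\<in>cross y. cross u) \<union> (cell y - nb y))"
    using finite_cross_Union[OF finite_cross[OF yV(1)] cV] cell_nb[OF yV(1)] by simp
  then obtain w where w: "w \<in> cell y" "w \<notin> (\<Union>u\<in>cross y. cross u) \<union> (cell y - nb y)"
    using infinite_cell[OF yV(1)] by (meson finite_subset subsetI)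
  have "E y w" using w by auto
  moreover have "y' \<in> cell y" using cross_opposite[OF x y] yV by (simp add: cell_def)
  ultimately have "conj_over {y} y' w"
    using conj_over_clique[OF cell_props(1-3)[OF yV(1)] in_cell_self[OF yV(1)] _ w(1) yy'] by simp
  then obtain g where g: "Aut g" "g y = y" "g y' = w" unfolding conj_over_def by auto
  have "g x \<in> cross y"
    using Aut_E[OF g(1) x yV(1)] par_Aut[OF g(1) x yV(1)] g(2) y(1) in_cross cross_sym by auto
  moreover have "w \<in> cross (g x)"
    using Aut_E[OF g(1) x yV(2)] par_Aut[OF g(1) x yV(2)] g(3) y(2) in_cross by auto
  ultimately show False using w(2) by blast
qed

text \<open>Otherwise \<open>x\<close> could be moved over \<open>y'\<close> to a vertex
  \<open>w\<close> of its cell with no cross edge to the finite class of \<open>y'\<close>. The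
  image of \<open>y\<close> is still in that class and is adjacent to \<open>w\<close>. The
  conjugacy comes from a \<open>k\<close>-clique in the cell of \<open>x\<close>, joined to
  \<open>x\<close> and \<open>w\<close> and not to \<open>y'\<close>.\<close>

lemma cross_closed:
  assumes y: "y \<in> cross x" and y': "y' \<in> cell y" "\<not> E y y'"
  shows "E x y'"
proof (rule ccontr)
  assume n: "\<not> E x y'"
  have xy: "E x y" "\<not> par x y" "x \<in> V" "y \<in> V" using y in_cross E_verts by blast+
  have y'V: "y' \<in> V" "par y y'" using y' by (auto simp: cell_def)
  have np: "\<not> par x y'" using xy(2) y'V(2) par_sym par_trans by blast
  have "finite (\<Union>u\<in>cell y' - nb y'. cross u)"
    by (rule finite_cross_Union[OF cell_nb[OF y'V(1)]]) (use cell_subset in blast)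
  then obtain w where w: "w \<in> cell x" "w \<notin> (\<Union>u\<in>cell y' - nb y'. cross u)"
    using infinite_cell[OF xy(3)] by (meson finite_subset subsetI)
  have wV: "w \<in> V" "par x w" using w(1) by (auto simp: cell_def)
  have npw: "\<not> par w y'" using np wV(2) par_trans by blast
  have "y' \<in> cell y' - nb y'" using in_cell_self[OF y'V(1)] by simp
  then have nw: "\<not> E y' w" using w(2) npw in_cross par_sym by blast
  have "finite (insert x (insert w (cross y')))" using finite_cross[OF y'V(1)] by simp
  moreover have "{x, w} \<subseteq> cell x" using w(1) in_cell_self[OF xy(3)] by simp
  ultimately obtain D where D: "D \<subseteq> cell x - insert x (insert w (cross y'))" "finite D" "card D = k"
    "mono_set True D" "\<forall>u\<in>{x, w}. \<forall>d\<in>D. E u d"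
    using large_clique[OF cell_props(1-3)[OF xy(3)], of "{x, w}" "insert x (insert w (cross y'))" k]
    by (metis finite.emptyI finite.insertI)
  have in_cls: "v \<in> cls {y'} {}" if "v \<in> V" "\<not> par v y'" "\<not> E y' v" for v
    using that par_refl unfolding cls_single_nE by auto
  have "D \<subseteq> cls {y'} {}"
  proof
    fix d assume d: "d \<in> D"
    then have "d \<in> V" "par x d" "d \<notin> cross y'" using D(1) by (auto simp: cell_def)
    moreover from this have "\<not> par d y'" using np par_trans by blast
    ultimately show "d \<in> cls {y'} {}" using in_cls in_cross par_sym by blast
  qed
  moreover have "x \<in> cls {y'} {}" "w \<in> cls {y'} {}"
    using in_cls xy(3) np n wV(1) npw nw E_sym by blast+
  moreover have "{y'} \<subseteq> V" "x \<notin> D" "w \<notin> D" "\<forall>d\<in>D. E x d = True" "\<forall>d\<in>D. E w d = True"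
    using y'V D(1,5) by auto
  ultimately have "conj_over {y'} x w"
    using D(2-4) by (intro conj_over_mono_sets[of "{y'}" x "{}" w D "{}" D True True]) auto
  then obtain g where g: "Aut g" "g y' = y'" "g x = w" unfolding conj_over_def by auto
  have "g y \<in> V" using Aut_in[OF g(1) xy(4)] .
  moreover have "par (g y) y'" using par_Aut[OF g(1) xy(4) y'V(1)] g(2) y'V(2) by simp
  moreover have "\<not> E (g y) y'" using Aut_E[OF g(1) xy(4) y'V(1)] g(2) y'(2) by simp
  ultimately have gy: "g y \<in> cell y' - nb y'" using par_sym E_sym by (simp add: cell_def)
  have "g y \<in> cross w"
    using Aut_E[OF g(1) xy(3,4)] par_Aut[OF g(1) xy(3,4)] g(3) xy(1,2) in_cross by simp
  then have "w \<in> cross (g y)" using cross_sym by blast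
  then show False using w(2) gy by blast
qed

text \<open>So cross edges match whole non-adjacency classes of one cell with those of the
  other.\<close>

lemma cross_eq:
  assumes "y \<in> cross x"
  shows "cross x = cell y - nb y"
proof (intro equalityI subsetI)
  have xV: "x \<in> V" "y \<in> V" "\<not> par x y" using assms in_cross E_verts by blast+
  fix z assume z: "z \<in> cross x"
  then have "z \<in> V" using in_cross E_verts by blast
  then show "z \<in> cell y - nb y"
    using cross_opposite[OF xV(1) assms z] cross_independent[OF xV(1) assms z]
    by (simp add: cell_def)
next
  have xV: "\<not> par x y" using assms in_cross by blast
  fix z assume z: "z \<in> cell y - nb y"
  then have "par y z" "E x z" using cross_closed[OF assms, of z] by (auto simp: cell_def)
  then show "z \<in> cross x" using xV par_sym par_trans in_cross by blast
qed

lemma isomorphic_H2: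
  assumes count: "countable V" and ex_cross: "cross e \<noteq> {}"
  shows "M \<cong>\<^sub>g graph_H2 width"
proof -
  have cr: "cross x \<noteq> {}" if x: "x \<in> V" for x
  proof -
    obtain g where "Aut g" "g e = x" using transitive[OF e x] .
    then show ?thesis using Aut_cross[OF _ e] ex_cross by (metis image_is_empty)
  qed
  obtain o' where o: "o' \<in> V" "anti e o'" using exists_anti[OF e] .
  have np: "\<not> par e o'" using o par_not_anti[OF V] by blast
  note cells = two_cells[OF e o(1) np]
  obtain c1 :: "'a \<Rightarrow> int" where c1: "\<And>i. card {y \<in> cell e. c1 y = i} = width"
    "\<And>y z. y \<in> cell e \<Longrightarrow> z \<in> cell e \<Longrightarrow> E y z \<longleftrightarrow> c1 y \<noteq> c1 z"
    using cell_colouring[OF count e] by blast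
  \<comment> \<open>The colour \<open>c1 (r y)\<close> does not depend on the choice, since the
    cross neighbours of \<open>y\<close> form one class. The opposite cell thus inherits its
    colouring from \<open>cell e\<close>.\<close>
  define r where "r y = (SOME x. x \<in> cross y)" for y
  have r: "r y \<in> cross y" if "y \<in> V" for y
    using cr[OF that] unfolding r_def by (simp add: some_in_eq)
  have npar: "\<not> par x y" if "x \<in> cell e" "y \<in> cell o'" for x y
    using that np par_sym par_trans unfolding cell_def by blast
  have cV: "x \<in> V" if "x \<in> cell z" for x z using that cell_subset by blast
  have re: "r y \<in> cell e" if "y \<in> cell o'" for y
  proof -
    have "r y \<in> V" "\<not> par y (r y)" using r[OF cV[OF that]] in_cross E_verts by blast+
    then have "r y \<notin> cell o'" using that par_sym par_trans unfolding cell_def by blast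
    then show ?thesis using cells(1) \<open>r y \<in> V\<close> by blast
  qed
  have cross_adj: "E x y \<longleftrightarrow> c1 x = c1 (r y)" if xy: "x \<in> cell e" "y \<in> cell o'" for x y
  proof -
    have "E x y \<longleftrightarrow> x \<in> cross y" using npar[OF xy] in_cross cross_sym by blast
    also have "\<dots> \<longleftrightarrow> x \<in> cell (r y) - nb (r y)" using cross_eq[OF r[OF cV[OF xy(2)]]] by simp
    also have "cell (r y) = cell e" using re[OF xy(2)] cell_eq[of e "r y"] unfolding cell_def by blast
    finally show ?thesis using xy c1(2)[OF xy(1) re[OF xy(2)]] E_sym by auto
  qed
  define c where "c x = (if x \<in> cell e then (c1 x, True) else (c1 (r x), False))" for x
  have c1': "c x = (c1 x, True)" if "x \<in> cell e" for x using that by (simp add: c_def)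
  have c2': "c x = (c1 (r x), False)" if "x \<in> cell o'" for x using that cells(2) by (auto simp: c_def)
  have "blow_up W_H2 width c M"
    unfolding blow_up_def
  proof (intro conjI allI ballI)
    fix i :: "int \<times> bool"
    show "card {x \<in> V. c x = i} = width"
    proof (cases "snd i")
      case True
      then have "{x \<in> V. c x = i} = {x \<in> cell e. c1 x = fst i}"
        using cells(1) c1' c2' by (cases i) auto
      then show ?thesis using c1(1) by simp
    next
      case False
      \<comment> \<open>On the opposite side the fibre of a colour is \<open>cross x\<close> for any
        \<open>x\<close> in \<open>cell e\<close> of that colour, hence a full class of size
        \<open>width\<close>.\<close>
      have "{x \<in> cell e. c1 x = fst i} \<noteq> {}"
        using c1(1)[of "fst i"] width_ge_1 by (metis card.empty not_one_le_zero)
      then obtain x where x: "x \<in> cell e" "c1 x = fst i" by blast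
      obtain y where y: "y \<in> cross x" using cr[OF cV[OF x(1)]] by blast
      have yV: "y \<in> V" using y in_cross E_verts by blast
      have "z \<in> cross x \<longleftrightarrow> z \<in> cell o' \<and> E x z" for z
      proof
        assume "z \<in> cross x"
        then have "E x z" "\<not> par x z" "z \<in> V" using in_cross E_verts by blast+
        then show "z \<in> cell o' \<and> E x z"
          using cells(1) x(1) par_sym par_trans unfolding cell_def by blast
      qed (use npar[OF x(1)] in_cross in blast)
      then have "{z \<in> V. c z = i} = cross x"
        using False cells(1) c1' c2' x cross_adj[OF x(1)] by (cases i) auto
      then have "{z \<in> V. c z = i} = cell y - nb y" using cross_eq[OF y] by simp
      then show ?thesis using card_cell_diff[OF yV in_cell_self[OF yV]] by simp
    qed
  next
    fix u v assume uv: "u \<in> V" "v \<in> V"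
    have opp: "E y z \<longleftrightarrow> c1 (r y) \<noteq> c1 (r z)" if yz: "y \<in> cell o'" "z \<in> cell o'" for y z
    proof -
      have ry: "y \<in> cross (r y)" using r[OF cV[OF yz(1)]] cross_sym by blast
      have rV: "r y \<in> V" using re[OF yz(1)] cV by blast
      have "cell y = cell o'" using yz(1) cell_eq[of o' y] unfolding cell_def by blast
      have "z \<in> cross (r y) \<longleftrightarrow> c1 (r y) = c1 (r z)"
        using cross_adj[OF re[OF yz(1)] yz(2)] npar[OF re[OF yz(1)] yz(2)] in_cross by blast
      moreover have "z \<in> cross (r y) \<longleftrightarrow> \<not> E y z"
        using cross_eq[OF ry] \<open>cell y = cell o'\<close> yz(2) by simp
      ultimately show ?thesis by blast
    qed
    consider "u \<in> cell e" "v \<in> cell e" | "u \<in> cell o'" "v \<in> cell o'"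
      | "u \<in> cell e" "v \<in> cell o'" | "u \<in> cell o'" "v \<in> cell e"
      using uv cells(1) by blast
    then show "E u v \<longleftrightarrow> W_H2 (c u) (c v)"
    proof cases
      case 1 then show ?thesis using c1(2) c1' by (simp add: W_H2_def)
    next
      case 2 then show ?thesis using opp c2' by (simp add: W_H2_def)
    next
      case 3 then show ?thesis using cross_adj c1' c2' by (simp add: W_H2_def)
    next
      case 4
      then have "E u v \<longleftrightarrow> c1 v = c1 (r u)" using cross_adj[of v u] E_sym[of u v] by simp
      then show ?thesis using 4 c1' c2' by (auto simp: W_H2_def)
    qed
  qed
  then show ?thesis using blow_up_graph_H2 width_ge_1 by (rule blow_up_isomorphic)
qed

end

section \<open>The classification\<close>

lemma edge_failure_intro:
  assumes "simple_graph M" "ge_k_homogeneous k M" "infinite (verts M)"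
    "k_homogeneous 1 M" "\<not> k_homogeneous 2 M"
  obtains e a b Q where "edge_failure M k e a b Q"
proof -
  interpret ge_hom_graph M k using assms(1,2) by unfold_locales
  obtain F Q a b where F: "finite F" "F \<subseteq> V" "card F = 2 - 1" "a \<in> cls F Q" "b \<in> cls F Q"
    "\<not> conj_over F a b"
    by (rule non_homogeneous_witness[OF assms(5)]) (use assms(4) in auto)
  then obtain e where "F = {e}" by (auto simp: card_1_singleton_iff)
  then have "edge_failure M k e a b Q"
    using F assms(3,4) by unfold_locales auto
  then show ?thesis using that by blast
qed

lemma clique_cells_structure:
  assumes "clique_cells M k e a b Q" "countable (verts M)"
  shows "(\<exists>t\<ge>2. M \<cong>\<^sub>g graph_H1 t) \<or> (\<exists>t\<ge>1. M \<cong>\<^sub>g graph_H2 t)"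
proof -
  interpret clique_cells M k e a b Q by fact
  show ?thesis using isomorphic_H1 isomorphic_H2 width_ge_1 assms(2) by blast
qed

lemma ge_k_homogeneous_complement:
  "simple_graph M \<Longrightarrow> ge_k_homogeneous k (complement M) \<longleftrightarrow> ge_k_homogeneous k M"
  unfolding ge_k_homogeneous_def by (simp add: k_homogeneous_complement)

lemma isomorphic_complement_iff:
  "simple_graph M \<Longrightarrow> simple_graph N \<Longrightarrow> complement M \<cong>\<^sub>g N \<longleftrightarrow> M \<cong>\<^sub>g complement N"
  by (metis complement_complement graph_isomorphic_complement)

text \<open>If the cells are almost independent, the complement is considered with a new witness of
  failure; its cells are the same sets by \<open>par_complement\<close> and are now almost
  complete.\<close>

lemma not_two_homogeneous_structure:
  assumes M: "simple_graph M" "ge_k_homogeneous k M" "infinite (verts M)" "countable (verts M)"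
    "k_homogeneous 1 M" "\<not> k_homogeneous 2 M"
  shows "(\<exists>t\<ge>2. M \<cong>\<^sub>g graph_H1 t \<or> M \<cong>\<^sub>g complement (graph_H1 t)) \<or>
    (\<exists>t\<ge>1. M \<cong>\<^sub>g graph_H2 t \<or> M \<cong>\<^sub>g complement (graph_H2 t))"
proof -
  obtain e a b Q where ef: "edge_failure M k e a b Q" using edge_failure_intro[OF M(1-3,5,6)] .
  interpret edge_failure M k e a b Q by fact
  show ?thesis
  proof (cases "\<forall>x\<in>V. finite (cell x - nb x)")
    case True
    then have "clique_cells M k e a b Q"
      using ef unfolding clique_cells_def clique_cells_axioms_def by blast
    from clique_cells_structure[OF this M(4)] show ?thesis by blast
  next
    case False
    then have alt: "\<forall>x\<in>V. finite (cell x \<inter> nb x)" using cell_dichotomy by blast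
    let ?N = "complement M"
    have N: "simple_graph ?N" "ge_k_homogeneous k ?N" "infinite (verts ?N)"
      "k_homogeneous 1 ?N" "\<not> k_homogeneous 2 ?N"
      using M simple_graph_complement[OF M(1)] ge_k_homogeneous_complement[OF M(1)]
        k_homogeneous_complement[OF M(1)] by simp_all
    obtain e' a' b' Q' where "edge_failure ?N k e' a' b' Q'" using edge_failure_intro[OF N] .
    then interpret N: edge_failure ?N k e' a' b' Q' .
    have "finite (N.cell x - N.nb x)" if x: "x \<in> verts ?N" for x
    proof -
      have "N.par x y \<longleftrightarrow> par x y" if "y \<in> V" for y
        using par_complement[of x y] x that unfolding N.par_def by simp
      then have "N.cell x = cell x" unfolding N.cell_def cell_def by auto
      then have "N.cell x - N.nb x \<subseteq> insert x (cell x \<inter> nb x)"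
        using x unfolding N.nb_def cell_def by (auto simp: adj_complement)
      moreover have "finite (insert x (cell x \<inter> nb x))" using alt x by simp
      ultimately show ?thesis by (rule finite_subset)
    qed
    then have "clique_cells ?N k e' a' b' Q'"
      using N.edge_failure_axioms unfolding clique_cells_def clique_cells_axioms_def by blast
    then have "(\<exists>t\<ge>2. ?N \<cong>\<^sub>g graph_H1 t) \<or> (\<exists>t\<ge>1. ?N \<cong>\<^sub>g graph_H2 t)"
      by (rule clique_cells_structure) (use M(4) in simp)
    then show ?thesis
      using isomorphic_complement_iff[OF M(1)] simple_graph_H1 simple_graph_H2 by blast
  qed
qed

text \<open>When the finite orbit is \<open>cofin_deg\<close>, complementing turns it into the
  vertices of finite degree, and \<open>nontransitive_structure\<close> applies there.\<close>

lemma not_one_homogeneous_structure: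
  assumes M: "simple_graph M" "ge_k_homogeneous k M" "infinite (verts M)" "countable (verts M)"
    "\<not> k_homogeneous 1 M"
  shows "\<exists>(H :: nat ugraph) t. simple_graph H \<and> finite (verts H) \<and> homogeneous H \<and> t \<ge> 1 \<and>
    (M \<cong>\<^sub>g graph_G t \<union>\<^sub>g H \<or> M \<cong>\<^sub>g complement (graph_G t \<union>\<^sub>g H))"
proof -
  have witness: "\<exists>a b. a \<in> verts N \<and> b \<in> verts N \<and> \<not> sgraph.conj_over N {} a b"
    if N: "simple_graph N" "\<not> k_homogeneous 1 N" for N :: "'a ugraph"
  proof -
    interpret N: sgraph N using N(1) by unfold_locales
    show ?thesis
      using N.non_homogeneous_witness[OF N(2)] N.cls_subset
      by (metis card_0_eq diff_self_eq_0 order_refl subsetD)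
  qed
  interpret ge_hom_graph M k using M(1,2) by unfold_locales
  obtain a b where ab: "a \<in> V" "b \<in> V" "\<not> conj_over {} a b" using witness[OF M(1,5)] by blast
  show ?thesis
  proof (cases "finite fin_deg")
    case True
    then show ?thesis using nontransitive_structure[OF M(3,4) ab] by blast
  next
    case False
    then have fin: "finite cofin_deg" using nontransitive_orbits(4)[OF M(3) ab] by blast
    let ?N = "complement M"
    have N: "simple_graph ?N" "ge_k_homogeneous k ?N" "\<not> k_homogeneous 1 ?N"
      using M simple_graph_complement[OF M(1)] ge_k_homogeneous_complement[OF M(1)]
        k_homogeneous_complement[OF M(1)] by simp_all
    interpret N: ge_hom_graph ?N k using N(1,2) by unfold_locales
    obtain a' b' where ab': "a' \<in> verts ?N" "b' \<in> verts ?N" "\<not> N.conj_over {} a' b'"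
      using witness[OF N(1,3)] by blast
    have "V - nb x \<subseteq> insert x (N.nb x)" if "x \<in> V" for x
      unfolding N.nb_def nb_def using that by (auto simp: adj_complement)
    then have "N.fin_deg \<subseteq> cofin_deg"
      unfolding N.fin_deg_def cofin_deg_def by (auto intro: finite_subset)
    then have "finite N.fin_deg" using fin finite_subset by blast
    then obtain H :: "nat ugraph" and t where H: "simple_graph H" "finite (verts H)" "homogeneous H"
      "t \<ge> 1" "?N \<cong>\<^sub>g graph_G t \<union>\<^sub>g H"
      using N.nontransitive_structure[OF _ _ ab'] M(3,4) by auto
    then have "M \<cong>\<^sub>g complement (graph_G t \<union>\<^sub>g H)"
      using isomorphic_complement_iff[OF M(1)] simple_graph_disjoint_union[OF simple_graph_G] by blast
    then show ?thesis using H by blast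
  qed
qed

lemma homogeneous_if_one_two:
  assumes M: "simple_graph M" "ge_k_homogeneous k M" "infinite (verts M)"
    "k_homogeneous 1 M" "k_homogeneous 2 M"
  shows "homogeneous M"
  unfolding homogeneous_def
proof (rule ccontr)
  interpret ge_hom_graph M k using M(1,2) by unfold_locales
  assume "\<not> (\<forall>t\<ge>1. k_homogeneous t M)"
  then obtain r where r: "r \<ge> 1 \<and> \<not> k_homogeneous r M"
    "\<And>s. s < r \<Longrightarrow> \<not> (s \<ge> 1 \<and> \<not> k_homogeneous s M)"
    using exists_least_iff[of "\<lambda>r. r \<ge> 1 \<and> \<not> k_homogeneous r M"] by blast
  have "r \<noteq> 1" "r \<noteq> 2" using r(1) M(4,5) by metis+
  then have "r \<ge> 3" using r(1) by linarith
  then have hom: "k_homogeneous (r - 1) M" using r(2)[of "r - 1"] by force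
  obtain F Q a b where F: "finite F" "F \<subseteq> V" "card F = r - 1" "a \<in> cls F Q" "b \<in> cls F Q"
    "\<not> conj_over F a b"
    using non_homogeneous_witness[of r] r(1) hom by metis
  moreover have "2 \<le> card F" using F(3) \<open>r \<ge> 3\<close> by linarith
  ultimately show False
    using no_late_failure[OF M(3), of F a Q b] hom M(5) by simp
qed

lemma ge_k_homogeneous_iso_complement:
  assumes "M \<cong>\<^sub>g X \<or> M \<cong>\<^sub>g complement X" "simple_graph X" "\<And>n. n \<ge> k \<Longrightarrow> k_homogeneous n X"
  shows "ge_k_homogeneous k M"
  unfolding ge_k_homogeneous_def
  using assms k_homogeneous_iso graph_isomorphic_sym k_homogeneous_complement by blast

text \<open>\<open>H\<close> is taken on \<open>nat\<close> because types cannot be quantified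
  existentially in HOL; every finite graph has a copy there.\<close>

theorem theorem1:
  fixes M :: "'v ugraph"
  assumes "simple_graph M" and "countable (verts M)" and "infinite (verts M)"
  shows "(\<exists>k\<ge>1. ge_k_homogeneous k M) \<longleftrightarrow>
    exactly_one_of_three
      (homogeneous M)
      (\<not> k_homogeneous 1 M \<and>
       (\<exists>(H :: nat ugraph) t. simple_graph H \<and> finite (verts H) \<and> homogeneous H \<and> t \<ge> 1 \<and>
          (M \<cong>\<^sub>g graph_G t \<union>\<^sub>g H \<or> M \<cong>\<^sub>g complement (graph_G t \<union>\<^sub>g H))))
      (k_homogeneous 1 M \<and> \<not> k_homogeneous 2 M \<and>
       ((\<exists>t\<ge>2. M \<cong>\<^sub>g graph_H1 t \<or> M \<cong>\<^sub>g complement (graph_H1 t)) \<or>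
        (\<exists>t\<ge>1. M \<cong>\<^sub>g graph_H2 t \<or> M \<cong>\<^sub>g complement (graph_H2 t))))"
  (is "?L \<longleftrightarrow> exactly_one_of_three ?I (\<not> ?k1 \<and> ?II) (?k1 \<and> \<not> ?k2 \<and> ?III)")
proof -
  \<comment> \<open>The homogeneity clauses make the alternatives mutually exclusive, so exactly one
    holds as soon as one does.\<close>
  have "?I \<Longrightarrow> ?k1" "?I \<Longrightarrow> ?k2" unfolding homogeneous_def by auto
  then have "exactly_one_of_three ?I (\<not> ?k1 \<and> ?II) (?k1 \<and> \<not> ?k2 \<and> ?III) \<longleftrightarrow>
    ?I \<or> (\<not> ?k1 \<and> ?II) \<or> (?k1 \<and> \<not> ?k2 \<and> ?III)"
    unfolding exactly_one_of_three_def by blast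
  moreover have "?I \<or> (\<not> ?k1 \<and> ?II) \<or> (?k1 \<and> \<not> ?k2 \<and> ?III)" if L: ?L
  proof -
    obtain k where k: "ge_k_homogeneous k M" using L by blast
    show ?thesis
      using not_one_homogeneous_structure[OF assms(1) k assms(3,2)]
        not_two_homogeneous_structure[OF assms(1) k assms(3,2)]
        homogeneous_if_one_two[OF assms(1) k assms(3)]
      by blast
  qed
  moreover have ?L if I: ?I
    using I unfolding homogeneous_def ge_k_homogeneous_def by blast
  moreover have ?L if II: ?II
  proof -
    obtain H :: "nat ugraph" and t where H: "simple_graph H" "finite (verts H)" "homogeneous H" "t \<ge> 1"
      "M \<cong>\<^sub>g graph_G t \<union>\<^sub>g H \<or> M \<cong>\<^sub>g complement (graph_G t \<union>\<^sub>g H)"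
      using II by blast
    have "ge_k_homogeneous (t * (card (verts H) + 1) + 1 + card (verts H)) M"
      by (rule ge_k_homogeneous_iso_complement[OF H(5)])
        (use H simple_graph_disjoint_union[OF simple_graph_G] graph_G_union_homogeneous in auto)
    then show ?L by (rule exI[of _ "t * (card (verts H) + 1) + 1 + card (verts H)", OF conjI[rotated]]) simp
  qed
  moreover have ?L if III: ?III
  proof -
    from III obtain t where "ge_k_homogeneous (6 * t + 1) M"
    proof (elim disjE exE conjE)
      fix t :: nat assume t: "2 \<le> t" and M: "M \<cong>\<^sub>g graph_H1 t"
      show ?thesis
        by (rule that[of t], rule ge_k_homogeneous_iso_complement[of M "graph_H1 t"])
          (use t M simple_graph_H1 blow_up_H1_homogeneous[OF blow_up_graph_H1] in auto)
    next
      fix t :: nat assume t: "2 \<le> t" and M: "M \<cong>\<^sub>g complement (graph_H1 t)"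
      show ?thesis
        by (rule that[of t], rule ge_k_homogeneous_iso_complement[of M "graph_H1 t"])
          (use t M simple_graph_H1 blow_up_H1_homogeneous[OF blow_up_graph_H1] in auto)
    next
      fix t :: nat assume t: "1 \<le> t" and M: "M \<cong>\<^sub>g graph_H2 t"
      show ?thesis
        by (rule that[of t], rule ge_k_homogeneous_iso_complement[of M "graph_H2 t"])
          (use t M simple_graph_H2 blow_up_H2_homogeneous[OF blow_up_graph_H2] in auto)
    next
      fix t :: nat assume t: "1 \<le> t" and M: "M \<cong>\<^sub>g complement (graph_H2 t)"
      show ?thesis
        by (rule that[of t], rule ge_k_homogeneous_iso_complement[of M "graph_H2 t"])
          (use t M simple_graph_H2 blow_up_H2_homogeneous[OF blow_up_graph_H2] in auto)
    qed
    then show ?L by (intro exI[of _ "6 * t + 1"]) simp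
  qed
  ultimately show ?thesis by blast
qed

end
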